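(* Let $G$ be a finite group, let $p$ and $r$ be two prime numbers, let $P$ be a Sylow $p$-subgroup of $G$, and assume that $\gcd(|N_G(P)|, 2r) = 1$. If $\chi$ is an irreducible complex character of $G$ with $p \nmid \chi(1)$ and with all values in $\mathbb{Q}_r$, then $N \leq \ker(\chi)$ for every $p$-solvable normal subgroup $N$ of $G$.
   Context: $\mathbb{Q}_n$ denotes the $n$-th cyclotomic field $\mathbb{Q}(\zeta)$ with $\zeta$ a primitive complex $n$-th root of unity (not the $p$-adic numbers). $N_G(P)$ is the normalizer of $P$ in $G$. A finite group is $p$-solvable if each of its composition factors is either of order $p$ or of order not divisible by $p$. *)

theory Defs
  imports
    "HOL-Algebra.Group_Action"
    "HOL-Algebra.SimpleGroups"
    "HOL-Algebra.Generated_Fields"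
    "HOL-Computational_Algebra.Primes"
    "Jordan_Normal_Form.Matrix"
    "Jordan_Normal_Form.VS_Connect"
begin

definition sylow_subgroup :: "('a, 'b) monoid_scheme \<Rightarrow> nat \<Rightarrow> 'a set \<Rightarrow> bool" where
  "sylow_subgroup G p P \<longleftrightarrow> subgroup P G \<and> card P = p ^ multiplicity p (Coset.order G)"

text \<open>A composition series is listed from the trivial subgroup up to the whole group.\<close>

definition composition_series :: "('a, 'b) monoid_scheme \<Rightarrow> 'a set list \<Rightarrow> bool" where
  "composition_series G Hs \<longleftrightarrow>
     Hs \<noteq> [] \<and> hd Hs = {\<one>\<^bsub>G\<^esub>} \<and> last Hs = carrier G \<and>
     (\<forall>i. Suc i < length Hs \<longrightarrow>
        subgroup (Hs ! Suc i) G \<and>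
        Hs ! i \<lhd> G\<lparr>carrier := Hs ! Suc i\<rparr> \<and>
        simple_group (G\<lparr>carrier := Hs ! Suc i\<rparr> Mod (Hs ! i)))"

definition composition_factor ::
  "('a, 'b) monoid_scheme \<Rightarrow> 'a set monoid \<Rightarrow> bool" where
  "composition_factor G Q \<longleftrightarrow>
     (\<exists>Hs i. composition_series G Hs \<and> Suc i < length Hs \<and>
        Q = G\<lparr>carrier := Hs ! Suc i\<rparr> Mod (Hs ! i))"

definition p_solvable :: "nat \<Rightarrow> ('a, 'b) monoid_scheme \<Rightarrow> bool" where
  "p_solvable p G \<longleftrightarrow>
     group G \<and> finite (carrier G) \<and>
     (\<forall>Q. composition_factor G Q \<longrightarrow> Coset.order Q = p \<or> \<not> p dvd Coset.order Q)"

text \<open>Complex representations are taken in matrix form: the unit group of the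
  ring of complex matrices of size \<open>n\<close> is the general linear group.\<close>

definition representation ::
  "('a, 'b) monoid_scheme \<Rightarrow> nat \<Rightarrow> ('a \<Rightarrow> complex mat) \<Rightarrow> bool" where
  "representation G n \<rho> \<longleftrightarrow> \<rho> \<in> hom G (units_of (ring_mat TYPE(complex) n ()))"

definition irreducible_representation ::
  "('a, 'b) monoid_scheme \<Rightarrow> nat \<Rightarrow> ('a \<Rightarrow> complex mat) \<Rightarrow> bool" where
  "irreducible_representation G n \<rho> \<longleftrightarrow>
     representation G n \<rho> \<and> n > 0 \<and>
     (\<forall>W. VectorSpace.subspace class_ring W (module_vec TYPE(complex) n) \<and>
          (\<forall>g\<in>carrier G. \<forall>w\<in>W. \<rho> g *\<^sub>v w \<in> W) \<longrightarrow>
          W = {0\<^sub>v n} \<or> W = carrier_vec n)"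

definition mat_trace :: "'a :: comm_monoid_add mat \<Rightarrow> 'a" where
  "mat_trace A = (\<Sum>i<dim_row A. A $$ (i, i))"

text \<open>Only the values of a character on the carrier are meaningful.\<close>

definition irreducible_character ::
  "('a, 'b) monoid_scheme \<Rightarrow> ('a \<Rightarrow> complex) \<Rightarrow> bool" where
  "irreducible_character G \<chi> \<longleftrightarrow>
     (\<exists>n \<rho>. irreducible_representation G n \<rho> \<and>
            (\<forall>g\<in>carrier G. \<chi> g = mat_trace (\<rho> g)))"

definition character_kernel ::
  "('a, 'b) monoid_scheme \<Rightarrow> ('a \<Rightarrow> complex) \<Rightarrow> 'a set" where
  "character_kernel G \<chi> = {g \<in> carrier G. \<chi> g = \<chi> \<one>\<^bsub>G\<^esub>}"

text \<open>For \<open>n > 0\<close> the number \<open>cis (2 * pi / n)\<close> is a primitive \<open>n\<close>-th root of unity;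
  the subfield generated by it contains the rationals.\<close>

definition cyclotomic_field :: "nat \<Rightarrow> complex set" where
  "cyclotomic_field n = generate_field class_ring {cis (2 * pi / real n)}"

end

theory Submission
  imports Defs
    "HOL-Algebra.Zassenhaus"
    "HOL-Computational_Algebra.Fundamental_Theorem_Algebra"
    "HOL-Number_Theory.Cong"
    "Jordan_Normal_Form.Schur_Decomposition"
begin

text \<open>Let \<open>\<chi>\<close> be afforded by \<open>\<rho>\<close>. If \<open>\<rho>(N)\<close> were nontrivial, a composition series of \<open>N\<close> would
  yield a nontrivial normal subgroup \<open>M\<close> of \<open>\<rho>(G)\<close> which is a \<open>p\<close>-group or a \<open>p'\<close>-group; the
  hypotheses pass to \<open>\<rho>(G)\<close> by a Frattini argument, so we may work there.

  By irreducibility the constituents \<open>\<theta>\<close> of \<open>\<chi>\<close> on \<open>M\<close> form one \<open>G\<close>-orbit \<open>\<Omega>\<close> whose length divides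
  \<open>\<chi>(1)\<close>, so \<open>P\<close> fixes some of them, and by Sylow's theorem those are conjugate under \<open>N_G(P)\<close>.
  Choose \<open>s\<close> prime to \<open>|G|\<close> with \<open>s \<equiv> -1\<close> modulo \<open>|N_G(P)|\<close> and \<open>s \<equiv> 1\<close> modulo \<open>r\<close>. The Galois
  automorphism \<open>\<zeta> \<mapsto> \<zeta>^s\<close> fixes \<open>\<chi>\<close>, hence maps a \<open>P\<close>-fixed \<open>\<theta>\<close> to a conjugate under some \<open>x\<close> in \<open>N_G(P)\<close>;
  since \<open>|N_G(P)|\<close> is odd, an odd power of it fixes \<open>\<theta>\<close>, which means that \<open>\<theta>\<close> is real on
  \<open>C = C_M(P)\<close>.

  If \<open>\<theta> \<noteq> 1\<close>, then modulo \<open>p\<close> and up to factors prime to \<open>p\<close>, the sum of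
  \<open>\<theta>(m) \<theta>(m\<inverse>)\<close> over \<open>M\<close> is that of \<open>\<theta>(c)\<^sup>2\<close> over \<open>C\<close>, then that of \<open>\<theta>(c c\<^sup>x)\<close> over
  \<open>c, x \<in> C\<close>, and, since \<open>C\<close> has odd order, that of \<open>\<theta>\<close> over \<open>C\<close> and over \<open>M\<close>, which is \<open>0\<close>.
  But the first sum is \<open>|M|\<close>, which is prime to \<open>p\<close>. (If \<open>M\<close> is a \<open>p\<close>-group, it lies in \<open>N_G(P)\<close>
  and the same computation works exactly with \<open>C = M\<close>.) So \<open>\<theta> = 1\<close>, and \<open>M\<close> acts trivially.\<close>

section \<open>Integral polynomials at roots of unity\<close>

text \<open>Two objects are avoided on purpose. No Galois group is built: an automorphism acts only
  through the fact that an integral polynomial relation at a root of unity \<open>z\<close> persists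
  when \<open>z\<close> is replaced by \<open>z ^ s\<close>, for \<open>s\<close> prime to the
  order. Character values must therefore be written as F(z) with one F that serves all exponents. No
  constituent of the restriction to M is built either: \<theta> is represented by \<theta> /
  \<theta>(1), which satisfies a functional equation that both conjugation and the exponent
  \<open>s\<close> respect. The condition on |N_G(P)| enters three times. Being prime to r makes the
  two congruences for \<open>s\<close> compatible; being odd makes the relevant power of -1 equal to
  -1, and makes squaring bijective on C. The congruences modulo p live in Z[z], where p Z[z] meets Z
  in p Z. To get there \<theta> / \<theta>(1) is multiplied by d = \<chi>(1) / |\<Omega>|, the trace
  of its isotypic projection, and the functional equation costs a factor |M|. Both are prime to p,
  so the final statement that p divides |M|^2 d^2 is absurd.\<close>

abbreviation ipoly :: "int poly \<Rightarrow> complex \<Rightarrow> complex" where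
  "ipoly F z \<equiv> poly (of_int_poly F) z"

lemma ipoly_pCons: "ipoly (pCons a F) z = of_int a + z * ipoly F z"
  by (cases "a = 0 \<and> F = 0") (auto simp: map_poly_pCons)

lemma ipoly_add: "ipoly (F + G) z = ipoly F z + ipoly G z"
  and ipoly_diff: "ipoly (F - G) z = ipoly F z - ipoly G z"
  and ipoly_uminus: "ipoly (- F) z = - ipoly F z"
  and ipoly_mult: "ipoly (F * G) z = ipoly F z * ipoly G z"
  and ipoly_power: "ipoly (F ^ k) z = ipoly F z ^ k"
  by (simp_all add: of_int_poly_hom.hom_add of_int_poly_hom.hom_minus of_int_poly_hom.hom_uminus
      of_int_poly_hom.hom_mult of_int_poly_hom.hom_power)

lemma ipoly_of_nat: "ipoly (of_nat k) z = of_nat k"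
  unfolding of_nat_poly by (simp add: ipoly_pCons)

lemma ipoly_pcompose: "ipoly (pcompose F G) z = ipoly F (ipoly G z)"
proof (induction F)
  case (pCons a F)
  then show ?case
    by (simp add: pcompose_pCons ipoly_add ipoly_mult ipoly_pCons)
qed simp

lemma ipoly_monom: "ipoly (monom 1 k) z = z ^ k"
  by (simp add: poly_monom)

lemma root_power_mod:
  fixes z :: "'a::monoid_mult"
  assumes "z ^ n = 1"
  shows "z ^ (k mod n) = z ^ k"
proof -
  have "z ^ k = z ^ (n * (k div n) + k mod n)" by simp
  also have "\<dots> = z ^ (k mod n)" unfolding power_add power_mult assms by simp
  finally show ?thesis by simp
qed

text \<open>\<open>A\<close> describes multiplication by F(z) on 1, z, ..., z^(n-1), with indices
  wrapping around because \<open>z ^ n = 1\<close>. So \<open>v\<close> is an eigenvector, and F(z)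
  is a root of a monic integral characteristic polynomial.\<close>

lemma algebraic_int_ipoly_root_of_unity:
  assumes "z ^ n = 1" "n > 0"
  shows "algebraic_int (ipoly F z)"
proof -
  define A :: "int mat" where
    "A = mat n n (\<lambda>(i,j). \<Sum>k\<le>degree F. if (i + k) mod n = j then coeff F k else 0)"
  define v where "v = vec n (\<lambda>i. z ^ i)"
  have A: "A \<in> carrier_mat n n" by (simp add: A_def)
  have "map_mat of_int A *\<^sub>v v = ipoly F z \<cdot>\<^sub>v v"
  proof (rule eq_vecI)
    fix i assume "i < dim_vec (ipoly F z \<cdot>\<^sub>v v)"
    then have i: "i < n" by (simp add: v_def)
    have "(map_mat of_int A *\<^sub>v v) $ i
        = (\<Sum>j<n. \<Sum>k\<le>degree F. (if (i + k) mod n = j then of_int (coeff F k) else 0) * z ^ j)"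
      using i by (simp add: v_def A_def scalar_prod_def sum_distrib_right lessThan_atLeast0 if_distrib of_int_sum cong: if_cong)
    also have "\<dots> = (\<Sum>k\<le>degree F. \<Sum>j<n. (if (i + k) mod n = j then of_int (coeff F k) * z ^ j else 0))"
      by (subst sum.swap) (auto intro!: sum.cong)
    also have "\<dots> = (\<Sum>k\<le>degree F. of_int (coeff F k) * z ^ (i + k))"
      using assms(2) by (intro sum.cong refl) (simp add: root_power_mod[OF assms(1)])
    also have "\<dots> = ipoly F z * z ^ i"
      by (simp add: poly_altdef sum_distrib_left sum_distrib_right power_add mult_ac)
    finally show "(map_mat of_int A *\<^sub>v v) $ i = (ipoly F z \<cdot>\<^sub>v v) $ i"
      using i by (simp add: v_def)
  qed (simp add: A_def v_def)
  moreover have "v \<noteq> 0\<^sub>v n"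
  proof
    assume "v = 0\<^sub>v n"
    then have "v $ 0 = 0" using assms(2) by simp
    then show False using assms(2) by (simp add: v_def)
  qed
  ultimately have "eigenvalue (map_mat of_int A) (ipoly F z)"
    unfolding eigenvalue_def eigenvector_def using A by (intro exI[of _ v]) (auto simp: v_def)
  then have "poly (char_poly (map_mat of_int A)) (ipoly F z) = 0"
    using eigenvalue_root_char_poly[of "map_mat of_int A :: complex mat" n] A by simp
  then have "ipoly (char_poly A) (ipoly F z) = 0"
    using of_int_hom.char_poly_hom[OF A, where 'a = complex] by simp
  moreover have "lead_coeff (char_poly A) = 1"
    using degree_monic_char_poly[OF A] by simp
  ultimately show ?thesis
    unfolding algebraic_int_altdef_ipoly by blast
qed

text \<open>F(z) is here rational and an algebraic integer, hence an integer. This is how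
  congruences in Z[z] return to the integers.\<close>

lemma dvd_of_int_eq_mult_ipoly:
  assumes "z ^ n = 1" "n > 0" "p > 0" "of_int c = of_nat p * ipoly F z"
  shows "int p dvd c"
proof -
  have eq: "ipoly F z = of_int c / of_nat p" using assms by (simp add: field_simps)
  have "ipoly F z \<in> \<rat>" unfolding eq by simp
  then have "ipoly F z \<in> \<int>"
    using rational_algebraic_int_is_int algebraic_int_ipoly_root_of_unity assms(1,2) by blast
  then obtain k where "ipoly F z = of_int k" by (auto elim: Ints_cases)
  then have "of_int c = (of_int (int p * k) :: complex)" using assms by simp
  then show ?thesis by (metis dvd_triv_left of_int_eq_iff)
qed

text \<open>Cancelling powers of the indeterminate leaves a polynomial with nonzero constant term;
  the remaining terms are a multiple of \<open>a\<close> and equal minus that constant.\<close>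

lemma ipoly_root_nonzero_const:
  assumes "Q \<noteq> 0" "ipoly Q a = 0" "a \<noteq> 0"
  shows "\<exists>c R. c \<noteq> 0 \<and> a * ipoly R a = of_int c"
  using assms(1,2)
proof (induction Q)
  case (pCons c Q)
  show ?case
  proof (cases "c = 0")
    case True
    then show ?thesis using pCons assms(3) by (auto simp: ipoly_pCons)
  next
    case False
    have "a * ipoly Q a = of_int (- c)" using pCons.prems(2)
      by (simp add: ipoly_pCons eq_neg_iff_add_eq_0 add.commute)
    then show ?thesis using False by (metis neg_equal_0_iff_equal)
  qed
qed simp

text \<open>The integer \<open>c\<close> limits the primes that can divide a nonzero element of
  Z[z].\<close>

lemma ipoly_dvd_nonzero_int:
  assumes "z ^ n = 1" "n > 0" "ipoly F z \<noteq> 0"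
  shows "\<exists>c G. c \<noteq> 0 \<and> ipoly F z * ipoly G z = of_int c"
proof -
  obtain Q where "ipoly Q (ipoly F z) = 0" "lead_coeff Q = 1"
    using algebraic_int_ipoly_root_of_unity[OF assms(1,2)] unfolding algebraic_int_altdef_ipoly by blast
  then obtain c R where "c \<noteq> 0" "ipoly F z * ipoly R (ipoly F z) = of_int c"
    using ipoly_root_nonzero_const[of Q "ipoly F z"] assms(3) by force
  then show ?thesis by (metis ipoly_pcompose)
qed

lemma prime_dvd_binomial_power:
  fixes x y :: "'a::comm_ring_1"
  assumes "Factorial_Ring.prime (q::nat)"
  shows "of_nat q dvd (x + y) ^ q - (x ^ q + y ^ q)"
proof -
  have q: "q > 0" using assms prime_gt_0_nat by blast
  have "(x + y) ^ q = (\<Sum>k\<le>q. of_nat (q choose k) * x ^ k * y ^ (q - k))"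
    by (rule binomial_ring)
  also have "{..q} = insert 0 (insert q {0<..<q})" using q by auto
  also have "(\<Sum>k\<in>\<dots>. of_nat (q choose k) * x ^ k * y ^ (q - k))
     = y ^ q + x ^ q + (\<Sum>k\<in>{0<..<q}. of_nat (q choose k) * x ^ k * y ^ (q - k))"
    using q by simp
  finally have "(x + y) ^ q - (x ^ q + y ^ q) = (\<Sum>k\<in>{0<..<q}. of_nat (q choose k) * x ^ k * y ^ (q - k))"
    by (simp add: algebra_simps)
  moreover have "of_nat q dvd (of_nat (q choose k) * x ^ k * y ^ (q - k))" if "k \<in> {0<..<q}" for k
    using dvd_choose_prime[of k q] that assms by (metis (no_types, lifting) dvd_def dvd_mult2 greaterThanLessThan_iff of_nat_mult neq0_conv not_less_zero)
  ultimately show ?thesis by (metis (no_types, lifting) dvd_sum)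
qed

lemma prime_dvd_power_minus_self:
  assumes "Factorial_Ring.prime (q::nat)"
  shows "int q dvd a ^ q - a"
proof -
  have *: "int q dvd int m ^ q - int m" for m
  proof (induction m)
    case 0
    then show ?case using prime_gt_0_nat[OF assms] by (simp add: zero_power)
  next
    case (Suc m)
    have "int (Suc m) ^ q - int (Suc m)
        = ((int m + 1) ^ q - (int m ^ q + 1 ^ q)) + (int m ^ q - int m)"
      by (simp add: add.commute)
    then show ?case
      using dvd_add[OF prime_dvd_binomial_power[OF assms, of "int m" 1] Suc.IH] by presburger
  qed
  define m where "m = nat (a mod int q)"
  have "int m = a mod int q" using prime_gt_0_nat[OF assms] by (simp add: m_def)
  then have "[a = int m] (mod int q)" by (simp add: cong_def)
  then have "[a ^ q - a = int m ^ q - int m] (mod int q)"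
    by (intro cong_diff cong_pow)
  then show ?thesis using *[of m] cong_dvd_iff by blast
qed

text \<open>Modulo \<open>q\<close> the \<open>q\<close>-th power is additive and, by Fermat, fixes
  integer coefficients, so it only acts on the indeterminate.\<close>

lemma prime_dvd_pcompose_monom:
  fixes F :: "int poly"
  assumes "Factorial_Ring.prime q"
  shows "of_nat q dvd pcompose F (monom 1 q) - F ^ q"
proof (induction F)
  case 0
  then show ?case using prime_gt_0_nat[OF assms] by (simp add: power_0_left)
next
  case (pCons a F)
  let ?X = "monom 1 q :: int poly" and ?x = "[:0, 1:] :: int poly"
  have comp: "pcompose (pCons a F) ?X = [:a:] + ?X * pcompose F ?X"
    by (simp add: pcompose_pCons)
  have pw: "(?x * F) ^ q = ?X * F ^ q"
    unfolding power_mult_distrib by (simp add: monom_altdef)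
  have "(pCons a F) ^ q = ([:a:] + ?x * F) ^ q" by simp
  then have eq: "pcompose (pCons a F) ?X - pCons a F ^ q =
     ?X * (pcompose F ?X - F ^ q) - ([:a:] ^ q - [:a:])
       - (([:a:] + ?x * F) ^ q - ([:a:] ^ q + (?x * F) ^ q))"
    unfolding comp pw by (simp only: algebra_simps)
  have "of_nat q dvd ([:a:] ^ q - [:a:])"
  proof -
    obtain k where "a ^ q - a = int q * k" using prime_dvd_power_minus_self[OF assms, of a] by (elim dvdE)
    then have "[:a:] ^ q - [:a:] = of_nat q * [:k:]"
      by (simp add: poly_const_pow of_nat_poly)
    then show ?thesis by (rule dvdI)
  qed
  then show ?case
    unfolding eq using dvd_mult[OF pCons.IH] prime_dvd_binomial_power[OF assms] by (blast intro: dvd_diff)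
qed

lemma ipoly_power_prime:
  assumes "Factorial_Ring.prime q"
  shows "\<exists>H. \<forall>x. ipoly F (x ^ q) = ipoly F x ^ q + of_nat q * ipoly H x"
proof -
  obtain H where H: "pcompose F (monom 1 q) - F ^ q = of_nat q * H"
    using prime_dvd_pcompose_monom[OF assms, of F] by (elim dvdE)
  have "ipoly F (x ^ q) = ipoly F x ^ q + of_nat q * ipoly H x" for x
  proof -
    have "pcompose F (monom 1 q) = F ^ q + of_nat q * H" using H by (simp add: algebra_simps)
    then have "ipoly (pcompose F (monom 1 q)) x = ipoly (F ^ q + of_nat q * H) x" by simp
    then show ?thesis unfolding ipoly_pcompose ipoly_monom
      unfolding ipoly_add ipoly_mult ipoly_power ipoly_of_nat .
  qed
  then show ?thesis by blast
qed

text \<open>If F(z^j) = 0, the Frobenius congruence puts F(z^(jq)) into q Z[z]. Were it nonzero,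
  \<open>q\<close> would divide the integer \<open>c k\<close> that it divides itself. Exponents
  matter only modulo \<open>n\<close>, so finitely many \<open>c k\<close> occur and
  \<open>B\<close> is their maximum.\<close>

lemma ipoly_root_power_large_prime:
  assumes z: "z ^ n = 1" "n > 0"
  shows "\<exists>B. \<forall>q j. Factorial_Ring.prime q \<and> q > B \<and> ipoly F (z ^ j) = 0 \<longrightarrow> ipoly F (z ^ (j * q)) = 0"
proof -
  have "\<exists>c G. c \<noteq> 0 \<and> ipoly F (z ^ k) * ipoly G z = of_int c" if "ipoly F (z ^ k) \<noteq> 0" for k
    using ipoly_dvd_nonzero_int[OF z, of "pcompose F (monom 1 k)"] that
    unfolding ipoly_pcompose ipoly_monom by blast
  then obtain c G where cG: "\<And>k. ipoly F (z ^ k) \<noteq> 0 \<Longrightarrow> c k \<noteq> 0 \<and> ipoly F (z ^ k) * ipoly (G k) z = of_int (c k)"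
    by metis
  define B where "B = Max ((\<lambda>k. nat \<bar>c k\<bar>) ` {..<n})"
  have "ipoly F (z ^ (j * q)) = 0" if q: "Factorial_Ring.prime q" "q > B" and 0: "ipoly F (z ^ j) = 0" for q j
  proof (rule ccontr)
    define k where "k = (j * q) mod n"
    assume "ipoly F (z ^ (j * q)) \<noteq> 0"
    then have "ipoly F (z ^ k) \<noteq> 0" by (simp add: k_def root_power_mod[OF z(1)])
    note ck = cG[OF this]
    obtain H where H: "\<And>x. ipoly F (x ^ q) = ipoly F x ^ q + of_nat q * ipoly H x"
      using ipoly_power_prime[OF q(1)] by blast
    have "ipoly F (z ^ k) = of_nat q * ipoly H (z ^ j)"
      using H[of "z ^ j"] 0 prime_gt_0_nat[OF q(1)] by (simp add: k_def root_power_mod[OF z(1)] power_mult)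
    then have "of_int (c k) = of_nat q * ipoly (pcompose H (monom 1 j) * G k) z"
      using ck unfolding ipoly_mult ipoly_pcompose ipoly_monom by (simp add: mult.assoc)
    then have "int q dvd c k"
      using dvd_of_int_eq_mult_ipoly[OF z prime_gt_0_nat[OF q(1)]] by blast
    then have "q \<le> nat \<bar>c k\<bar>" using ck
      by (metis dvd_imp_le_int int_nat_eq nat_le_iff abs_ge_zero abs_of_nat zle_int)
    also have "\<dots> \<le> B" unfolding B_def k_def using z(2) by (intro Max_ge) auto
    finally show False using q(2) by simp
  qed
  then show ?thesis by blast
qed

text \<open>Landau's argument: congruent exponents may be exchanged for one whose prime factors
  are all large, and a large prime maps roots to roots since the finitely many nonzero
  values cannot be divisible by it.\<close>

lemma ipoly_root_coprime_power:
  assumes z: "z ^ n = 1" "n > 0" and "coprime s n" and 0: "ipoly F z = 0"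
  shows "ipoly F (z ^ s) = 0"
proof -
  obtain B where B: "\<And>q j. Factorial_Ring.prime q \<Longrightarrow> q > B \<Longrightarrow> ipoly F (z ^ j) = 0 \<Longrightarrow> ipoly F (z ^ (j * q)) = 0"
    using ipoly_root_power_large_prime[OF z, of F] by blast
  have large: "ipoly F (z ^ (j * t)) = 0"
    if "t > 0" "\<And>q. Factorial_Ring.prime q \<Longrightarrow> q dvd t \<Longrightarrow> q > B" "ipoly F (z ^ j) = 0" for t j
    using that
  proof (induction t arbitrary: j rule: prime_divisors_induct)
    case (factor q t)
    have "ipoly F (z ^ (j * q)) = 0" using factor by (intro B) auto
    then have "ipoly F (z ^ (j * q * t)) = 0"
      using factor by (intro factor.IH) auto
    then show ?case by (simp add: mult.assoc)
  qed auto
  \<comment> \<open>Adding \<open>n * \<Prod>Q\<close> does not change the power of \<open>z\<close>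
    and removes all prime factors up to \<open>B\<close>: such a prime divides exactly one of the
    two summands of \<open>t\<close>. If it divides \<open>s\<close>, it is neither in
    \<open>Q\<close> nor a divisor of \<open>n\<close>; otherwise it is in \<open>Q\<close>.\<close>
  define Q where "Q = {q. Factorial_Ring.prime q \<and> q \<le> B \<and> \<not> q dvd s}"
  have finQ: "finite Q" unfolding Q_def by (rule finite_subset[of _ "{..B}"]) auto
  define t where "t = s + n * \<Prod>Q"
  have "\<Prod>Q > 0" using prime_gt_0_nat by (intro prod_pos) (auto simp: Q_def)
  then have "t > 0" using z(2) by (simp add: t_def)
  moreover have "q > B" if q: "Factorial_Ring.prime q" "q dvd t" for q
  proof (rule ccontr)
    assume "\<not> q > B"
    show False
    proof (cases "q dvd s")
      case True
      then have "q dvd n * \<Prod>Q" using q(2) by (simp add: t_def dvd_add_right_iff)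
      then consider "q dvd n" | x where "x \<in> Q" "q dvd x"
        using q(1) finQ by (metis prime_dvd_mult_iff prime_dvd_prod_iff)
      then show False
      proof cases
        case 1
        then show False using assms(3) True q(1) by (meson coprime_common_divisor not_prime_unit)
      next
        case 2
        then have "q = x" using q(1) by (simp add: Q_def primes_dvd_imp_eq)
        then show False using 2 True by (simp add: Q_def)
      qed
    next
      case False
      then have "q \<in> Q" using q \<open>\<not> q > B\<close> by (simp add: Q_def)
      then have "q dvd \<Prod>Q" using finQ by (simp add: dvd_prod_eqI)
      then show False using False q(2) by (simp add: t_def dvd_add_left_iff)
    qed
  qed
  ultimately have "ipoly F (z ^ (1 * t)) = 0" by (intro large) (auto simp: 0)
  moreover have "z ^ t = z ^ s" by (simp add: t_def power_add power_mult z)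
  ultimately show ?thesis by simp
qed

lemma class_ring_inv: "(x::complex) \<noteq> 0 \<Longrightarrow> inv\<^bsub>class_ring\<^esub> x = inverse x"
  by (rule monoid.inv_char[OF ring.is_monoid[OF field.is_ring]]) 
    (auto simp: class_field class_ring_simps)

text \<open>\<open>Fix\<close> consists of the quotients A(z) / B(z) whose numerator and denominator
  do not change under \<open>z ^ s\<close>. It is closed under the field operations and contains the
  generator \<open>z ^ k\<close>, because \<open>s\<close> is 1 modulo \<open>r\<close>. For an
  element C(z) of it, the relation B C = A at \<open>z\<close> holds at \<open>z ^ s\<close> as
  well, and there it yields the claim.\<close>

lemma cyclotomic_field_galois_fixed:
  assumes z: "z ^ n = 1" "n > 0" and s: "coprime s n" "[s = 1] (mod r)" and r: "r > 0"
    and zk: "z ^ k = cis (2 * pi / real r)"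
    and x: "ipoly C z \<in> cyclotomic_field r"
  shows "ipoly C (z ^ s) = ipoly C z"
proof -
  define Fix where "Fix = {x. \<exists>A B. ipoly B z \<noteq> 0 \<and> ipoly B z * x = ipoly A z \<and>
     ipoly A (z ^ s) = ipoly A z \<and> ipoly B (z ^ s) = ipoly B z}"
  have FixI: "ipoly B z \<noteq> 0 \<Longrightarrow> ipoly B z * x = ipoly A z \<Longrightarrow> ipoly A (z ^ s) = ipoly A z
    \<Longrightarrow> ipoly B (z ^ s) = ipoly B z \<Longrightarrow> x \<in> Fix" for A B x unfolding Fix_def by blast
  have FixE: thesis if "x \<in> Fix" "\<And>A B. ipoly B z \<noteq> 0 \<Longrightarrow> ipoly B z * x = ipoly A z \<Longrightarrow>
     ipoly A (z ^ s) = ipoly A z \<Longrightarrow> ipoly B (z ^ s) = ipoly B z \<Longrightarrow> thesis" for x thesis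
    using that unfolding Fix_def by blast
  have "x \<in> Fix" if "x \<in> cyclotomic_field r" for x
    using that unfolding cyclotomic_field_def
  proof (induction rule: generate_field.induct)
    case one
    show ?case by (rule FixI[of 1 _ 1]) (auto simp: class_ring_simps)
  next
    case (incl h)
    have "cis (2 * pi / real r) ^ s = cis (2 * pi / real r)"
    proof -
      have "cis (2 * pi / real r) ^ r = 1" using r by (simp add: DeMoivre)
      then have "cis (2 * pi / real r) ^ s = cis (2 * pi / real r) ^ (s mod r)"
        by (rule root_power_mod[symmetric])
      moreover have "s mod r = 1 mod r" using s(2) by (simp add: cong_def)
      ultimately show ?thesis by (cases "r = 1") auto
    qed
    then have "(z ^ s) ^ k = z ^ k" unfolding zk[symmetric] by (simp add: mult.commute flip: power_mult)
    then show ?case using incl zk by (intro FixI[of 1 _ "monom 1 k"]) (auto simp: ipoly_monom poly_monom)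
  next
    case (a_inv h)
    obtain A B where AB: "ipoly B z \<noteq> 0" "ipoly B z * h = ipoly A z"
      "ipoly A (z ^ s) = ipoly A z" "ipoly B (z ^ s) = ipoly B z" using a_inv.IH by (rule FixE)
    have "\<ominus>\<^bsub>class_ring\<^esub> h = - h" by (simp add: class_ring_simps)
    then show ?case using AB by (intro FixI[of B _ "- A"]) (simp_all only: ipoly_uminus, auto)
  next
    case (m_inv h)
    obtain A B where AB: "ipoly B z \<noteq> 0" "ipoly B z * h = ipoly A z"
      "ipoly A (z ^ s) = ipoly A z" "ipoly B (z ^ s) = ipoly B z" using m_inv.IH by (rule FixE)
    have h: "h \<noteq> 0" using m_inv by (simp add: class_ring_simps)
    then show ?case using AB(1,3,4)
      by (intro FixI[of A _ B]) (simp_all add: class_ring_inv[OF h] flip: AB(2))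
  next
    case (eng_add h1 h2)
    obtain A B where AB: "ipoly B z \<noteq> 0" "ipoly B z * h1 = ipoly A z"
      "ipoly A (z ^ s) = ipoly A z" "ipoly B (z ^ s) = ipoly B z" using eng_add.IH(1) by (rule FixE)
    obtain A' B' where AB': "ipoly B' z \<noteq> 0" "ipoly B' z * h2 = ipoly A' z"
      "ipoly A' (z ^ s) = ipoly A' z" "ipoly B' (z ^ s) = ipoly B' z" using eng_add.IH(2) by (rule FixE)
    have "h1 \<oplus>\<^bsub>class_ring\<^esub> h2 = h1 + h2" by (simp add: class_ring_simps)
    moreover have "ipoly (B * B') z * (h1 + h2) = ipoly (A * B' + A' * B) z"
      unfolding ipoly_add ipoly_mult AB(2)[symmetric] AB'(2)[symmetric] by (simp add: algebra_simps)
    ultimately show ?case using AB(1,3,4) AB'(1,3,4)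
      by (intro FixI[of "B * B'" _ "A * B' + A' * B"]) (simp_all only: ipoly_add ipoly_mult, auto)
  next
    case (eng_mult h1 h2)
    obtain A B where AB: "ipoly B z \<noteq> 0" "ipoly B z * h1 = ipoly A z"
      "ipoly A (z ^ s) = ipoly A z" "ipoly B (z ^ s) = ipoly B z" using eng_mult.IH(1) by (rule FixE)
    obtain A' B' where AB': "ipoly B' z \<noteq> 0" "ipoly B' z * h2 = ipoly A' z"
      "ipoly A' (z ^ s) = ipoly A' z" "ipoly B' (z ^ s) = ipoly B' z" using eng_mult.IH(2) by (rule FixE)
    have "h1 \<otimes>\<^bsub>class_ring\<^esub> h2 = h1 * h2" by (simp add: class_ring_simps)
    moreover have "ipoly (B * B') z * (h1 * h2) = ipoly (A * A') z"
      unfolding ipoly_mult AB(2)[symmetric] AB'(2)[symmetric] by (simp add: algebra_simps)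
    ultimately show ?case using AB(1,3,4) AB'(1,3,4)
      by (intro FixI[of "B * B'" _ "A * A'"]) (simp_all only: ipoly_mult, auto)
  qed
  then obtain A B where AB: "ipoly B z \<noteq> 0" "ipoly B z * ipoly C z = ipoly A z"
    "ipoly A (z ^ s) = ipoly A z" "ipoly B (z ^ s) = ipoly B z" using x by (blast elim: FixE)
  have "ipoly (B * C - A) z = 0"
    using AB by (simp add: of_int_poly_hom.hom_mult of_int_poly_hom.hom_minus)
  then have "ipoly (B * C - A) (z ^ s) = 0"
    by (rule ipoly_root_coprime_power[OF z s(1)])
  then have "ipoly B z * ipoly C (z ^ s) = ipoly B z * ipoly C z"
    using AB by (simp add: of_int_poly_hom.hom_mult of_int_poly_hom.hom_minus)
  then show ?thesis using AB(1) by simp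
qed

section \<open>Matrices of finite support\<close>

text \<open>Square matrices of arbitrary size form one type (matrices of finite support), so that
  sums and products of operators are covered by the type class \<open>ring\<close>.\<close>

typedef fmat = "{f :: nat \<Rightarrow> nat \<Rightarrow> complex. \<exists>N. \<forall>i j. f i j \<noteq> 0 \<longrightarrow> i < N \<and> j < N}"
  morphisms ent Fmat
  by (rule exI[of _ "\<lambda>_ _. 0"]) auto

setup_lifting type_definition_fmat

lemma fmat_eqI: "(\<And>i j. ent A i j = ent B i j) \<Longrightarrow> A = B"
  by (metis ent_inject ext)

definition supp_le :: "nat \<Rightarrow> fmat \<Rightarrow> bool" where
  "supp_le N A \<longleftrightarrow> (\<forall>i j. ent A i j \<noteq> 0 \<longrightarrow> i < N \<and> j < N)"

lemma supp_le_exists: "\<exists>N. supp_le N A"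
  using ent[of A] by (auto simp: supp_le_def)

lemma supp_le_mono: "supp_le N A \<Longrightarrow> N \<le> N' \<Longrightarrow> supp_le N' A"
  by (fastforce simp: supp_le_def)

lemma supp_le_exists2: "\<exists>N. supp_le N A \<and> supp_le N B"
proof -
  obtain N1 N2 where "supp_le N1 A" "supp_le N2 B" using supp_le_exists by blast
  then show ?thesis by (intro exI[of _ "max N1 N2"]) (auto intro: supp_le_mono)
qed

instantiation fmat :: ring
begin

lift_definition zero_fmat :: fmat is "\<lambda>_ _. 0" by auto

lift_definition uminus_fmat :: "fmat \<Rightarrow> fmat" is "\<lambda>f i j. - f i j" by auto

lift_definition plus_fmat :: "fmat \<Rightarrow> fmat \<Rightarrow> fmat" is "\<lambda>f g i j. f i j + g i j"
proof -
  fix f g :: "nat \<Rightarrow> nat \<Rightarrow> complex"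
  assume "\<exists>N. \<forall>i j. f i j \<noteq> 0 \<longrightarrow> i < N \<and> j < N" "\<exists>N. \<forall>i j. g i j \<noteq> 0 \<longrightarrow> i < N \<and> j < N"
  then obtain N1 N2 where N: "\<forall>i j. f i j \<noteq> 0 \<longrightarrow> i < N1 \<and> j < N1" "\<forall>i j. g i j \<noteq> 0 \<longrightarrow> i < N2 \<and> j < N2"
    by blast
  show "\<exists>N. \<forall>i j. f i j + g i j \<noteq> 0 \<longrightarrow> i < N \<and> j < N"
  proof (intro exI[of _ "max N1 N2"] allI impI)
    fix i j assume "f i j + g i j \<noteq> 0"
    then have "f i j \<noteq> 0 \<or> g i j \<noteq> 0" by auto
    then show "i < max N1 N2 \<and> j < max N1 N2" using N by (auto simp: less_max_iff_disj)
  qed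
qed

definition minus_fmat :: "fmat \<Rightarrow> fmat \<Rightarrow> fmat" where "minus_fmat A B = A + (- B)"

lift_definition times_fmat :: "fmat \<Rightarrow> fmat \<Rightarrow> fmat" is
  "\<lambda>f g i j. \<Sum>k | f i k \<noteq> 0. f i k * g k j"
proof -
  fix f g :: "nat \<Rightarrow> nat \<Rightarrow> complex"
  assume "\<exists>N. \<forall>i j. f i j \<noteq> 0 \<longrightarrow> i < N \<and> j < N" "\<exists>N. \<forall>i j. g i j \<noteq> 0 \<longrightarrow> i < N \<and> j < N"
  then obtain N1 N2 where N: "\<And>i j. f i j \<noteq> 0 \<Longrightarrow> i < N1 \<and> j < N1" "\<And>i j. g i j \<noteq> 0 \<Longrightarrow> i < N2 \<and> j < N2"
    by blast
  show "\<exists>N. \<forall>i j. (\<Sum>k | f i k \<noteq> 0. f i k * g k j) \<noteq> 0 \<longrightarrow> i < N \<and> j < N"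
  proof (intro exI[of _ "max N1 N2"] allI impI)
    fix i j assume "(\<Sum>k | f i k \<noteq> 0. f i k * g k j) \<noteq> 0"
    then obtain k where "f i k * g k j \<noteq> 0" by (metis (mono_tags, lifting) sum.neutral)
    then have "f i k \<noteq> 0" "g k j \<noteq> 0" by auto
    then show "i < max N1 N2 \<and> j < max N1 N2" using N by (auto simp: less_max_iff_disj)
  qed
qed

text \<open>The product sums over the support of a row, since no bound is available in its
  definition; any bound for the left factor gives the usual formula.\<close>

lemma ent_times:
  assumes "supp_le N A"
  shows "ent (A * B) i j = (\<Sum>k<N. ent A i k * ent B k j)"
  unfolding times_fmat.rep_eq
  by (rule sum.mono_neutral_left) (use assms in \<open>auto simp: supp_le_def\<close>)

lemma supp_le_times: "supp_le N A \<Longrightarrow> supp_le N B \<Longrightarrow> supp_le N (A * B)"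
  unfolding supp_le_def[of _ "A * B"]
proof (intro allI impI)
  fix i j assume A: "supp_le N A" and B: "supp_le N B" and "ent (A * B) i j \<noteq> 0"
  then obtain k where "ent A i k * ent B k j \<noteq> 0"
    by (metis (mono_tags, lifting) ent_times[OF A] sum.neutral)
  then show "i < N \<and> j < N" using A B by (auto simp: supp_le_def)
qed

instance
proof
  fix A B C :: fmat
  show "A + B + C = A + (B + C)" "A + B = B + A" "0 + A = A" "- A + A = 0" "A - B = A + - B"
    by (auto intro!: fmat_eqI simp: plus_fmat.rep_eq zero_fmat.rep_eq uminus_fmat.rep_eq minus_fmat_def)
  obtain N where N: "supp_le N A" "supp_le N B" using supp_le_exists2 by blast
  obtain N' where N': "supp_le N' A" "supp_le N' (A + B)" "supp_le N' B"
  proof -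
    obtain N1 N2 where "supp_le N1 A \<and> supp_le N1 B" "supp_le N2 (A + B)"
      using supp_le_exists2 supp_le_exists by meson
    then show ?thesis by (intro that[of "max N1 N2"]) (auto intro: supp_le_mono)
  qed
  show "(A + B) * C = A * C + B * C"
    by (rule fmat_eqI) (simp add: ent_times[OF N'(1)] ent_times[OF N'(2)] ent_times[OF N'(3)]
        plus_fmat.rep_eq ring_distribs sum.distrib)
  show "A * (B + C) = A * B + A * C"
    by (rule fmat_eqI) (simp add: ent_times[OF N(1)] plus_fmat.rep_eq ring_distribs sum.distrib)
  show "A * B * C = A * (B * C)"
  proof (rule fmat_eqI)
    fix i j
    have "ent (A * B * C) i j = (\<Sum>k<N. \<Sum>l<N. ent A i l * ent B l k * ent C k j)"
      by (simp add: ent_times[OF supp_le_times[OF N]] ent_times[OF N(1)] sum_distrib_right)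
    also have "\<dots> = (\<Sum>l<N. \<Sum>k<N. ent A i l * ent B l k * ent C k j)"
      by (rule sum.swap)
    also have "\<dots> = ent (A * (B * C)) i j"
      by (simp add: ent_times[OF N(1)] ent_times[OF N(2)] sum_distrib_left mult.assoc)
    finally show "ent (A * B * C) i j = ent (A * (B * C)) i j" .
  qed
qed

end

lift_definition scl :: "complex \<Rightarrow> fmat \<Rightarrow> fmat" is "\<lambda>c f i j. c * f i j" by auto

interpretation fmat: vector_space scl
  by unfold_locales (auto intro!: fmat_eqI simp: scl.rep_eq plus_fmat.rep_eq ring_distribs)

lemma scl_mult_left: "scl c A * B = scl c (A * B)"
proof -
  obtain N where N: "supp_le N A" using supp_le_exists by blast
  then have N': "supp_le N (scl c A)" by (auto simp: supp_le_def scl.rep_eq)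
  show ?thesis
    by (rule fmat_eqI) (simp add: ent_times[OF N] ent_times[OF N'] scl.rep_eq sum_distrib_left mult.assoc)
qed

lemma scl_mult_right: "A * scl c B = scl c (A * B)"
proof -
  obtain N where N: "supp_le N A" using supp_le_exists by blast
  show ?thesis
    by (rule fmat_eqI) (simp add: ent_times[OF N] scl.rep_eq sum_distrib_left mult_ac)
qed

lemma supp_le_zero: "supp_le N 0"
  by (simp add: supp_le_def zero_fmat.rep_eq)

lemma supp_le_add: "supp_le N A \<Longrightarrow> supp_le N B \<Longrightarrow> supp_le N (A + B)"
  unfolding supp_le_def plus_fmat.rep_eq by (metis add.right_neutral add_cancel_left_left)

lemma supp_le_scl: "supp_le N A \<Longrightarrow> supp_le N (scl c A)"
  by (auto simp: supp_le_def scl.rep_eq)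

lemma supp_le_sum: "(\<And>x. x \<in> X \<Longrightarrow> supp_le N (f x)) \<Longrightarrow> supp_le N (sum f X)"
  by (induction X rule: infinite_finite_induct) (simp_all add: supp_le_zero supp_le_add)

definition tr :: "fmat \<Rightarrow> complex" where
  "tr A = (\<Sum>i | ent A i i \<noteq> 0. ent A i i)"

lemma tr_bound:
  assumes "supp_le N A"
  shows "tr A = (\<Sum>i<N. ent A i i)"
  unfolding tr_def
  by (rule sum.mono_neutral_left) (use assms in \<open>auto simp: supp_le_def\<close>)

lemma tr_add: "tr (A + B) = tr A + tr B"
proof -
  obtain N where N: "supp_le N A" "supp_le N B" using supp_le_exists2 by blast
  then have "supp_le N (A + B)" by (rule supp_le_add)
  then show ?thesis using N by (simp add: tr_bound plus_fmat.rep_eq sum.distrib)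
qed

lemma tr_scl: "tr (scl c A) = c * tr A"
proof -
  obtain N where N: "supp_le N A" using supp_le_exists by blast
  then have "supp_le N (scl c A)" by (auto simp: supp_le_def scl.rep_eq)
  then show ?thesis using N by (simp add: tr_bound scl.rep_eq sum_distrib_left)
qed

lemma tr_zero: "tr 0 = 0"
  by (simp add: tr_def zero_fmat.rep_eq)

lemma tr_sum: "tr (\<Sum>x\<in>X. f x) = (\<Sum>x\<in>X. tr (f x))"
  by (induction X rule: infinite_finite_induct) (simp_all add: tr_zero tr_add)

lemma tr_commute: "tr (A * B) = tr (B * A)"
proof -
  obtain N where N: "supp_le N A" "supp_le N B" using supp_le_exists2 by blast
  have "tr (A * B) = (\<Sum>i<N. \<Sum>k<N. ent A i k * ent B k i)"
    by (simp add: tr_bound[OF supp_le_times[OF N]] ent_times[OF N(1)])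
  also have "\<dots> = (\<Sum>k<N. \<Sum>i<N. ent A i k * ent B k i)" by (rule sum.swap)
  also have "\<dots> = tr (B * A)"
    by (simp add: tr_bound[OF supp_le_times[OF N(2,1)]] ent_times[OF N(2)] mult.commute)
  finally show ?thesis .
qed

definition fmat_of_mat :: "complex mat \<Rightarrow> fmat" where
  "fmat_of_mat A = Fmat (\<lambda>i j. if i < dim_row A \<and> j < dim_col A then A $$ (i,j) else 0)"

lemma ent_fmat_of_mat:
  "ent (fmat_of_mat A) i j = (if i < dim_row A \<and> j < dim_col A then A $$ (i,j) else 0)"
  unfolding fmat_of_mat_def
  by (subst Fmat_inverse) (auto intro!: exI[of _ "max (dim_row A) (dim_col A)"] split: if_splits)

lemma supp_le_fmat_of_mat: "A \<in> carrier_mat n n \<Longrightarrow> supp_le n (fmat_of_mat A)"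
  by (auto simp: supp_le_def ent_fmat_of_mat)

lemma fmat_of_mat_times:
  assumes "A \<in> carrier_mat n n" "B \<in> carrier_mat n n"
  shows "fmat_of_mat (A * B) = fmat_of_mat A * fmat_of_mat B"
  by (rule fmat_eqI) (use assms in \<open>auto simp: ent_times[OF supp_le_fmat_of_mat[OF assms(1)]]
      ent_fmat_of_mat scalar_prod_def lessThan_atLeast0 intro!: sum.cong\<close>)

lemma tr_fmat_of_mat: "A \<in> carrier_mat n n \<Longrightarrow> tr (fmat_of_mat A) = mat_trace A"
  by (simp add: tr_bound[OF supp_le_fmat_of_mat] mat_trace_def ent_fmat_of_mat)

lemma fmat_of_mat_inject:
  assumes "A \<in> carrier_mat n n" "B \<in> carrier_mat n n" "fmat_of_mat A = fmat_of_mat B"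
  shows "A = B"
proof (rule eq_matI)
  fix i j assume "i < dim_row B" "j < dim_col B"
  then show "A $$ (i,j) = B $$ (i,j)"
    using assms ent_fmat_of_mat[of A i j] ent_fmat_of_mat[of B i j] by auto
qed (use assms in auto)

definition mat_of_fmat :: "nat \<Rightarrow> fmat \<Rightarrow> complex mat" where
  "mat_of_fmat n A = mat n n (\<lambda>(i,j). ent A i j)"

lemma mat_of_fmat_carrier [simp]: "mat_of_fmat n A \<in> carrier_mat n n"
  by (simp add: mat_of_fmat_def)

lemma fmat_of_mat_of_fmat: "supp_le n A \<Longrightarrow> fmat_of_mat (mat_of_fmat n A) = A"
  by (rule fmat_eqI) (auto simp: ent_fmat_of_mat mat_of_fmat_def supp_le_def)

text \<open>The type has no unit. \<open>idm n\<close> is one only for matrices supported in the top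
  left block of size \<open>n\<close>, and plays the role of the identity operator on the
  representation space.\<close>

definition idm :: "nat \<Rightarrow> fmat" where
  "idm n = fmat_of_mat (1\<^sub>m n)"

lemma idm_mult:
  assumes "supp_le n A"
  shows "idm n * A = A" "A * idm n = A"
proof -
  have "fmat_of_mat (1\<^sub>m n * mat_of_fmat n A) = idm n * A"
    "fmat_of_mat (mat_of_fmat n A * 1\<^sub>m n) = A * idm n"
    unfolding idm_def by (simp_all add: fmat_of_mat_times[of _ n] fmat_of_mat_of_fmat[OF assms])
  then show "idm n * A = A" "A * idm n = A"
    by (simp_all add: fmat_of_mat_of_fmat[OF assms] left_mult_one_mat[of _ n n] right_mult_one_mat[of _ n n])
qed

lemma supp_le_idm: "supp_le n (idm n)"
  by (simp add: idm_def supp_le_fmat_of_mat)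

lemma tr_idm: "tr (idm n) = of_nat n"
  by (simp add: idm_def tr_fmat_of_mat[of _ n] mat_trace_def)

text \<open>By Schur decomposition the idempotent is similar to a triangular one, whose diagonal
  entries satisfy b = b^2. All multiplicities and degrees below get their integrality from
  here.\<close>

lemma idempotent_tr_nat:
  assumes "E * E = E"
  shows "\<exists>k. tr E = of_nat k"
proof -
  obtain n where n: "supp_le n E" using supp_le_exists by blast
  define A where "A = mat_of_fmat n E"
  have A: "A \<in> carrier_mat n n" by (simp add: A_def)
  have E: "fmat_of_mat A = E" using n by (simp add: A_def fmat_of_mat_of_fmat)
  have AA: "A * A = A"
    by (rule fmat_of_mat_inject[of _ n]) (use A in \<open>simp_all add: fmat_of_mat_times[of _ n] E assms\<close>)
  obtain es where es: "char_poly A = (\<Prod>a\<leftarrow>es. [:- a, 1:])" "length es = n"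
    using char_poly_factorized[OF A] by blast
  obtain B P Q where BPQ: "schur_decomposition A es = (B, P, Q)" by (cases "schur_decomposition A es")
  have sw: "similar_mat_wit A B P Q" and ut: "upper_triangular B"
    using schur_decomposition[OF A es(1) BPQ] by auto
  then have c: "B \<in> carrier_mat n n" "P \<in> carrier_mat n n" "Q \<in> carrier_mat n n"
    and PQ: "P * Q = 1\<^sub>m n" "Q * P = 1\<^sub>m n" and ABPQ: "A = P * B * Q"
    using A by (auto simp: similar_mat_wit_def Let_def)
  let ?F = fmat_of_mat
  have PQ': "?F P * ?F Q = idm n" "?F Q * ?F P = idm n"
    using PQ fmat_of_mat_times[OF c(2,3)] fmat_of_mat_times[OF c(3,2)] by (simp_all add: idm_def)
  have "E = ?F P * ?F B * ?F Q"
    unfolding E[symmetric] ABPQ using c fmat_of_mat_times[OF mult_carrier_mat[OF c(2,1)] c(3)] fmat_of_mat_times[OF c(2,1)] by simp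
  then have "?F Q * E * ?F P = (?F Q * ?F P) * ?F B * (?F Q * ?F P)"
    by (simp add: mult.assoc)
  then have FB: "?F B = ?F Q * E * ?F P"
    by (simp add: PQ' idm_mult[OF supp_le_fmat_of_mat[OF c(1)]])
  have "?F B * ?F B = ?F Q * (E * (?F P * ?F Q) * E) * ?F P"
    by (simp add: FB mult.assoc)
  also have "\<dots> = ?F B" by (simp add: PQ' idm_mult[OF n] assms FB)
  finally have "?F (B * B) = ?F B" using c by (simp add: fmat_of_mat_times[of _ n])
  then have BB: "B * B = B" using c by (intro fmat_of_mat_inject[of _ n]) auto
  have diag: "B $$ (i,i) = 0 \<or> B $$ (i,i) = 1" if i: "i < n" for i
  proof -
    have "B $$ (i,i) = (B * B) $$ (i,i)" by (simp add: BB)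
    also have "\<dots> = (\<Sum>k<n. B $$ (i,k) * B $$ (k,i))"
      using c i by (simp add: scalar_prod_def lessThan_atLeast0)
    also have "\<dots> = (\<Sum>k<n. if k = i then B $$ (i,i) * B $$ (i,i) else 0)"
    proof (intro sum.cong refl)
      fix k assume "k \<in> {..<n}"
      then consider "k < i" | "k = i" | "i < k" "k < n" by force
      then show "B $$ (i,k) * B $$ (k,i) = (if k = i then B $$ (i,i) * B $$ (i,i) else 0)"
        using ut c i by cases (auto simp: upper_triangular_def)
    qed
    also have "\<dots> = B $$ (i,i) * B $$ (i,i)" using i by simp
    finally show ?thesis by (metis mult_cancel_right1)
  qed
  have "tr E = tr (E * (?F P * ?F Q))" by (simp add: PQ' idm_mult[OF n])
  also have "\<dots> = tr (?F Q * (E * ?F P))" by (metis mult.assoc tr_commute)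
  also have "\<dots> = tr (?F B)" by (simp add: FB mult.assoc)
  also have "\<dots> = (\<Sum>i<n. B $$ (i,i))" using c by (simp add: tr_fmat_of_mat[of _ n] mat_trace_def)
  also have "\<dots> = (\<Sum>i<n. of_nat (if B $$ (i,i) = 1 then 1 else 0))"
    using diag by (intro sum.cong) auto
  also have "\<dots> = of_nat (\<Sum>i<n. if B $$ (i,i) = 1 then 1 else 0)" by simp
  finally show ?thesis by blast
qed

text \<open>\<open>orbit_comb T W q\<close> is \<open>q(T) W\<close>.\<close>

definition orbit_comb :: "fmat \<Rightarrow> fmat \<Rightarrow> complex poly \<Rightarrow> fmat" where
  "orbit_comb T W q = fold_coeffs (\<lambda>a X. scl a W + T * X) q 0"

lemma orbit_comb_0 [simp]: "orbit_comb T W 0 = 0"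
  by (simp add: orbit_comb_def)

lemma orbit_comb_pCons: "orbit_comb T W (pCons a q) = scl a W + T * orbit_comb T W q"
  by (cases "q = 0"; cases "a = 0") (simp_all add: orbit_comb_def)

lemma orbit_comb_add: "orbit_comb T W (p + q) = orbit_comb T W p + orbit_comb T W q"
proof (induction p arbitrary: q)
  case (pCons a p)
  obtain b q' where "q = pCons b q'" by (cases q)
  then show ?case
    using pCons.IH[of q'] by (simp add: orbit_comb_pCons fmat.scale_left_distrib algebra_simps)
qed simp

lemma orbit_comb_smult: "orbit_comb T W (smult c q) = scl c (orbit_comb T W q)"
  by (induction q) (simp_all add: orbit_comb_pCons fmat.scale_right_distrib scl_mult_right)

lemma orbit_comb_monom: "orbit_comb T W (monom c k) = scl c (((*) T ^^ k) W)"
  by (induction k) (simp_all add: monom_0 monom_Suc orbit_comb_pCons scl_mult_right)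

lemma orbit_comb_sum: "orbit_comb T W (sum f X) = (\<Sum>x\<in>X. orbit_comb T W (f x))"
  by (induction X rule: infinite_finite_induct) (simp_all add: orbit_comb_add)

text \<open>The matrices T^k W with k \<le> N^2 are N^2 + 1 elements of a space of dimension
  N^2.\<close>

lemma orbit_comb_annihilator: "\<exists>q. q \<noteq> 0 \<and> orbit_comb T W q = 0"
proof -
  obtain N where N: "supp_le N T" "supp_le N W" using supp_le_exists2 by blast
  define X where "X k = ((*) T ^^ k) W" for k
  have X: "supp_le N (X k)" for k
    by (induction k) (simp_all add: X_def N supp_le_times)
  define m where "m = Suc (N * N)"
  \<comment> \<open>Each row states the linear relation for one matrix entry; the last row is zero
    and only makes the system square, so that its determinant vanishes.\<close>
  define A where "A = mat m m (\<lambda>(r,k). if r = N * N then 0 else ent (X k) (r div N) (r mod N))"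
  have A: "A \<in> carrier_mat m m" by (simp add: A_def)
  have "row A (N * N) = 0\<^sub>v m" by (rule eq_vecI) (auto simp: A_def m_def)
  then have "A = mat\<^sub>r m m (\<lambda>i. if i = N * N then 0\<^sub>v m else row A i)"
    by (intro eq_rowI) (auto simp: A_def)
  then have "det A = 0"
    using det_row_0[of "N * N" m "row A"] A by (simp add: m_def)
  then obtain v where v: "v \<in> carrier_vec m" "v \<noteq> 0\<^sub>v m" "A *\<^sub>v v = 0\<^sub>v m"
    using det_0_iff_vec_prod_zero[OF A] by blast
  define q where "q = (\<Sum>k<m. monom (v $ k) k)"
  have coeff: "poly.coeff q k = v $ k" if "k < m" for k
    using that by (simp add: q_def coeff_sum)
  have "q \<noteq> 0"
  proof
    assume "q = 0"
    then have "v $ k = 0" if "k < m" for k using coeff[OF that] by simp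
    then have "v = 0\<^sub>v m" using v(1) by (intro eq_vecI) auto
    then show False using v(2) by simp
  qed
  moreover have "orbit_comb T W q = 0"
  proof (rule fmat_eqI)
    fix i j
    have entq: "ent (orbit_comb T W q) i j = (\<Sum>k<m. v $ k * ent (X k) i j)"
    proof -
      have "ent (\<Sum>k\<in>K. Y k) i j = (\<Sum>k\<in>K. ent (Y k) i j)" for K and Y :: "nat \<Rightarrow> fmat"
        by (induction K rule: infinite_finite_induct) (simp_all add: zero_fmat.rep_eq plus_fmat.rep_eq)
      then show ?thesis by (simp add: q_def orbit_comb_sum orbit_comb_monom X_def scl.rep_eq)
    qed
    show "ent (orbit_comb T W q) i j = ent 0 i j"
    proof (cases "i < N \<and> j < N")
      case True
      define r where "r = i * N + j"
      have "i * N + j < (i + 1) * N" using True by simp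
      also have "\<dots> \<le> N * N" using True by (intro mult_right_mono) auto
      finally have r: "r < N * N" "r div N = i" "r mod N = j" using True by (simp_all add: r_def)
      then have "0 = (A *\<^sub>v v) $ r" using v(3) by (simp add: m_def)
      also have "\<dots> = (\<Sum>k<m. ent (X k) i j * v $ k)"
        using r v(1) by (simp add: A_def m_def scalar_prod_def lessThan_atLeast0)
      finally show ?thesis by (simp add: entq zero_fmat.rep_eq mult.commute)
    next
      case False
      then have "ent (X k) i j = 0" for k using X[of k] by (auto simp: supp_le_def)
      then show ?thesis by (simp add: entq zero_fmat.rep_eq)
    qed
  qed
  ultimately show ?thesis by blast
qed

text \<open>Let q be the annihilator of \<open>W\<close> of least degree and \<open>a\<close> a root
  of it. Then W' = (q / (X - a))(T) W is nonzero by minimality. As a polynomial in \<open>T\<close>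
  applied to \<open>W\<close>, it inherits every eigenvalue of an operator commuting with
  \<open>T\<close>.\<close>

lemma eigen_matrix_step:
  assumes "W \<noteq> 0"
  shows "\<exists>W' a. W' \<noteq> 0 \<and> T * W' = scl a W' \<and>
    (\<forall>S b. S * T = T * S \<longrightarrow> S * W = scl b W \<longrightarrow> S * W' = scl b W')"
proof -
  define d where "d = (LEAST d. \<exists>q. q \<noteq> 0 \<and> orbit_comb T W q = 0 \<and> degree q = d)"
  have ex: "\<exists>d q. q \<noteq> 0 \<and> orbit_comb T W q = 0 \<and> degree q = d"
    using orbit_comb_annihilator by blast
  obtain q where q: "q \<noteq> 0" "orbit_comb T W q = 0" "degree q = d"
    using LeastI_ex[OF ex] unfolding d_def by blast
  have min: "d \<le> degree q'" if "q' \<noteq> 0" "orbit_comb T W q' = 0" for q'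
    unfolding d_def by (rule Least_le) (use that in blast)
  have "degree q \<noteq> 0"
  proof
    assume "degree q = 0"
    then obtain c where c: "q = [:c:]" by (rule degree_eq_zeroE)
    then have "scl c W = 0" using q(2) by (simp add: orbit_comb_pCons)
    then show False using c q(1) assms by simp
  qed
  then have "\<not> constant (poly q)" by (simp add: constant_degree)
  then obtain a where "poly q a = 0" using fundamental_theorem_of_algebra by blast
  then obtain q' where q': "q = [:-a, 1:] * q'" by (metis dvdE poly_eq_0_iff_dvd)
  define W' where "W' = orbit_comb T W q'"
  have q'0: "q' \<noteq> 0" using q q' by auto
  have "degree q = Suc (degree q')" unfolding q' using q'0 by (subst degree_mult_eq) auto
  then have "W' \<noteq> 0" using min[OF q'0] q(3) unfolding W'_def by linarith
  moreover have "T * W' = scl a W'"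
  proof -
    have "q = smult (-a) q' + pCons 0 q'" by (simp add: q')
    then have "0 = scl (-a) W' + T * W'"
      using q(2) orbit_comb_add[of T W "smult (-a) q'" "pCons 0 q'"]
        orbit_comb_smult[of T W "-a" q'] orbit_comb_pCons[of T W 0 q'] by (simp add: W'_def)
    then show ?thesis by (simp add: fmat.scale_minus_left)
  qed
  moreover have "S * W' = scl b W'" if S: "S * T = T * S" "S * W = scl b W" for S b
  proof -
    have "S * orbit_comb T W p = scl b (orbit_comb T W p)" for p
    proof (induction p)
      case (pCons c p)
      have "S * (T * orbit_comb T W p) = T * (S * orbit_comb T W p)"
        by (simp add: S(1) flip: mult.assoc)
      then show ?case using pCons
        by (simp add: orbit_comb_pCons ring_distribs scl_mult_right S(2) fmat.scale_right_distrib mult.commute)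
    qed simp
    then show ?thesis by (simp add: W'_def)
  qed
  ultimately show ?thesis by blast
qed

text \<open>The extra operator \<open>S\<close> carries an eigenvalue known in advance through the
  induction. It will be \<open>idm n\<close> with eigenvalue 1, which keeps the eigenvector inside
  the representation space.\<close>

lemma common_eigen_matrix:
  assumes "finite F" "E0 \<noteq> 0" "\<And>x y. x \<in> F \<Longrightarrow> y \<in> F \<Longrightarrow> T x * T y = T y * T x"
    and "\<And>x. x \<in> F \<Longrightarrow> S * T x = T x * S" "S * E0 = scl b E0"
  shows "\<exists>E c. E \<noteq> 0 \<and> S * E = scl b E \<and> (\<forall>x\<in>F. T x * E = scl (c x) E)"
proof -
  have "\<exists>E. E \<noteq> 0 \<and> S * E = scl b E \<and> (\<forall>x\<in>F'. \<exists>c. T x * E = scl c E)" if "F' \<subseteq> F" for F'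
    using finite_subset[OF that assms(1)] that
  proof (induction F')
    case empty
    then show ?case using assms by auto
  next
    case (insert x F')
    then obtain E where E: "E \<noteq> 0" "S * E = scl b E" "\<forall>x\<in>F'. \<exists>c. T x * E = scl c E" by auto
    obtain W' a where W': "W' \<noteq> 0" "T x * W' = scl a W'"
      "\<And>S b. S * T x = T x * S \<Longrightarrow> S * E = scl b E \<Longrightarrow> S * W' = scl b W'"
      using eigen_matrix_step[OF E(1), of "T x"] by blast
    have "\<exists>c. T y * W' = scl c W'" if "y \<in> F'" for y
      using W'(3)[of "T y"] E(3) that assms(3) insert.prems by blast
    moreover have "S * W' = scl b W'" using W'(3) E(2) assms(4) insert.prems by blast
    ultimately show ?case using W' by blast
  qed
  from this[OF subset_refl] show ?thesis by metis
qed

section \<open>Spherical functions\<close>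

context group
begin

abbreviation conjg :: "'a \<Rightarrow> 'a \<Rightarrow> 'a" where
  "conjg g x \<equiv> g \<otimes> x \<otimes> inv g"

abbreviation subgrp where
  "subgrp A \<equiv> G\<lparr>carrier := A\<rparr>"

lemma conj_mult:
  assumes "y \<in> carrier G" "a \<in> carrier G" "b \<in> carrier G"
  shows "conjg y (a \<otimes> b) = (conjg y a) \<otimes> (conjg y b)"
proof -
  have "(conjg y a) \<otimes> (conjg y b) = y \<otimes> a \<otimes> (inv y \<otimes> y) \<otimes> b \<otimes> inv y"
    using assms by (simp only: m_assoc m_closed inv_closed)
  then show ?thesis using assms by (simp add: m_assoc)
qed

lemma conj_inv:
  "y \<in> carrier G \<Longrightarrow> a \<in> carrier G \<Longrightarrow> conjg y (inv a) = inv (conjg y a)"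
  by (simp add: inv_mult_group m_assoc)

lemma conj_cancel:
  assumes "y \<in> carrier G" "x \<in> carrier G"
  shows "inv y \<otimes> (conjg y x) \<otimes> y = x" and "conjg y (inv y \<otimes> x \<otimes> y) = x"
proof -
  have "inv y \<otimes> (conjg y x) \<otimes> y = (inv y \<otimes> y) \<otimes> x \<otimes> (inv y \<otimes> y)"
    using assms by (simp only: m_assoc m_closed inv_closed)
  then show "inv y \<otimes> (conjg y x) \<otimes> y = x" using assms by simp
  have "conjg y (inv y \<otimes> x \<otimes> y) = (y \<otimes> inv y) \<otimes> x \<otimes> (y \<otimes> inv y)"
    using assms by (simp only: m_assoc m_closed inv_closed)
  then show "conjg y (inv y \<otimes> x \<otimes> y) = x" using assms by simp
qed

lemma conj_subgroup:
  assumes P: "subgroup P G" and g: "g \<in> carrier G"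
  shows "subgroup ((conjg g) ` P) G" and "card ((conjg g) ` P) = card P"
proof -
  have "group_hom G G (conjg g)"
    using g by (intro group_hom.intro group_hom_axioms.intro is_group) (auto simp: hom_def conj_mult)
  then show "subgroup ((conjg g) ` P) G" using P by (rule group_hom.subgroup_img_is_subgroup)
  have "inj_on (conjg g) P"
    using g subgroup.mem_carrier[OF P] by (intro inj_onI) auto
  then show "card ((conjg g) ` P) = card P" by (rule card_image)
qed

lemma pow_mod_period:
  assumes "g \<in> carrier G" "g [^] (N::nat) = \<one>"
  shows "g [^] (j mod N) = g [^] (j::nat)"
proof -
  have "g [^] j = g [^] (N * (j div N) + j mod N)" by simp
  also have "\<dots> = g [^] (j mod N)"
    using assms by (simp only: nat_pow_mult[symmetric] nat_pow_pow[symmetric]) simp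
  finally show ?thesis by simp
qed

lemma pow_card_subgroup:
  assumes K: "subgroup K G" and x: "x \<in> K"
  shows "x [^] card K = \<one>"
proof -
  interpret K: group "subgrp K" using subgroup.subgroup_is_group[OF K is_group] .
  show ?thesis using K.pow_order_eq_1[of x] x nat_pow_consistent[of x _ K] by (simp add: Coset.order_def)
qed

lemma dvd_card_pow_one:
  assumes "card (carrier G) dvd N" "g \<in> carrier G"
  shows "g [^] N = \<one>"
proof -
  obtain k where "N = card (carrier G) * k" using assms(1) by (elim dvdE)
  moreover have "g [^] (card (carrier G) * k) = (g [^] card (carrier G)) [^] k"
    using assms(2) by (rule nat_pow_pow[symmetric])
  ultimately show ?thesis using pow_order_eq_1[OF assms(2)] by (simp add: Coset.order_def)
qed

lemma card_subgroup_dvd: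
  assumes "subgroup A G" "subgroup B G" "A \<subseteq> B"
  shows "card A dvd card B"
proof -
  interpret B: group "subgrp B" using subgroup.subgroup_is_group[OF assms(2) is_group] .
  have "card (rcosets\<^bsub>subgrp B\<^esub> A) * card A = card B"
    using B.lagrange[OF subgroup_incl[OF assms]] by (simp add: Coset.order_def)
  then show ?thesis by (metis dvd_triv_right)
qed

end

locale finite_subgroup = group G for G (structure) + fixes M
  assumes sub: "subgroup M G" and fin: "finite M"
begin

lemma memG [simp, intro]: "x \<in> M \<Longrightarrow> x \<in> carrier G"
  using subgroup.mem_carrier[OF sub] .

lemma memM [simp, intro]: "\<one> \<in> M" "x \<in> M \<Longrightarrow> y \<in> M \<Longrightarrow> x \<otimes> y \<in> M" "x \<in> M \<Longrightarrow> inv x \<in> M"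
  using sub by (auto simp: subgroup.one_closed subgroup.m_closed subgroup.m_inv_closed)

lemma card_pos: "card M > 0"
  using fin memM(1) by (auto simp: card_gt_0_iff)

lemma sum_left_mult: "y \<in> M \<Longrightarrow> (\<Sum>x\<in>M. f (y \<otimes> x)) = sum f M"
  by (rule sum.reindex_bij_witness[of _ "\<lambda>x. inv y \<otimes> x" "\<lambda>x. y \<otimes> x"]) (auto simp flip: m_assoc)

lemma sum_right_mult: "y \<in> M \<Longrightarrow> (\<Sum>x\<in>M. f (x \<otimes> y)) = sum f M"
  by (rule sum.reindex_bij_witness[of _ "\<lambda>x. x \<otimes> inv y" "\<lambda>x. x \<otimes> y"]) (auto simp: m_assoc)

lemma sum_inv: "(\<Sum>x\<in>M. f (inv x)) = sum f M"
  by (rule sum.reindex_bij_witness[of _ "\<lambda>x. inv x" "\<lambda>x. inv x"]) auto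

lemma sum_conj:
  assumes "y \<in> carrier G" "\<And>x. x \<in> M \<Longrightarrow> conjg y x \<in> M" "\<And>x. x \<in> M \<Longrightarrow> inv y \<otimes> x \<otimes> y \<in> M"
  shows "(\<Sum>x\<in>M. f (conjg y x)) = sum f M"
  by (rule sum.reindex_bij_witness[of _ "\<lambda>x. inv y \<otimes> x \<otimes> y" "\<lambda>x. conjg y x"])
    (use assms conj_cancel in auto)

text \<open>The solutions of this equation are the quotients \<open>\<theta> / \<theta>(\<one>)\<close> of the irreducible characters
  \<open>\<theta>\<close> of \<open>M\<close>. They are read off from a representation without splitting it into
  irreducible constituents.\<close>

definition spherical :: "('a \<Rightarrow> complex) \<Rightarrow> bool" where
  "spherical \<eta> \<longleftrightarrow> \<eta> \<one> = 1 \<and> (\<forall>x. x \<notin> M \<longrightarrow> \<eta> x = 0) \<and>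
     (\<forall>c\<in>M. \<forall>d\<in>M. of_nat (card M) * (\<eta> c * \<eta> d) = (\<Sum>x\<in>M. \<eta> (c \<otimes> (conjg x d))))"

text \<open>No complex conjugation occurs, so this is a polynomial in the values. On \<theta> /
  \<theta>(1) paired with itself it gives |M| / \<theta>(1)^2.\<close>

definition pairing :: "('a \<Rightarrow> complex) \<Rightarrow> ('a \<Rightarrow> complex) \<Rightarrow> complex" where
  "pairing \<eta> \<theta> = (\<Sum>m\<in>M. \<eta> m * \<theta> (inv m))"

lemma spherical_one: "spherical \<eta> \<Longrightarrow> \<eta> \<one> = 1"
  by (simp add: spherical_def)

lemma spherical_eq: "spherical \<eta> \<Longrightarrow> c \<in> M \<Longrightarrow> d \<in> M \<Longrightarrow>
    (\<Sum>x\<in>M. \<eta> (c \<otimes> (conjg x d))) = of_nat (card M) * (\<eta> c * \<eta> d)"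
  by (simp add: spherical_def)

text \<open>With c = 1 the functional equation says that \<eta> is its own average over
  conjugates.\<close>

lemma spherical_conj:
  assumes s: "spherical \<eta>" and y: "y \<in> M" and d: "d \<in> M"
  shows "\<eta> (conjg y d) = \<eta> d"
proof -
  have *: "of_nat (card M) * \<eta> e = (\<Sum>x\<in>M. \<eta> (conjg x e))" if "e \<in> M" for e
    using spherical_eq[OF s memM(1) that] that spherical_one[OF s] by simp
  have "of_nat (card M) * \<eta> (conjg y d) = (\<Sum>x\<in>M. \<eta> (conjg x (conjg y d)))"
    using y d by (intro *) auto
  also have "\<dots> = (\<Sum>x\<in>M. \<eta> ((x \<otimes> y) \<otimes> d \<otimes> inv (x \<otimes> y)))"
    using y d by (intro sum.cong refl) (simp add: inv_mult_group m_assoc)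
  also have "\<dots> = (\<Sum>x\<in>M. \<eta> (conjg x d))"
    using y by (rule sum_right_mult)
  also have "\<dots> = of_nat (card M) * \<eta> d" using d by (simp add: *)
  finally show ?thesis using card_pos by simp
qed

lemma spherical_mult_commute:
  assumes "spherical \<eta>" "c \<in> M" "d \<in> M"
  shows "\<eta> (c \<otimes> d) = \<eta> (d \<otimes> c)"
proof -
  have "conjg d (c \<otimes> d) = d \<otimes> c" using assms by (simp add: m_assoc)
  then show ?thesis using spherical_conj[OF assms(1,3), of "c \<otimes> d"] assms by simp
qed

text \<open>Since \<eta> is a class function, \<open>inv m\<close> may be replaced by any of its
  conjugates; averaging over them lets the functional equation split \<theta>. Convolution with
  \<eta> thus acts on \<theta> as a scalar.\<close>

lemma spherical_convolution:
  assumes s: "spherical \<eta>" and s': "spherical \<theta>" and h: "h \<in> M"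
  shows "(\<Sum>m\<in>M. \<eta> m * \<theta> (h \<otimes> inv m)) = pairing \<eta> \<theta> * \<theta> h"
proof -
  have *: "(\<Sum>m\<in>M. \<eta> m * \<theta> (h \<otimes> (conjg x (inv m)))) = (\<Sum>m\<in>M. \<eta> m * \<theta> (h \<otimes> inv m))"
    if x: "x \<in> M" for x
  proof -
    have "(\<Sum>m\<in>M. \<eta> m * \<theta> (h \<otimes> inv m)) = (\<Sum>m\<in>M. \<eta> (conjg x m) * \<theta> (h \<otimes> inv (conjg x m)))"
      by (subst sum_conj[of x]) (use x in auto)
    also have "\<dots> = (\<Sum>m\<in>M. \<eta> m * \<theta> (h \<otimes> (conjg x (inv m))))"
    proof (rule sum.cong[OF refl])
      fix m assume m: "m \<in> M"
      have "inv (conjg x m) = conjg x (inv m)"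
        using x m by (simp add: inv_mult_group m_assoc)
      then show "\<eta> (conjg x m) * \<theta> (h \<otimes> inv (conjg x m))
          = \<eta> m * \<theta> (h \<otimes> (conjg x (inv m)))"
        using spherical_conj[OF s x m] by simp
    qed
    finally show ?thesis by simp
  qed
  have "of_nat (card M) * (\<Sum>m\<in>M. \<eta> m * \<theta> (h \<otimes> inv m))
      = (\<Sum>x\<in>M. \<Sum>m\<in>M. \<eta> m * \<theta> (h \<otimes> (conjg x (inv m))))"
    by (simp add: *)
  also have "\<dots> = (\<Sum>m\<in>M. \<eta> m * (\<Sum>x\<in>M. \<theta> (h \<otimes> (conjg x (inv m)))))"
    by (subst sum.swap) (simp add: sum_distrib_left)
  also have "\<dots> = (\<Sum>m\<in>M. \<eta> m * (of_nat (card M) * (\<theta> h * \<theta> (inv m))))"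
    using h by (intro sum.cong refl) (simp add: spherical_eq[OF s'])
  also have "\<dots> = of_nat (card M) * (pairing \<eta> \<theta> * \<theta> h)"
    by (simp add: pairing_def sum_distrib_left sum_distrib_right mult_ac)
  finally show ?thesis using card_pos by simp
qed

lemma pairing_commute: "pairing \<eta> \<theta> = pairing \<theta> \<eta>"
  unfolding pairing_def by (subst sum_inv[symmetric]) (simp add: mult.commute)

text \<open>The convolution of \<eta> and \<theta> is a multiple of each of them, with the same
  factor \<open>pairing \<eta> \<theta>\<close>.\<close>

lemma spherical_orthogonal:
  assumes s: "spherical \<eta>" and s': "spherical \<theta>" and ne: "pairing \<eta> \<theta> \<noteq> 0"
  shows "\<eta> = \<theta>"
proof
  fix h show "\<eta> h = \<theta> h"
  proof (cases "h \<in> M")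
    case h: True
    have "pairing \<eta> \<theta> * \<theta> h = (\<Sum>m\<in>M. \<eta> m * \<theta> (h \<otimes> inv m))"
      using spherical_convolution[OF s s' h] by simp
    also have "\<dots> = (\<Sum>m\<in>M. \<eta> (m \<otimes> h) * \<theta> (h \<otimes> inv (m \<otimes> h)))"
      by (subst sum_right_mult[OF h]) simp
    also have "\<dots> = (\<Sum>m\<in>M. \<theta> (inv m) * \<eta> (h \<otimes> m))"
      using h by (intro sum.cong refl) (simp add: inv_mult_group mult.commute spherical_mult_commute[OF s] flip: m_assoc)
    also have "\<dots> = (\<Sum>m\<in>M. \<theta> m * \<eta> (h \<otimes> inv m))"
      by (subst sum_inv[symmetric]) (auto intro!: sum.cong)
    also have "\<dots> = pairing \<eta> \<theta> * \<eta> h"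
      using spherical_convolution[OF s' s h] pairing_commute by simp
    finally show ?thesis using ne by simp
  qed (use s s' in \<open>simp add: spherical_def\<close>)
qed

text \<open>The conjugate \<open>m \<mapsto> cnj (\<eta> (inv m))\<close> is again spherical, and its pairing with
  \<open>\<eta>\<close> is a sum of squares, so both coincide.\<close>

lemma spherical_pairing_self:
  assumes s: "spherical \<eta>"
  shows "pairing \<eta> \<eta> \<noteq> 0"
proof -
  define \<theta> where "\<theta> m = (if m \<in> M then cnj (\<eta> (inv m)) else 0)" for m
  have s': "spherical \<theta>"
    unfolding spherical_def
  proof (intro conjI ballI allI impI)
    fix c d assume c: "c \<in> M" and d: "d \<in> M"
    have "(\<Sum>x\<in>M. \<eta> (inv (c \<otimes> (conjg x d)))) = (\<Sum>x\<in>M. \<eta> (inv c \<otimes> (conjg x (inv d))))"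
      using c d by (intro sum.cong refl)
        (simp add: inv_mult_group m_assoc[symmetric] spherical_mult_commute[OF s, of _ "inv c"])
    also have "\<dots> = of_nat (card M) * (\<eta> (inv c) * \<eta> (inv d))"
      using c d by (intro spherical_eq[OF s]) auto
    finally have "cnj (\<Sum>x\<in>M. \<eta> (inv (c \<otimes> (conjg x d)))) = of_nat (card M) * (\<theta> c * \<theta> d)"
      using c d by (simp add: \<theta>_def)
    then show "of_nat (card M) * (\<theta> c * \<theta> d) = (\<Sum>x\<in>M. \<theta> (c \<otimes> (conjg x d)))"
      using c d by (simp add: \<theta>_def)
  qed (use spherical_one[OF s] in \<open>auto simp: \<theta>_def\<close>)
  have norm: "pairing \<eta> \<theta> = of_real (\<Sum>m\<in>M. (cmod (\<eta> m))\<^sup>2)"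
    unfolding pairing_def of_real_sum by (intro sum.cong refl) (simp add: \<theta>_def flip: complex_norm_square)
  have "(\<Sum>m\<in>M. (cmod (\<eta> m))\<^sup>2) \<ge> (cmod (\<eta> \<one>))\<^sup>2"
    using fin by (intro member_le_sum) auto
  then have ne: "pairing \<eta> \<theta> \<noteq> 0"
    unfolding norm of_real_eq_0_iff using spherical_one[OF s] by auto
  then show ?thesis using spherical_orthogonal[OF s s'] by metis
qed

text \<open>The quotient is the trace of the central idempotent of the regular representation
  attached to \<open>\<eta>\<close>, that is, the square of a character degree.\<close>

lemma spherical_pairing_self_dvd:
  assumes s: "spherical \<eta>"
  shows "\<exists>k. of_nat k * pairing \<eta> \<eta> = of_nat (card M)"
proof -
  define S where "S = pairing \<eta> \<eta>"
  have S: "S \<noteq> 0" using spherical_pairing_self[OF s] by (simp add: S_def)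
  define N where "N = card M"
  obtain e where e: "bij_betw e {..<N} M"
    using ex_bij_betw_nat_finite[OF fin] by (auto simp: N_def lessThan_atLeast0)
  have eM: "e i \<in> M" if "i < N" for i using bij_betwE[OF e] that by auto
  \<comment> \<open>This is convolution with \<eta> / S on the functions on \<open>M\<close>. It is
    idempotent by \<open>spherical_convolution\<close>, and each of its |M| diagonal entries is 1 /
    S.\<close>
  define A where "A = fmat_of_mat (mat N N (\<lambda>(i,j). \<eta> (inv (e i) \<otimes> e j) / S))"
  have A: "supp_le N A" unfolding A_def by (rule supp_le_fmat_of_mat) simp
  have ent: "ent A i j = (if i < N \<and> j < N then \<eta> (inv (e i) \<otimes> e j) / S else 0)" for i j
    by (simp add: A_def ent_fmat_of_mat)
  have "A * A = A"
  proof (rule fmat_eqI)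
    fix i j
    show "ent (A * A) i j = ent A i j"
    proof (cases "i < N \<and> j < N")
      case True
      then have i: "e i \<in> M" and j: "e j \<in> M" using eM by auto
      have "ent (A * A) i j = (\<Sum>k<N. \<eta> (inv (e i) \<otimes> e k) * \<eta> (inv (e k) \<otimes> e j) / (S * S))"
        unfolding ent_times[OF A] by (intro sum.cong refl) (use True in \<open>simp add: ent\<close>)
      also have "\<dots> = (\<Sum>m\<in>M. \<eta> (inv (e i) \<otimes> m) * \<eta> (inv m \<otimes> e j) / (S * S))"
        using sum.reindex_bij_betw[OF e, of "\<lambda>m. \<eta> (inv (e i) \<otimes> m) * \<eta> (inv m \<otimes> e j) / (S * S)"] by simp
      also have "\<dots> = (\<Sum>m\<in>M. \<eta> m * \<eta> (inv (e i \<otimes> m) \<otimes> e j) / (S * S))"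
        using i by (subst sum_left_mult[of "e i", symmetric]) (auto intro!: sum.cong simp flip: m_assoc)
      also have "\<dots> = (\<Sum>m\<in>M. \<eta> m * \<eta> ((inv (e i) \<otimes> e j) \<otimes> inv m)) / (S * S)"
        unfolding sum_divide_distrib using i j
        by (intro sum.cong refl) (simp add: inv_mult_group m_assoc spherical_mult_commute[OF s, of "inv _" "inv (e i) \<otimes> e j"])
      also have "\<dots> = \<eta> (inv (e i) \<otimes> e j) / S"
        using spherical_convolution[OF s s, of "inv (e i) \<otimes> e j"] i j S by (simp add: S_def)
      finally show ?thesis using True by (simp add: ent)
    next
      case False
      then show ?thesis using supp_le_times[OF A A] by (auto simp: ent supp_le_def)
    qed
  qed
  then obtain k where "tr A = of_nat k" using idempotent_tr_nat by blast
  moreover have "tr A = (\<Sum>i<N. 1 / S)"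
    unfolding tr_bound[OF A] using eM by (intro sum.cong refl) (simp add: ent spherical_one[OF s])
  ultimately have "of_nat k * S = of_nat (card M)" using S by (simp add: N_def field_simps)
  then show ?thesis unfolding S_def by blast
qed

text \<open>The constant 1 on \<open>M\<close> is spherical, and pairing with it is
  summation.\<close>

lemma spherical_trivial:
  assumes s: "spherical \<eta>" and ne: "(\<Sum>m\<in>M. \<eta> m) \<noteq> 0" and m: "m \<in> M"
  shows "\<eta> m = 1"
proof -
  define \<theta> :: "'a \<Rightarrow> complex" where "\<theta> m = (if m \<in> M then 1 else 0)" for m
  have s': "spherical \<theta>" by (auto simp: spherical_def \<theta>_def)
  have "pairing \<eta> \<theta> = (\<Sum>m\<in>M. \<eta> m)"
    unfolding pairing_def by (intro sum.cong refl) (simp add: \<theta>_def)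
  then have "\<eta> = \<theta>" using spherical_orthogonal[OF s s'] ne by simp
  then show ?thesis using m by (simp add: \<theta>_def)
qed

text \<open>The inverse map is the power with exponent (|M| + 1) / 2, which is
  \<open>Suc k\<close>.\<close>

lemma square_bij_odd:
  assumes "odd (card M)"
  shows "bij_betw (\<lambda>x. x \<otimes> x) M M"
proof -
  obtain k where k: "card M = 2 * k + 1" using assms by (rule oddE)
  have pw: "x [^] card M = \<one>" if "x \<in> M" for x using pow_card_subgroup[OF sub that] .
  have pc: "x [^] j \<in> M" if "x \<in> M" for x and j :: nat
    using that by (induction j) auto
  have sq: "(x \<otimes> x) [^] Suc k = x" if "x \<in> M" for x
  proof -
    have "(x \<otimes> x) [^] Suc k = x [^] (2 * Suc k)"
      using that by (subst nat_pow_pow[symmetric]) (auto simp: numeral_2_eq_2)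
    also have "\<dots> = x [^] card M \<otimes> x" using that by (simp add: k)
    finally show ?thesis using that pw by simp
  qed
  have "(x [^] Suc k) \<otimes> (x [^] Suc k) = x" if "x \<in> M" for x
  proof -
    have "(x [^] Suc k) \<otimes> (x [^] Suc k) = x [^] (card M + 1)"
      using that by (simp only: nat_pow_mult memG) (simp add: k mult_2)
    then show ?thesis using that pw by simp
  qed
  then show ?thesis using sq pc
    by (intro bij_betwI[of _ _ _ "\<lambda>x. x [^] Suc k"]) auto
qed

text \<open>Substituting c = u x^-1 turns c (x c x^-1) into u^2 x^-2, and for fixed u the element
  x^-2 runs through \<open>M\<close> once because |M| is odd.\<close>

lemma sum_square_twist:
  assumes "odd (card M)"
  shows "(\<Sum>c\<in>M. \<Sum>x\<in>M. f (c \<otimes> (conjg x c))) = of_nat (card M) * (\<Sum>m\<in>M. f m)"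
proof -
  have "(\<Sum>c\<in>M. \<Sum>x\<in>M. f (c \<otimes> (conjg x c))) = (\<Sum>x\<in>M. \<Sum>c\<in>M. f (c \<otimes> (conjg x c)))"
    by (rule sum.swap)
  also have "\<dots> = (\<Sum>x\<in>M. \<Sum>u\<in>M. f ((u \<otimes> u) \<otimes> (inv x \<otimes> inv x)))"
  proof (rule sum.cong[OF refl])
    fix x assume x: "x \<in> M"
    have "(\<Sum>c\<in>M. f (c \<otimes> (conjg x c)))
        = (\<Sum>u\<in>M. f ((u \<otimes> inv x) \<otimes> (conjg x (u \<otimes> inv x))))"
      using x by (subst sum_right_mult[of "inv x"]) auto
    also have "\<dots> = (\<Sum>u\<in>M. f ((u \<otimes> u) \<otimes> (inv x \<otimes> inv x)))"
    proof (rule sum.cong[OF refl], rule arg_cong[of _ _ f])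
      fix u assume u: "u \<in> M"
      have "(u \<otimes> inv x) \<otimes> (conjg x (u \<otimes> inv x)) = u \<otimes> (inv x \<otimes> x) \<otimes> u \<otimes> inv x \<otimes> inv x"
        using u x by (simp only: m_assoc m_closed inv_closed memG)
      then show "(u \<otimes> inv x) \<otimes> (conjg x (u \<otimes> inv x)) = (u \<otimes> u) \<otimes> (inv x \<otimes> inv x)"
        using u x by (simp add: m_assoc)
    qed
    finally show "(\<Sum>c\<in>M. f (c \<otimes> (conjg x c))) = (\<Sum>u\<in>M. f ((u \<otimes> u) \<otimes> (inv x \<otimes> inv x)))" .
  qed
  also have "\<dots> = (\<Sum>u\<in>M. \<Sum>x\<in>M. f ((u \<otimes> u) \<otimes> (inv x \<otimes> inv x)))" by (rule sum.swap)
  also have "\<dots> = (\<Sum>u\<in>M. \<Sum>m\<in>M. f m)"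
  proof (rule sum.cong[OF refl])
    fix u assume u: "u \<in> M"
    have "(\<Sum>x\<in>M. f ((u \<otimes> u) \<otimes> (inv x \<otimes> inv x))) = (\<Sum>x\<in>M. f ((u \<otimes> u) \<otimes> (x \<otimes> x)))"
      by (rule sum_inv)
    also have "\<dots> = (\<Sum>x\<in>M. f ((u \<otimes> u) \<otimes> x))"
      using sum.reindex_bij_betw[OF square_bij_odd[OF assms], of "\<lambda>x. f ((u \<otimes> u) \<otimes> x)"] .
    also have "\<dots> = (\<Sum>m\<in>M. f m)" using u by (intro sum_left_mult) auto
    finally show "(\<Sum>x\<in>M. f ((u \<otimes> u) \<otimes> (inv x \<otimes> inv x))) = (\<Sum>m\<in>M. f m)" .
  qed
  also have "\<dots> = of_nat (card M) * (\<Sum>m\<in>M. f m)" by simp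
  finally show ?thesis .
qed

text \<open>Burnside's fact that a group of odd order has no nontrivial real irreducible character:
  reality makes \<open>pairing \<eta> \<eta>\<close> a sum of squares, the functional equation with
  c = d expands each square, and the twist reduces everything to the sum of \<eta>.\<close>

lemma spherical_real_odd:
  assumes s: "spherical \<eta>" and odd: "odd (card M)"
    and real: "\<And>m. m \<in> M \<Longrightarrow> \<eta> (inv m) = \<eta> m"
  shows "(\<Sum>m\<in>M. \<eta> m) \<noteq> 0"
proof
  assume 0: "(\<Sum>m\<in>M. \<eta> m) = 0"
  have "of_nat (card M) * pairing \<eta> \<eta> = (\<Sum>m\<in>M. of_nat (card M) * (\<eta> m * \<eta> m))"
    by (simp add: pairing_def real sum_distrib_left)
  also have "\<dots> = (\<Sum>m\<in>M. \<Sum>x\<in>M. \<eta> (m \<otimes> (conjg x m)))"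
    by (intro sum.cong refl) (simp add: spherical_eq[OF s])
  also have "\<dots> = 0" using sum_square_twist[OF odd, of \<eta>] 0 by simp
  finally show False using spherical_pairing_self[OF s] card_pos by simp
qed

end

section \<open>Fixed points of p-groups\<close>

text \<open>\<open>R\<close> is the additive monoid in which the quotient \<open>(sum f X - sum f (Fix X)) / p\<close> lives.\<close>

lemma (in group) p_group_sum_fixed_points:
  fixes act :: "'a \<Rightarrow> 'x \<Rightarrow> 'x" and f :: "'x \<Rightarrow> complex"
  assumes P: "subgroup P G" "card P = p ^ k" "Factorial_Ring.prime p"
    and fin: "finite X"
    and act: "\<And>y x. y \<in> P \<Longrightarrow> x \<in> X \<Longrightarrow> act y x \<in> X"
      "\<And>x. x \<in> X \<Longrightarrow> act \<one> x = x"
      "\<And>y y' x. y \<in> P \<Longrightarrow> y' \<in> P \<Longrightarrow> x \<in> X \<Longrightarrow> act (y \<otimes> y') x = act y (act y' x)"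
    and inv: "\<And>y x. y \<in> P \<Longrightarrow> x \<in> X \<Longrightarrow> f (act y x) = f x"
    and R: "0 \<in> R" "\<And>a b. a \<in> R \<Longrightarrow> b \<in> R \<Longrightarrow> a + b \<in> R" "\<And>x. x \<in> X \<Longrightarrow> f x \<in> R"
  shows "\<exists>z\<in>R. sum f X = sum f {x \<in> X. \<forall>y\<in>P. act y x = x} + of_nat p * z"
  using fin act inv R(3)
proof (induction "card X" arbitrary: X rule: less_induct)
  case less
  note act = less.prems(2-4) and inv = less.prems(5) and fR = less.prems(6)
  have one: "\<one> \<in> P" and mP: "\<And>y y'. y \<in> P \<Longrightarrow> y' \<in> P \<Longrightarrow> y \<otimes> y' \<in> P"
    and iP: "\<And>y. y \<in> P \<Longrightarrow> inv y \<in> P" and PG: "\<And>y. y \<in> P \<Longrightarrow> y \<in> carrier G"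
    using P(1) by (auto simp: subgroup.one_closed subgroup.m_closed subgroup.m_inv_closed subgroup.mem_carrier)
  have finP: "finite P" using P(2,3) prime_gt_0_nat[OF P(3)] by (intro card_ge_0_finite) simp
  have cancel: "act (inv y) (act y x) = x" if "y \<in> P" "x \<in> X" for y x
    using act(3)[OF iP[OF that(1)] that] act(2)[OF that(2)] PG[OF that(1)] by simp
  let ?F = "\<lambda>X. {x \<in> X. \<forall>y\<in>P. act y x = x}"
  show ?case
  proof (cases "?F X = X")
    case True
    then show ?thesis by (intro bexI[of _ 0] R(1)) simp
  next
    case False
    then obtain x0 y0 where x0: "x0 \<in> X" "y0 \<in> P" "act y0 x0 \<noteq> x0" by blast
    \<comment> \<open>The induction splits off the orbit of a point that is not fixed. All fibres of
      y \<mapsto> y x0 have the size of the stabiliser \<open>S\<close>, so the orbit length is a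
      power of \<open>p\<close>, and it exceeds 1. Hence the orbit contributes \<open>p\<close>
      times a sum of copies of \<open>f x0\<close>, which stays in \<open>R\<close> by
      additivity.\<close>
    define Orb where "Orb = (\<lambda>y. act y x0) ` P"
    have x0O: "x0 \<in> Orb" unfolding Orb_def using act(2)[OF x0(1)] one by force
    have OX: "Orb \<subseteq> X" using act(1) x0(1) by (auto simp: Orb_def)
    define S where "S = {y \<in> P. act y x0 = x0}"
    have "card {y \<in> P. act y x0 = w} = card S" if w: "w \<in> Orb" for w
    proof -
      obtain u where u: "u \<in> P" "w = act u x0" using w by (auto simp: Orb_def)
      have "bij_betw (\<lambda>y. u \<otimes> y) S {y \<in> P. act y x0 = w}"
      proof (rule bij_betwI[of _ _ _ "\<lambda>y. inv u \<otimes> y"])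
        show "(\<lambda>y. u \<otimes> y) \<in> S \<rightarrow> {y \<in> P. act y x0 = w}"
          using u x0(1) by (auto simp: S_def mP act(3))
        show "(\<lambda>y. inv u \<otimes> y) \<in> {y \<in> P. act y x0 = w} \<rightarrow> S"
          using u x0(1) by (auto simp: S_def mP iP act(3) cancel)
      qed (use u PG in \<open>auto simp: S_def simp flip: m_assoc\<close>)
      then show ?thesis by (rule bij_betw_same_card[symmetric])
    qed
    then have "(\<Sum>w\<in>Orb. card {y \<in> P. act y x0 = w}) = card Orb * card S" by simp
    moreover have "card P = (\<Sum>w\<in>Orb. card {y \<in> P. act y x0 = w})"
      using sum.image_gen[OF finP, of "\<lambda>_. 1::nat" "\<lambda>y. act y x0"] by (simp add: Orb_def)
    ultimately have "card Orb dvd p ^ k" using P(2) by simp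
    then obtain i where i: "card Orb = p ^ i" using divides_primepow_nat[OF P(3)] by blast
    have "finite Orb" using finP by (simp add: Orb_def)
    have "{x0, act y0 x0} \<subseteq> Orb" using x0O x0(2) by (auto simp: Orb_def)
    then have "card {x0, act y0 x0} \<le> card Orb" using \<open>finite Orb\<close> by (intro card_mono)
    then have "card Orb \<noteq> 1" using x0(3) by auto
    then obtain j where j: "card Orb = p * j" using i by (cases i) auto
    have "sum f Orb = (\<Sum>w\<in>Orb. f x0)"
      using inv x0(1) by (intro sum.cong refl) (auto simp: Orb_def)
    then have sumO: "sum f Orb = of_nat p * (of_nat j * f x0)" by (simp add: j)
    have multR: "of_nat l * f x0 \<in> R" for l :: nat
      by (induction l) (auto simp: R(1,2) fR x0(1) ring_distribs)
    have "\<exists>z\<in>R. sum f (X - Orb) = sum f (?F (X - Orb)) + of_nat p * z"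
    proof (rule less.hyps)
      show "card (X - Orb) < card X" using less.prems(1) x0O x0(1) by (intro psubset_card_mono) auto
      show "finite (X - Orb)" using less.prems(1) by simp
      fix y x assume y: "y \<in> P" and x: "x \<in> X - Orb"
      have "act y x \<notin> Orb"
      proof
        assume "act y x \<in> Orb"
        then obtain u where "u \<in> P" "act y x = act u x0" by (auto simp: Orb_def)
        then have "x = act (inv y \<otimes> u) x0" using cancel[of y x] x y x0(1) act(3) iP by force
        then show False using x mP iP y \<open>u \<in> P\<close> by (auto simp: Orb_def)
      qed
      then show "act y x \<in> X - Orb" using act(1) x y by blast
    qed (use act inv fR in auto)
    then obtain z where z: "z \<in> R" "sum f (X - Orb) = sum f (?F (X - Orb)) + of_nat p * z" by blast
    have "?F (X - Orb) = ?F X"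
    proof (intro equalityI subsetI)
      fix x assume x: "x \<in> ?F X"
      have "x \<notin> Orb"
      proof
        assume "x \<in> Orb"
        then obtain u where u: "u \<in> P" "x = act u x0" by (auto simp: Orb_def)
        then have "x0 = act (inv u) x" using cancel x0(1) by simp
        also have "\<dots> = x" using x iP[OF u(1)] by auto
        finally show False using x x0(2,3) by auto
      qed
      then show "x \<in> ?F (X - Orb)" using x by auto
    qed auto
    moreover have "sum f X = sum f (X - Orb) + sum f Orb"
      using OX less.prems(1) by (metis sum.subset_diff)
    ultimately have "sum f X = sum f (?F X) + of_nat p * (z + of_nat j * f x0)"
      using z sumO by (simp add: ring_distribs)
    then show ?thesis using R(2)[OF z(1) multR] by blast
  qed
qed

text \<open>The case f = 1 with the natural numbers as \<open>R\<close>.\<close>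

lemma (in group) p_group_card_fixed_points:
  fixes act :: "'a \<Rightarrow> 'x \<Rightarrow> 'x"
  assumes P: "subgroup P G" "card P = p ^ k" "Factorial_Ring.prime p"
    and fin: "finite X"
    and act: "\<And>y x. y \<in> P \<Longrightarrow> x \<in> X \<Longrightarrow> act y x \<in> X"
      "\<And>x. x \<in> X \<Longrightarrow> act \<one> x = x"
      "\<And>y y' x. y \<in> P \<Longrightarrow> y' \<in> P \<Longrightarrow> x \<in> X \<Longrightarrow> act (y \<otimes> y') x = act y (act y' x)"
    and ndvd: "\<not> p dvd card X"
  shows "\<exists>x\<in>X. \<forall>y\<in>P. act y x = x"
proof (rule ccontr)
  assume "\<not> ?thesis"
  then have empty: "{x \<in> X. \<forall>y\<in>P. act y x = x} = {}" by blast
  have "\<exists>z\<in>\<nat>. sum (\<lambda>_. 1) X = sum (\<lambda>_. 1::complex) {x \<in> X. \<forall>y\<in>P. act y x = x} + of_nat p * z"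
    by (rule p_group_sum_fixed_points[OF P fin act]) auto
  then obtain z where "of_nat (card X) = of_nat p * (of_nat z :: complex)"
    unfolding empty by (auto elim: Nats_cases)
  then have "card X = p * z" by (metis of_nat_eq_iff of_nat_mult)
  then show False using ndvd by simp
qed

text \<open>\<open>Q\<close> acts on the cosets of \<open>P\<close> in \<open>S\<close>, whose
  number \<open>j\<close> is prime to \<open>p\<close>. A fixed coset P s means that s Q s^-1 lies
  in \<open>P\<close>.\<close>

lemma (in group) sylow_conjugate_subset:
  assumes fin: "finite S" and S: "subgroup S G" and P: "subgroup P G" "P \<subseteq> S"
    and ndvd: "card S = card P * j" "\<not> p dvd j"
    and Q: "subgroup Q G" "Q \<subseteq> S" "card Q = p ^ k" and p: "Factorial_Ring.prime p"
  shows "\<exists>s\<in>S. \<forall>q\<in>Q. conjg s q \<in> P"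
proof -
  interpret S: group "subgrp S" using subgroup.subgroup_is_group[OF S is_group] .
  have SG: "S \<subseteq> carrier G" using S by (rule subgroup.subset)
  have PS: "subgroup P (subgrp S)" using P S by (intro subgroup_incl)
  define X where "X = rcosets\<^bsub>subgrp S\<^esub> P"
  have X: "X = (\<lambda>s. P #> s) ` S"
    by (auto simp: X_def RCOSETS_def r_coset_def)
  have "card X * card P = card S"
    using S.lagrange[OF PS] by (simp add: X_def Coset.order_def)
  moreover have "card P > 0" using finite_subset[OF P(2) fin] subgroup.one_closed[OF P(1)] by (auto simp: card_gt_0_iff)
  ultimately have cX: "card X = j" using ndvd(1) by simp
  have iS: "\<And>q. q \<in> Q \<Longrightarrow> inv q \<in> S" and QS: "\<And>q. q \<in> Q \<Longrightarrow> q \<in> S" and QG: "\<And>q. q \<in> Q \<Longrightarrow> q \<in> carrier G"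
    using Q subgroup.m_inv_closed[OF S] SG by auto
  have mS: "\<And>a b. a \<in> S \<Longrightarrow> b \<in> S \<Longrightarrow> a \<otimes> b \<in> S" using subgroup.m_closed[OF S] .
  have PG: "P \<subseteq> carrier G" using P(2) SG by blast
  have XG: "x \<subseteq> carrier G" if "x \<in> X" for x using that PG SG by (auto simp: X r_coset_def)
  have "\<exists>x\<in>X. \<forall>q\<in>Q. x #> inv q = x"
  proof (rule p_group_card_fixed_points[OF Q(1,3) p])
    show "finite X" using fin by (simp add: X)
    show "\<not> p dvd card X" using cX ndvd(2) by simp
    fix q x assume q: "q \<in> Q" and x: "x \<in> X"
    then obtain s where s: "s \<in> S" "x = P #> s" by (auto simp: X)
    then have "x #> inv q = P #> (s \<otimes> inv q)" using q QG SG coset_mult_assoc[OF PG, of s "inv q"] by auto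
    then show "x #> inv q \<in> X" using s(1) iS[OF q] mS by (auto simp: X)
  next
    fix x assume "x \<in> X"
    then show "x #> inv \<one> = x" using XG by simp
  next
    fix q q' x assume "q \<in> Q" "q' \<in> Q" "x \<in> X"
    then show "x #> inv (q \<otimes> q') = (x #> inv q') #> inv q"
      using QG XG by (simp add: inv_mult_group coset_mult_assoc)
  qed
  then obtain s where s: "s \<in> S" "\<And>q. q \<in> Q \<Longrightarrow> (P #> s) #> inv q = P #> s" by (auto simp: X)
  have sG: "s \<in> carrier G" using s(1) SG by blast
  have "conjg s q \<in> P" if q: "q \<in> Q" for q
  proof -
    have iq: "inv q \<in> Q" using subgroup.m_inv_closed[OF Q(1) q] .
    have "P #> (s \<otimes> q) = P #> s" using s(2)[OF iq] q QG sG PG by (simp add: coset_mult_assoc)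
    moreover have "s \<otimes> q \<in> P #> (s \<otimes> q)" using rcos_self[OF _ P(1)] sG QG[OF q] by simp
    ultimately obtain h where h: "h \<in> P" "s \<otimes> q = h \<otimes> s" by (auto simp: r_coset_def)
    then have "conjg s q = h" using sG PG by (auto simp: m_assoc)
    then show ?thesis using h by simp
  qed
  then show ?thesis using s(1) by blast
qed

text \<open>The ring Z[z].\<close>

definition integral_at :: "complex \<Rightarrow> complex set" where
  "integral_at z = range (\<lambda>F. ipoly F z)"

lemma integral_at_0: "0 \<in> integral_at z"
  unfolding integral_at_def by (rule range_eqI[of _ _ 0]) simp

lemma integral_at_add: "a \<in> integral_at z \<Longrightarrow> b \<in> integral_at z \<Longrightarrow> a + b \<in> integral_at z"
  unfolding integral_at_def by (auto simp only: ipoly_add[symmetric])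

lemma integral_at_mult: "a \<in> integral_at z \<Longrightarrow> b \<in> integral_at z \<Longrightarrow> a * b \<in> integral_at z"
  unfolding integral_at_def by (auto simp only: ipoly_mult[symmetric])

lemma integral_at_diff: "a \<in> integral_at z \<Longrightarrow> b \<in> integral_at z \<Longrightarrow> a - b \<in> integral_at z"
  unfolding integral_at_def by (auto simp only: ipoly_diff[symmetric])

lemma integral_at_of_nat: "of_nat k \<in> integral_at z"
  unfolding integral_at_def using ipoly_of_nat[of k z] by (metis rangeI)

lemma integral_at_sum: "(\<And>x. x \<in> X \<Longrightarrow> f x \<in> integral_at z) \<Longrightarrow> sum f X \<in> integral_at z"
  by (induction X rule: infinite_finite_induct) (auto simp: integral_at_0 integral_at_add)

lemma prime_dvd_of_nat_integral_at:
  assumes "z ^ n = 1" "n > 0" "p > 0" "of_nat c = of_nat p * a" "a \<in> integral_at z"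
  shows "p dvd c"
proof -
  obtain F where "a = ipoly F z" using assms(5) by (auto simp: integral_at_def)
  then have "int p dvd int c"
    using assms(4) by (intro dvd_of_int_eq_mult_ipoly[OF assms(1-3), of _ F]) simp
  then show ?thesis by simp
qed

lemma (in finite_subgroup) fixed_points_subgroup:
  assumes P: "P \<subseteq> carrier G" and C: "C = {m \<in> M. \<forall>y\<in>P. conjg y m = m}"
  shows "subgroup C G"
proof (rule subgroupI)
  show "C \<subseteq> carrier G" by (auto simp: C)
  show "C \<noteq> {}" using P by (auto simp: C intro!: exI[of _ \<one>])
  fix a assume a: "a \<in> C"
  have "conjg y (inv a) = inv a" if "y \<in> P" for y
    using conj_inv[of y a] a P that by (auto simp: C)
  then show "inv a \<in> C" using a by (simp add: C)
  fix b assume b: "b \<in> C"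
  have "conjg y (a \<otimes> b) = a \<otimes> b" if "y \<in> P" for y
    using conj_mult[of y a b] a b P that by (auto simp: C)
  then show "a \<otimes> b \<in> C" using a b by (simp add: C)
qed

text \<open>This replaces the Glauberman correspondence: modulo \<open>p\<close> all sums over \<open>M\<close> reduce to
  sums over the fixed points \<open>C\<close>, and on \<open>C\<close> reality turns \<open>\<eta> c * \<eta> (inv c)\<close> into \<open>\<eta> c * \<eta> c\<close>,
  whose average is that of \<open>\<eta>\<close> because squaring is bijective on \<open>C\<close>.\<close>

lemma (in finite_subgroup) spherical_real_fixed_points:
  assumes s: "spherical \<eta>" and p: "Factorial_Ring.prime p" "\<not> p dvd card M" "\<not> p dvd d"
    and z: "z ^ n = 1" "n > 0" and int: "\<And>m. m \<in> M \<Longrightarrow> of_nat d * \<eta> m \<in> integral_at z"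
    and P: "subgroup P G" "card P = p ^ k"
    and norm: "\<And>y m. y \<in> P \<Longrightarrow> m \<in> M \<Longrightarrow> conjg y m \<in> M"
    and P_inv: "\<And>y m. y \<in> P \<Longrightarrow> m \<in> M \<Longrightarrow> \<eta> (conjg y m) = \<eta> m"
    and C: "C = {m \<in> M. \<forall>y\<in>P. conjg y m = m}" and odd: "odd (card C)"
    and real: "\<And>c. c \<in> C \<Longrightarrow> \<eta> (inv c) = \<eta> c"
  shows "(\<Sum>m\<in>M. \<eta> m) \<noteq> 0"
proof
  assume 0: "(\<Sum>m\<in>M. \<eta> m) = 0"
  let ?I = "integral_at z"
  \<comment> \<open>The values of \<eta> have denominators; the factor \<open>d\<close>, prime to
    \<open>p\<close>, moves them into Z[z], where congruences modulo \<open>p\<close> make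
    sense.\<close>
  define t where "t m = of_nat d * \<eta> m" for m
  have tI: "t m \<in> ?I" if "m \<in> M" for m using int[OF that] by (simp add: t_def)
  have PG: "\<And>y. y \<in> P \<Longrightarrow> y \<in> carrier G" using subgroup.mem_carrier[OF P(1)] .
  have fixsum: "\<exists>a\<in>?I. sum f M = sum f C + of_nat p * a"
    if "\<And>m. m \<in> M \<Longrightarrow> f m \<in> ?I" "\<And>y m. y \<in> P \<Longrightarrow> m \<in> M \<Longrightarrow> f (conjg y m) = f m" for f
    unfolding C
    by (rule p_group_sum_fixed_points[OF P p(1) fin])
      (use that norm PG in \<open>auto simp: integral_at_0 integral_at_add inv_mult_group m_assoc\<close>)
  have CM: "C \<subseteq> M" by (auto simp: C)
  have subC: "subgroup C G" by (rule fixed_points_subgroup[OF subgroup.subset[OF P(1)] C])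
  interpret C: finite_subgroup G C
    using subC finite_subset[OF CM fin] by (intro finite_subgroup.intro finite_subgroup_axioms.intro is_group)
  have a1: "\<exists>a\<in>?I. (\<Sum>m\<in>M. t m * t (inv m)) = (\<Sum>c\<in>C. t c * t (inv c)) + of_nat p * a"
  proof (rule fixsum)
    fix m assume m: "m \<in> M"
    then show "t m * t (inv m) \<in> ?I" by (intro integral_at_mult tI) auto
    fix y assume y: "y \<in> P"
    have "inv (conjg y m) = conjg y (inv m)"
      using conj_inv[of y m] y m PG by simp
    then show "t (conjg y m) * t (inv (conjg y m)) = t m * t (inv m)"
      using P_inv[OF y m] P_inv[of y "inv m"] y m by (simp add: t_def)
  qed
  then obtain a1 where a1: "a1 \<in> ?I" "(\<Sum>m\<in>M. t m * t (inv m)) = (\<Sum>c\<in>C. t c * t (inv c)) + of_nat p * a1" by blast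
  obtain a2 where a2: "a2 \<in> ?I" "(\<Sum>m\<in>M. t m) = (\<Sum>c\<in>C. t c) + of_nat p * a2"
    using fixsum[of t] tI by (auto simp: t_def P_inv)
  \<comment> \<open>For a fixed c in \<open>C\<close> the summand is invariant under conjugating x
    by \<open>P\<close>, since \<open>P\<close> centralises c and preserves \<eta>.\<close>
  have "\<exists>a\<in>?I. (\<Sum>x\<in>M. t (c \<otimes> (conjg x c))) = (\<Sum>x\<in>C. t (c \<otimes> (conjg x c))) + of_nat p * a"
    if c: "c \<in> C" for c
  proof (rule fixsum)
    have cM: "c \<in> M" using c CM by auto
    fix m assume m: "m \<in> M"
    show "t (c \<otimes> (conjg m c)) \<in> ?I" using m cM by (intro tI) auto
    fix y assume y: "y \<in> P"
    have cy: "conjg y c = c" using c y by (simp add: C)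
    have "c \<otimes> (conjg y m \<otimes> c \<otimes> inv (conjg y m))
        = (conjg y c) \<otimes> ((conjg y m) \<otimes> (conjg y c) \<otimes> (conjg y (inv m)))"
      using m y PG by (simp add: cy conj_inv)
    also have "\<dots> = conjg y (c \<otimes> (conjg m c))"
      using m cM PG[OF y] conj_mult[of y c "conjg m c"] conj_mult[of y "m \<otimes> c" "inv m"] conj_mult[of y m c]
      by simp
    finally show "t (c \<otimes> (conjg y m \<otimes> c \<otimes> inv (conjg y m))) = t (c \<otimes> (conjg m c))"
      using m cM y P_inv by (simp add: t_def)
  qed
  then have "\<forall>c\<in>C. \<exists>a. a \<in> ?I \<and>
      (\<Sum>x\<in>M. t (c \<otimes> (conjg x c))) = (\<Sum>x\<in>C. t (c \<otimes> (conjg x c))) + of_nat p * a"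
    by blast
  from bchoice[OF this] obtain b where b: "\<And>c. c \<in> C \<Longrightarrow> b c \<in> ?I"
    "\<And>c. c \<in> C \<Longrightarrow> (\<Sum>x\<in>M. t (c \<otimes> (conjg x c))) = (\<Sum>x\<in>C. t (c \<otimes> (conjg x c))) + of_nat p * b c"
    by blast
  \<comment> \<open>Reality on \<open>C\<close> gives squares and the functional equation of
    \<open>M\<close> expands them. Then x is reduced from \<open>M\<close> to \<open>C\<close>
    modulo \<open>p\<close>, the twist on \<open>C\<close> applies, and the remaining sum of t over
    \<open>C\<close> is congruent to the sum over \<open>M\<close>, which vanishes.\<close>
  have "of_nat (card M) * (\<Sum>c\<in>C. t c * t (inv c)) = (\<Sum>c\<in>C. of_nat d * (of_nat d * (of_nat (card M) * (\<eta> c * \<eta> c))))"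
    by (simp add: t_def real sum_distrib_left mult_ac)
  also have "\<dots> = (\<Sum>c\<in>C. of_nat d * (\<Sum>x\<in>M. t (c \<otimes> (conjg x c))))"
  proof (rule sum.cong[OF refl])
    fix c assume "c \<in> C"
    then have "c \<in> M" using CM by blast
    then show "of_nat d * (of_nat d * (of_nat (card M) * (\<eta> c * \<eta> c)))
        = of_nat d * (\<Sum>x\<in>M. t (c \<otimes> (conjg x c)))"
      unfolding t_def sum_distrib_left[symmetric] by (simp only: spherical_eq[OF s])
  qed
  also have "\<dots> = of_nat d * (\<Sum>c\<in>C. \<Sum>x\<in>C. t (c \<otimes> (conjg x c))) + of_nat p * (of_nat d * sum b C)"
    by (simp add: b(2) sum_distrib_left sum.distrib ring_distribs mult_ac)
  also have "(\<Sum>c\<in>C. \<Sum>x\<in>C. t (c \<otimes> (conjg x c))) = of_nat (card C) * (\<Sum>c\<in>C. t c)"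
    by (rule C.sum_square_twist[OF odd])
  also have "(\<Sum>c\<in>C. t c) = - (of_nat p * a2)"
    using a2(2) 0 by (simp add: t_def sum_distrib_left[symmetric] eq_neg_iff_add_eq_0)
  finally have cC: "of_nat (card M) * (\<Sum>c\<in>C. t c * t (inv c))
      = of_nat p * (of_nat d * sum b C - of_nat d * (of_nat (card C) * a2))"
    by (simp add: algebra_simps)
  have "(\<Sum>m\<in>M. t m * t (inv m)) = of_nat d * (of_nat d * pairing \<eta> \<eta>)"
    by (simp add: pairing_def t_def sum_distrib_left mult_ac)
  then have "of_nat (card M) * (of_nat d * (of_nat d * pairing \<eta> \<eta>))
      = of_nat (card M) * (\<Sum>c\<in>C. t c * t (inv c)) + of_nat (card M) * (of_nat p * a1)"
    using a1(2) unfolding distrib_left[symmetric] by simp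
  then have eq: "of_nat (card M) * (of_nat d * (of_nat d * pairing \<eta> \<eta>))
      = of_nat p * (of_nat d * sum b C - of_nat d * (of_nat (card C) * a2) + of_nat (card M) * a1)"
    (is "_ = of_nat p * ?a") unfolding cC by (simp add: algebra_simps)
  have aI: "?a \<in> ?I"
    by (intro integral_at_add integral_at_diff integral_at_mult integral_at_of_nat integral_at_sum a1(1) a2(1) b(1))
  obtain q where q: "of_nat q * pairing \<eta> \<eta> = of_nat (card M)"
    using spherical_pairing_self_dvd[OF s] by blast
  \<comment> \<open>Multiplying by \<open>q\<close>, which is |M| divided by the pairing, replaces
    the pairing by the integer |M|, so the congruence becomes one between integers.\<close>
  have "of_nat (card M * card M * (d * d)) = of_nat q * (of_nat (card M) * (of_nat d * (of_nat d * pairing \<eta> \<eta>)))"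
    by (simp add: q[symmetric] mult_ac)
  also have "\<dots> = of_nat p * (of_nat q * ?a)" unfolding eq by (simp only: mult_ac)
  finally have "p dvd card M * card M * (d * d)"
    by (rule prime_dvd_of_nat_integral_at[OF z prime_gt_0_nat[OF p(1)]])
      (intro integral_at_mult integral_at_of_nat aI)
  then show False using p by (simp add: prime_dvd_mult_iff)
qed

section \<open>Irreducible representations and normal subgroups\<close>

text \<open>Irreducibility is phrased through idempotents commuting with the group instead of
  invariant subspaces, because it is applied to a sum of isotypic projections.\<close>

locale fmat_rep = group G for G (structure) +
  fixes n :: nat and \<rho> :: "'a \<Rightarrow> fmat"
  assumes finG: "finite (carrier G)"
    and rho_mult: "x \<in> carrier G \<Longrightarrow> y \<in> carrier G \<Longrightarrow> \<rho> (x \<otimes> y) = \<rho> x * \<rho> y"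
    and rho_one: "\<rho> \<one> = idm n"
    and rho_supp: "x \<in> carrier G \<Longrightarrow> supp_le n (\<rho> x)"
    and n_pos: "n > 0"
    and irr: "supp_le n I \<Longrightarrow> I * I = I \<Longrightarrow> I \<noteq> 0 \<Longrightarrow> (\<And>g. g \<in> carrier G \<Longrightarrow> \<rho> g * I = I * \<rho> g) \<Longrightarrow> I = idm n"
begin

lemma rho_idm: "x \<in> carrier G \<Longrightarrow> idm n * \<rho> x = \<rho> x" "x \<in> carrier G \<Longrightarrow> \<rho> x * idm n = \<rho> x"
  using idm_mult[OF rho_supp] by auto

lemma rho_inv: "x \<in> carrier G \<Longrightarrow> \<rho> x * \<rho> (inv x) = idm n" "x \<in> carrier G \<Longrightarrow> \<rho> (inv x) * \<rho> x = idm n"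
  by (simp_all add: rho_one flip: rho_mult)

lemma root_of_unity_power_sum:
  assumes u: "u ^ N = 1" "N > 0"
  shows "(\<Sum>i<N. u ^ i) = (if u = 1 then of_nat N else (0::complex))"
  using u by (simp add: sum_gp_strict)

text \<open>The eigenprojections of \<open>\<rho> g\<close> cut an idempotent commuting with \<open>\<rho> g\<close> into idempotents,
  whose traces are the multiplicities of the eigenvalues \<open>z ^ i\<close>.\<close>

lemma tr_power_ipoly:
  assumes z: "z = cis (2 * pi / real N)" and N: "N > 0" and g: "g \<in> carrier G" "g [^] N = \<one>"
    and E: "E * E = E" "supp_le n E" "\<rho> g * E = E * \<rho> g"
  shows "\<exists>F. \<forall>s::nat. tr (\<rho> (g [^] s) * E) = ipoly F (z ^ s)"
proof -
  have zN: "z ^ N = 1" using N by (simp add: z DeMoivre)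
  have z0: "z \<noteq> 0" by (simp add: z)
  define w where "w = inverse z"
  have wN: "w ^ N = 1" using zN by (simp add: w_def power_inverse)
  have zw: "z * w = 1" using z0 by (simp add: w_def)
  have inj: "z ^ s = z ^ j \<Longrightarrow> s = j" if "s < N" "j < N" for s j
  proof -
    have "inj_on (\<lambda>k. cis (2 * pi * real k / real N)) {..<N}"
      using bij_betw_roots_unity[OF N] by (rule bij_betw_imp_inj_on)
    moreover have "z ^ k = cis (2 * pi * real k / real N)" for k
      by (simp add: z DeMoivre mult_ac)
    ultimately show "z ^ s = z ^ j \<Longrightarrow> s = j" using that by (auto dest: inj_onD)
  qed
  \<comment> \<open>The projection onto the eigenspace of \<open>\<rho> g\<close> for
    \<open>z ^ i\<close>; \<open>decomp\<close> is Fourier inversion on the cyclic group of order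
    \<open>N\<close>.\<close>
  define F where "F i = scl (1 / of_nat N) (\<Sum>j<N. scl (w ^ (i * j)) (\<rho> (g [^] j)))" for i
  have decomp: "\<rho> (g [^] s) = (\<Sum>i<N. scl (z ^ (s * i)) (F i))" for s
  proof -
    have aux: "(\<Sum>i<N. z ^ (s * i) * w ^ (i * j)) = (if j = s mod N then of_nat N else 0)" if j: "j < N" for j
    proof -
      have "(\<Sum>i<N. z ^ (s * i) * w ^ (i * j)) = (\<Sum>i<N. (z ^ s * w ^ j) ^ i)"
        by (intro sum.cong refl) (simp add: power_mult_distrib mult.commute[of _ j] flip: power_mult)
      also have "\<dots> = (if z ^ s * w ^ j = 1 then of_nat N else 0)"
        by (rule root_of_unity_power_sum[OF _ N])
          (simp add: power_mult_distrib zN wN mult.commute[of _ N] power_mult flip: power_mult[of z s N] power_mult[of w j N])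
      also have "(z ^ s * w ^ j = 1) = (z ^ s = z ^ j)"
        using z0 by (simp add: w_def power_inverse field_simps)
      also have "\<dots> = (j = s mod N)" using inj[of "s mod N" j] j N by (auto simp: root_power_mod[OF zN])
      finally show ?thesis .
    qed
    have "(\<Sum>i<N. scl (z ^ (s * i)) (F i))
        = (\<Sum>i<N. \<Sum>j<N. scl (1 / of_nat N * (z ^ (s * i) * w ^ (i * j))) (\<rho> (g [^] j)))"
      by (simp add: F_def fmat.scale_sum_right mult_ac)
    also have "\<dots> = (\<Sum>j<N. scl (1 / of_nat N * (\<Sum>i<N. z ^ (s * i) * w ^ (i * j))) (\<rho> (g [^] j)))"
      by (subst sum.swap) (simp only: fmat.scale_sum_left sum_distrib_left)
    also have "\<dots> = (\<Sum>j<N. if j = s mod N then \<rho> (g [^] j) else 0)"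
      using N by (intro sum.cong refl) (auto simp: aux)
    also have "\<dots> = \<rho> (g [^] s)" using N by (simp add: pow_mod_period[OF g])
    finally show ?thesis by simp
  qed
  have gF: "\<rho> g * F i = scl (z ^ i) (F i)" for i
  proof -
    have "(\<Sum>j<N. scl (w ^ (i * j)) (\<rho> (g [^] Suc j))) = scl (z ^ i) (\<Sum>j<N. scl (w ^ (i * j)) (\<rho> (g [^] j)))"
    proof -
      define h where "h j = scl (w ^ (i * j)) (\<rho> (g [^] j))" for j
      \<comment> \<open>The summand has period \<open>N\<close>, so shifting \<open>j\<close> by one
        leaves the sum over a period unchanged.\<close>
      have "h N = h 0" using g by (simp add: h_def mult.commute[of i] power_mult wN)
      then have hs: "(\<Sum>j<N. h (Suc j)) = (\<Sum>j<N. h j)"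
        using sum.lessThan_Suc_shift[of h N] by (simp add: add.commute)
      have "scl (z ^ i) (h (Suc j)) = scl (w ^ (i * j)) (\<rho> (g [^] Suc j))" for j
      proof -
        have "z ^ i * w ^ (i * Suc j) = (z * w) ^ i * w ^ (i * j)"
          by (simp add: power_add power_mult_distrib)
        then show ?thesis by (simp add: h_def zw)
      qed
      then have "(\<Sum>j<N. scl (w ^ (i * j)) (\<rho> (g [^] Suc j))) = scl (z ^ i) (\<Sum>j<N. h j)"
        by (simp only: fmat.scale_sum_right flip: hs)
      then show ?thesis by (simp only: h_def)
    qed
    moreover have "\<rho> g * \<rho> (g [^] j) = \<rho> (g [^] Suc j)" for j
      unfolding nat_pow_Suc2[OF g(1)] using g by (simp add: rho_mult)
    ultimately show ?thesis
      by (simp add: F_def scl_mult_right sum_distrib_left mult.commute del: nat_pow_Suc)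
  qed
  have gjF: "\<rho> (g [^] j) * F i = scl (z ^ (i * j)) (F i)" for i j
  proof (induction j)
    case 0
    have "supp_le n (F i)"
      unfolding F_def using g by (intro supp_le_scl supp_le_sum rho_supp) simp
    then show ?case by (simp add: rho_one idm_mult)
  next
    case (Suc j)
    have "\<rho> (g [^] Suc j) * F i = \<rho> (g [^] j) * (\<rho> g * F i)"
      using g by (simp add: rho_mult mult.assoc)
    then show ?case using Suc by (simp add: gF scl_mult_right power_add mult.commute)
  qed
  have FF: "F i * F i = F i" for i
  proof -
    have "F i * F i = scl (1 / of_nat N) (\<Sum>j<N. scl (w ^ (i * j) * z ^ (i * j)) (F i))"
      by (subst (1) F_def) (simp add: scl_mult_left sum_distrib_right gjF)
    also have "\<dots> = scl (1 / of_nat N) (\<Sum>j<N. F i)"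
    proof -
      have "w ^ k * z ^ k = 1" for k using zw by (simp add: mult.commute flip: power_mult_distrib)
      then show ?thesis by simp
    qed
    also have "(\<Sum>j<N. F i) = scl (of_nat N) (F i)"
      using fmat.scale_sum_left[of "\<lambda>_. 1" "{..<N}" "F i"] by simp
    finally show ?thesis using N by simp
  qed
  have powE: "\<rho> (g [^] j) * E = E * \<rho> (g [^] j)" for j :: nat
  proof (induction j)
    case 0
    then show ?case by (simp add: rho_one idm_mult[OF E(2)])
  next
    case (Suc j)
    then show ?case using g by (simp add: rho_mult mult.assoc E(3)) (simp add: mult.assoc[symmetric])
  qed
  have FE: "F i * E = E * F i" for i
    by (simp add: F_def scl_mult_left scl_mult_right sum_distrib_left sum_distrib_right powE)
  have "\<exists>k. tr (F i * E) = of_nat k" for i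
  proof (rule idempotent_tr_nat)
    have "F i * E * (F i * E) = F i * (E * F i) * E" by (simp add: mult.assoc)
    also have "\<dots> = (F i * F i) * (E * E)" by (simp add: mult.assoc flip: FE)
    finally show "F i * E * (F i * E) = F i * E" by (simp add: FF E(1))
  qed
  then obtain a where a: "\<And>i. tr (F i * E) = of_nat (a i)" by metis
  \<comment> \<open>The coefficients are eigenvalue multiplicities. They belong to \<open>g\<close>
    and \<open>E\<close> alone, so one polynomial describes the traces of all powers of
    \<open>g\<close>.\<close>
  define Q where "Q = (\<Sum>i<N. of_nat (a i) * monom 1 i :: int poly)"
  have "tr (\<rho> (g [^] s) * E) = ipoly Q (z ^ s)" for s
  proof -
    have "tr (\<rho> (g [^] s) * E) = (\<Sum>i<N. z ^ (s * i) * of_nat (a i))"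
      by (simp add: decomp sum_distrib_right scl_mult_left tr_sum tr_scl a)
    also have "\<dots> = (\<Sum>i<N. ipoly (of_nat (a i) * monom 1 i) (z ^ s))"
      unfolding ipoly_mult ipoly_of_nat ipoly_monom by (simp add: mult.commute flip: power_mult)
    also have "\<dots> = ipoly Q (z ^ s)"
    proof -
      have "(\<Sum>i<N'. ipoly (of_nat (a i) * monom 1 i) (z ^ s)) = ipoly (\<Sum>i<N'. of_nat (a i) * monom 1 i) (z ^ s)" for N'
      proof (induction N')
        case (Suc N')
        then show ?case unfolding sum.lessThan_Suc ipoly_add by simp
      qed simp
      then show ?thesis by (simp add: Q_def)
    qed
    finally show ?thesis .
  qed
  then show ?thesis by blast
qed

end

section \<open>Isotypic projections for a normal subgroup\<close>

locale fmat_rep_normal = fmat_rep G n \<rho> for G (structure) and n \<rho> + fixes M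
  assumes normalM: "M \<lhd> G"
begin

sublocale finite_subgroup G M
proof (intro finite_subgroup.intro finite_subgroup_axioms.intro is_group)
  show "subgroup M G" using normalM by (simp add: normal_def)
  then show "finite M" using finite_subset[OF subgroup.subset finG] by blast
qed

lemma conjM: "g \<in> carrier G \<Longrightarrow> m \<in> M \<Longrightarrow> conjg g m \<in> M"
  using normalM by (simp add: normal_inv_iff)

lemma conjM': "g \<in> carrier G \<Longrightarrow> m \<in> M \<Longrightarrow> inv g \<otimes> m \<otimes> g \<in> M"
  using conjM[of "inv g" m] by simp

lemma sum_conjG: "g \<in> carrier G \<Longrightarrow> (\<Sum>x\<in>M. f (conjg g x)) = sum f M"
  by (rule sum_conj) (auto simp: conjM conjM')

text \<open>The value 0 outside \<open>M\<close> matches \<open>spherical\<close>, so members of an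
  orbit can be compared as functions on the whole type.\<close>

definition cact :: "'a \<Rightarrow> ('a \<Rightarrow> complex) \<Rightarrow> 'a \<Rightarrow> complex" where
  "cact g \<eta> = (\<lambda>m. if m \<in> M then \<eta> (inv g \<otimes> m \<otimes> g) else 0)"

lemma cact_in: "m \<in> M \<Longrightarrow> cact g \<eta> m = \<eta> (inv g \<otimes> m \<otimes> g)"
  by (simp add: cact_def)

lemma cact_one: "spherical \<eta> \<Longrightarrow> cact \<one> \<eta> = \<eta>"
  by (auto simp: cact_def spherical_def)

lemma cact_mult: "g \<in> carrier G \<Longrightarrow> h \<in> carrier G \<Longrightarrow> cact (g \<otimes> h) \<eta> = cact g (cact h \<eta>)"
proof
  fix m assume g: "g \<in> carrier G" "h \<in> carrier G"
  show "cact (g \<otimes> h) \<eta> m = cact g (cact h \<eta>) m"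
  proof (cases "m \<in> M")
    case True
    then show ?thesis using g conjM'[OF g(1) True] by (simp add: cact_in inv_mult_group m_assoc)
  qed (simp add: cact_def)
qed

lemma cact_spherical:
  assumes s: "spherical \<eta>" and g: "g \<in> carrier G"
  shows "spherical (cact g \<eta>)"
  unfolding spherical_def
proof (intro conjI ballI allI impI)
  show "cact g \<eta> \<one> = 1" using g spherical_one[OF s] by (simp add: cact_def)
  fix c d assume c: "c \<in> M" and d: "d \<in> M"
  have "(\<Sum>x\<in>M. cact g \<eta> (c \<otimes> (conjg x d)))
      = (\<Sum>x\<in>M. cact g \<eta> (c \<otimes> ((conjg g x) \<otimes> d \<otimes> inv (conjg g x))))"
    by (rule sum_conjG[OF g, symmetric])
  also have "\<dots> = (\<Sum>x\<in>M. \<eta> ((inv g \<otimes> c \<otimes> g) \<otimes> (conjg x (inv g \<otimes> d \<otimes> g))))"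
  proof (rule sum.cong[OF refl])
    fix x assume x: "x \<in> M"
    let ?u = "c \<otimes> ((conjg g x) \<otimes> d \<otimes> inv (conjg g x))"
    have "?u \<in> M" using c d conjM[OF g x] by auto
    moreover have "inv g \<otimes> ?u \<otimes> g = (inv g \<otimes> c \<otimes> g) \<otimes> (conjg x (inv g \<otimes> d \<otimes> g))"
    proof -
      have "inv g \<otimes> ?u \<otimes> g = inv g \<otimes> c \<otimes> g \<otimes> x \<otimes> inv g \<otimes> d \<otimes> g \<otimes> inv x \<otimes> (inv g \<otimes> g)"
        using c d x g by (simp add: inv_mult_group m_assoc)
      then show ?thesis using c d x g by (simp add: m_assoc)
    qed
    ultimately show "cact g \<eta> ?u = \<eta> ((inv g \<otimes> c \<otimes> g) \<otimes> (conjg x (inv g \<otimes> d \<otimes> g)))"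
      by (simp add: cact_in)
  qed
  also have "\<dots> = of_nat (card M) * (cact g \<eta> c * cact g \<eta> d)"
    using c d conjM'[OF g] by (simp add: cact_in spherical_eq[OF s])
  finally show "of_nat (card M) * (cact g \<eta> c * cact g \<eta> d) = (\<Sum>x\<in>M. cact g \<eta> (c \<otimes> (conjg x d)))"
    by simp
qed (simp add: cact_def)

lemma cact_self: "spherical \<eta> \<Longrightarrow> x \<in> M \<Longrightarrow> cact x \<eta> = \<eta>"
  using spherical_conj[of \<eta> "inv x"] by (auto simp: cact_def spherical_def)

definition isum :: "('a \<Rightarrow> complex) \<Rightarrow> fmat" where
  "isum \<eta> = (\<Sum>m\<in>M. scl (\<eta> (inv m)) (\<rho> m))"

text \<open>For \<eta> = \<theta> / \<theta>(1) this is the usual central idempotent, \<theta>(1) /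
  |M| times the sum of \<theta>(m^-1) \<rho>(m).\<close>

definition proj :: "('a \<Rightarrow> complex) \<Rightarrow> fmat" where
  "proj \<eta> = scl (1 / pairing \<eta> \<eta>) (isum \<eta>)"

lemma supp_proj: "supp_le n (proj \<eta>)"
  unfolding proj_def isum_def by (intro supp_le_scl supp_le_sum rho_supp) auto

text \<open>Collecting the terms with the same product turns this into
  \<open>spherical_convolution\<close>.\<close>

lemma isum_mult:
  assumes s: "spherical \<eta>" and s': "spherical \<theta>"
  shows "isum \<eta> * isum \<theta> = scl (pairing \<eta> \<theta>) (isum \<theta>)"
proof -
  have "isum \<eta> * isum \<theta> = (\<Sum>m\<in>M. \<Sum>k\<in>M. scl (\<eta> (inv m) * \<theta> (inv k)) (\<rho> (m \<otimes> k)))"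
    unfolding isum_def sum_product
    by (intro sum.cong refl) (simp add: scl_mult_left scl_mult_right rho_mult mult.commute)
  also have "\<dots> = (\<Sum>m\<in>M. \<Sum>h\<in>M. scl (\<eta> (inv m) * \<theta> (inv h \<otimes> m)) (\<rho> h))"
  proof (rule sum.cong[OF refl])
    fix m assume m: "m \<in> M"
    have "(\<Sum>h\<in>M. scl (\<eta> (inv m) * \<theta> (inv h \<otimes> m)) (\<rho> h))
        = (\<Sum>k\<in>M. scl (\<eta> (inv m) * \<theta> (inv (m \<otimes> k) \<otimes> m)) (\<rho> (m \<otimes> k)))"
      by (rule sum_left_mult[OF m, symmetric])
    also have "\<dots> = (\<Sum>k\<in>M. scl (\<eta> (inv m) * \<theta> (inv k)) (\<rho> (m \<otimes> k)))"
      using m by (intro sum.cong refl) (simp add: inv_mult_group m_assoc)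
    finally show "(\<Sum>k\<in>M. scl (\<eta> (inv m) * \<theta> (inv k)) (\<rho> (m \<otimes> k)))
        = (\<Sum>h\<in>M. scl (\<eta> (inv m) * \<theta> (inv h \<otimes> m)) (\<rho> h))" by simp
  qed
  also have "\<dots> = (\<Sum>h\<in>M. scl (\<Sum>m\<in>M. \<eta> (inv m) * \<theta> (inv h \<otimes> m)) (\<rho> h))"
    by (subst sum.swap) (simp add: fmat.scale_sum_left)
  also have "\<dots> = (\<Sum>h\<in>M. scl (pairing \<eta> \<theta> * \<theta> (inv h)) (\<rho> h))"
  proof (rule sum.cong[OF refl])
    fix h assume h: "h \<in> M"
    have "(\<Sum>m\<in>M. \<eta> (inv m) * \<theta> (inv h \<otimes> m)) = (\<Sum>m\<in>M. \<eta> m * \<theta> (inv h \<otimes> inv m))"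
      by (subst sum_inv[symmetric]) (auto intro!: sum.cong)
    also have "\<dots> = pairing \<eta> \<theta> * \<theta> (inv h)"
      using h by (intro spherical_convolution[OF s s']) auto
    finally show "scl (\<Sum>m\<in>M. \<eta> (inv m) * \<theta> (inv h \<otimes> m)) (\<rho> h) = scl (pairing \<eta> \<theta> * \<theta> (inv h)) (\<rho> h)"
      by simp
  qed
  also have "\<dots> = scl (pairing \<eta> \<theta>) (isum \<theta>)"
    by (simp add: isum_def fmat.scale_sum_right)
  finally show ?thesis .
qed

lemma proj_mult:
  assumes s: "spherical \<eta>" and s': "spherical \<theta>"
  shows "proj \<eta> * proj \<theta> = (if \<eta> = \<theta> then proj \<eta> else 0)"
proof (cases "\<eta> = \<theta>")
  case True
  then show ?thesis
    using isum_mult[OF s s] spherical_pairing_self[OF s] by (simp add: proj_def scl_mult_left scl_mult_right)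
next
  case False
  then show ?thesis
    using isum_mult[OF s s'] spherical_orthogonal[OF s s'] by (auto simp: proj_def scl_mult_left scl_mult_right)
qed

lemma pairing_cact: "g \<in> carrier G \<Longrightarrow> pairing (cact g \<eta>) (cact g \<eta>) = pairing \<eta> \<eta>"
proof -
  assume g: "g \<in> carrier G"
  have "pairing (cact g \<eta>) (cact g \<eta>)
      = (\<Sum>m\<in>M. cact g \<eta> (conjg g m) * cact g \<eta> (inv (conjg g m)))"
    unfolding pairing_def by (rule sum_conjG[OF g, symmetric])
  also have "\<dots> = (\<Sum>m\<in>M. \<eta> m * \<eta> (inv m))"
  proof (rule sum.cong[OF refl])
    fix m assume m: "m \<in> M"
    have "inv (conjg g m) = conjg g (inv m)" using m g by (simp add: inv_mult_group m_assoc)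
    then show "cact g \<eta> (conjg g m) * cact g \<eta> (inv (conjg g m)) = \<eta> m * \<eta> (inv m)"
      using m g conjM[OF g] by (simp add: cact_in conj_cancel)
  qed
  finally show ?thesis by (simp add: pairing_def)
qed

lemma rho_proj_cact:
  assumes g: "g \<in> carrier G"
  shows "\<rho> g * proj \<eta> = proj (cact g \<eta>) * \<rho> g"
proof -
  have "isum (cact g \<eta>) * \<rho> g = (\<Sum>m\<in>M. scl (cact g \<eta> (inv (conjg g m))) (\<rho> (conjg g m))) * \<rho> g"
    unfolding isum_def by (subst sum_conjG[OF g]) simp
  also have "\<dots> = (\<Sum>m\<in>M. scl (\<eta> (inv m)) (\<rho> g * \<rho> m))"
    unfolding sum_distrib_right
  proof (rule sum.cong[OF refl])
    fix m assume m: "m \<in> M"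
    have "inv (conjg g m) = conjg g (inv m)" using m g by (simp add: inv_mult_group m_assoc)
    moreover have "\<rho> (conjg g m) * \<rho> g = \<rho> g * \<rho> m"
      using m g by (simp add: m_assoc flip: rho_mult)
    ultimately show "scl (cact g \<eta> (inv (conjg g m))) (\<rho> (conjg g m)) * \<rho> g = scl (\<eta> (inv m)) (\<rho> g * \<rho> m)"
      using m g conjM[OF g] by (simp add: cact_in conj_cancel scl_mult_left)
  qed
  also have "\<dots> = \<rho> g * isum \<eta>"
    by (simp add: isum_def sum_distrib_left scl_mult_right)
  finally show ?thesis by (simp add: proj_def scl_mult_left scl_mult_right pairing_cact[OF g])
qed

lemma tr_proj_cact:
  assumes g: "g \<in> carrier G"
  shows "tr (proj (cact g \<eta>)) = tr (proj \<eta>)"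
proof -
  have "tr (proj (cact g \<eta>)) = tr (proj (cact g \<eta>) * (\<rho> g * \<rho> (inv g)))"
    using g by (simp add: rho_inv idm_mult[OF supp_proj])
  also have "\<dots> = tr (\<rho> g * proj \<eta> * \<rho> (inv g))" by (simp add: rho_proj_cact[OF g] mult.assoc)
  also have "\<dots> = tr (\<rho> (inv g) * \<rho> g * proj \<eta>)" by (metis mult.assoc tr_commute)
  also have "\<dots> = tr (proj \<eta>)" using g by (simp add: rho_inv idm_mult[OF supp_proj])
  finally show ?thesis .
qed

lemma tr_rho_conj:
  assumes "g \<in> carrier G" "h \<in> carrier G"
  shows "tr (\<rho> (conjg g h)) = tr (\<rho> h)"
proof -
  have "tr (\<rho> (conjg g h)) = tr (\<rho> g * (\<rho> h * \<rho> (inv g)))" using assms by (simp add: rho_mult m_assoc)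
  also have "\<dots> = tr (\<rho> h * (\<rho> (inv g) * \<rho> g))" by (metis mult.assoc tr_commute)
  finally show ?thesis using assms by (simp add: rho_inv rho_idm)
qed

text \<open>The trace is a class function, so the sum may be averaged over conjugates by
  \<open>M\<close>, and the functional equation factors out \<open>\<eta> m\<close>. Consequently
  \<eta> times \<open>tr (proj \<eta>)\<close> is a genuine character of \<open>M\<close>, which is
  why its values are integral.\<close>

lemma tr_rho_proj:
  assumes s: "spherical \<eta>" and m: "m \<in> M"
  shows "tr (\<rho> m * proj \<eta>) = \<eta> m * tr (proj \<eta>)"
proof -
  have "\<rho> m * isum \<eta> = (\<Sum>k\<in>M. scl (\<eta> (inv k)) (\<rho> (m \<otimes> k)))"
    using m by (simp add: isum_def sum_distrib_left scl_mult_right rho_mult)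
  also have "\<dots> = (\<Sum>k\<in>M. scl (\<eta> (inv (m \<otimes> k) \<otimes> m)) (\<rho> (m \<otimes> k)))"
    using m by (intro sum.cong refl) (simp add: inv_mult_group m_assoc)
  also have "\<dots> = (\<Sum>h\<in>M. scl (\<eta> (inv h \<otimes> m)) (\<rho> h))" by (rule sum_left_mult[OF m])
  finally have 1: "tr (\<rho> m * isum \<eta>) = (\<Sum>h\<in>M. \<eta> (inv h \<otimes> m) * tr (\<rho> h))"
    by (simp add: tr_sum tr_scl)
  have "of_nat (card M) * tr (\<rho> m * isum \<eta>) = (\<Sum>x\<in>M. \<Sum>h\<in>M. \<eta> (inv h \<otimes> m) * tr (\<rho> h))"
    by (simp add: 1)
  also have "\<dots> = (\<Sum>x\<in>M. \<Sum>h\<in>M. \<eta> (inv (conjg x h) \<otimes> m) * tr (\<rho> (conjg x h)))"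
    by (rule sum.cong[OF refl], rule sum_conjG[symmetric]) auto
  also have "\<dots> = (\<Sum>x\<in>M. \<Sum>h\<in>M. \<eta> (m \<otimes> (conjg x (inv h))) * tr (\<rho> h))"
  proof (rule sum.cong[OF refl], rule sum.cong[OF refl])
    fix x h assume x: "x \<in> M" and h: "h \<in> M"
    have "inv (conjg x h) = conjg x (inv h)" using x h by (simp add: inv_mult_group m_assoc)
    then show "\<eta> (inv (conjg x h) \<otimes> m) * tr (\<rho> (conjg x h)) = \<eta> (m \<otimes> (conjg x (inv h))) * tr (\<rho> h)"
      using x h m spherical_mult_commute[OF s, of "conjg x (inv h)" m] by (simp add: tr_rho_conj)
  qed
  also have "\<dots> = (\<Sum>h\<in>M. (\<Sum>x\<in>M. \<eta> (m \<otimes> (conjg x (inv h)))) * tr (\<rho> h))"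
    by (subst sum.swap) (simp add: sum_distrib_right)
  also have "\<dots> = (\<Sum>h\<in>M. of_nat (card M) * (\<eta> m * \<eta> (inv h)) * tr (\<rho> h))"
    using m by (intro sum.cong refl) (simp add: spherical_eq[OF s])
  also have "\<dots> = of_nat (card M) * (\<eta> m * tr (isum \<eta>))"
    by (simp add: isum_def tr_sum tr_scl sum_distrib_left mult_ac)
  finally have "tr (\<rho> m * isum \<eta>) = \<eta> m * tr (isum \<eta>)" using card_pos by simp
  then show ?thesis by (simp add: proj_def scl_mult_right tr_scl)
qed

text \<open>The class averages \<open>T m\<close> commute with each other and multiply according to
  the spherical functional equation. Their eigenvalues on a common eigenvector \<open>E\<close>
  therefore form a spherical \<eta> (a central character). Since \<eta> is a class function,
  \<open>isum \<eta>\<close> is a combination of the \<open>T m\<close>, and it multiplies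
  \<open>E\<close> by the nonzero scalar \<open>pairing \<eta> \<eta>\<close>.\<close>

lemma exists_spherical_proj: "\<exists>\<eta>. spherical \<eta> \<and> proj \<eta> \<noteq> 0"
proof -
  define T where "T m = scl (1 / of_nat (card M)) (\<Sum>x\<in>M. \<rho> (conjg x m))" for m
  have cM: "(of_nat (card M) :: complex) \<noteq> 0" using card_pos by simp
  have T_rho: "\<rho> y * T m = T m * \<rho> y" if y: "y \<in> M" and m: "m \<in> M" for y m
  proof -
    have "(\<Sum>x\<in>M. \<rho> (conjg x m)) * \<rho> y = (\<Sum>x\<in>M. \<rho> ((y \<otimes> x) \<otimes> m \<otimes> inv (y \<otimes> x))) * \<rho> y"
      by (subst sum_left_mult[OF y]) simp
    also have "\<dots> = \<rho> y * (\<Sum>x\<in>M. \<rho> (conjg x m))"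
      unfolding sum_distrib_left sum_distrib_right using y m
      by (intro sum.cong refl) (simp add: inv_mult_group m_assoc flip: rho_mult)
    finally show ?thesis by (simp add: T_def scl_mult_left scl_mult_right)
  qed
  have T_comm: "T c * T d = T d * T c" if c: "c \<in> M" and d: "d \<in> M" for c d
  proof -
    have "\<rho> (conjg x c) * T d = T d * \<rho> (conjg x c)" if "x \<in> M" for x
      using that c d by (intro T_rho) auto
    then show ?thesis
      unfolding T_def[of c] scl_mult_left scl_mult_right sum_distrib_left sum_distrib_right by simp
  qed
  have T_mult: "scl (of_nat (card M)) (T c * T d) = (\<Sum>x\<in>M. T (c \<otimes> (conjg x d)))"
    if c: "c \<in> M" and d: "d \<in> M" for c d
  proof -
    have "T c * T d = scl (1 / of_nat (card M)) (scl (1 / of_nat (card M))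
        (\<Sum>x\<in>M. \<Sum>y\<in>M. \<rho> ((conjg x c) \<otimes> (conjg y d))))"
      unfolding T_def scl_mult_left scl_mult_right sum_product using c d
      by (intro arg_cong[of _ _ "scl _"] sum.cong refl) (simp add: rho_mult)
    also have "(\<Sum>x\<in>M. \<Sum>y\<in>M. \<rho> ((conjg x c) \<otimes> (conjg y d)))
        = (\<Sum>x\<in>M. \<Sum>y\<in>M. \<rho> (conjg x (c \<otimes> (conjg y d))))"
    proof (rule sum.cong[OF refl])
      fix x assume x: "x \<in> M"
      have "(\<Sum>y\<in>M. \<rho> ((conjg x c) \<otimes> (conjg y d)))
          = (\<Sum>y\<in>M. \<rho> ((conjg x c) \<otimes> ((x \<otimes> y) \<otimes> d \<otimes> inv (x \<otimes> y))))"
        by (rule sum_left_mult[OF x, symmetric])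
      also have "\<dots> = (\<Sum>y\<in>M. \<rho> (conjg x (c \<otimes> (conjg y d))))"
      proof (rule sum.cong[OF refl])
        fix y assume y: "y \<in> M"
        have "(conjg x c) \<otimes> ((x \<otimes> y) \<otimes> d \<otimes> inv (x \<otimes> y))
            = x \<otimes> c \<otimes> (inv x \<otimes> x) \<otimes> y \<otimes> d \<otimes> inv (x \<otimes> y)"
          using x y c d by (simp only: m_assoc m_closed inv_closed memG)
        then show "\<rho> ((conjg x c) \<otimes> ((x \<otimes> y) \<otimes> d \<otimes> inv (x \<otimes> y)))
            = \<rho> (conjg x (c \<otimes> (conjg y d)))"
          using x y c d by (simp add: inv_mult_group m_assoc)
      qed
      finally show "(\<Sum>y\<in>M. \<rho> ((conjg x c) \<otimes> (conjg y d)))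
        = (\<Sum>y\<in>M. \<rho> (conjg x (c \<otimes> (conjg y d))))" .
    qed
    also have "\<dots> = (\<Sum>y\<in>M. \<Sum>x\<in>M. \<rho> (conjg x (c \<otimes> (conjg y d))))" by (rule sum.swap)
    finally show ?thesis using cM by (simp add: T_def fmat.scale_sum_right)
  qed
  have idm0: "idm n \<noteq> 0"
  proof
    assume "idm n = 0"
    then have "tr (idm n) = 0" by (simp add: tr_zero)
    then show False using n_pos by (simp add: tr_idm)
  qed
  have suppT: "supp_le n (T m)" if "m \<in> M" for m
    unfolding T_def using that by (intro supp_le_scl supp_le_sum rho_supp) auto
  \<comment> \<open>Requiring \<open>idm n * E = E\<close> is what later yields \<eta>(1) = 1,
    because \<open>T \<one>\<close> is \<open>idm n\<close>.\<close>
  have "\<exists>E c. E \<noteq> 0 \<and> idm n * E = scl 1 E \<and> (\<forall>x\<in>M. T x * E = scl (c x) E)"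
    by (rule common_eigen_matrix[OF fin idm0])
      (simp_all add: T_comm idm_mult[OF suppT] idm_mult[OF supp_le_idm])
  then obtain E c where E: "E \<noteq> 0" "idm n * E = E" "\<And>x. x \<in> M \<Longrightarrow> T x * E = scl (c x) E"
    by auto
  have scl_inj: "a = b" if "scl a E = scl b E" for a b
    using that E(1) fmat.scale_right_imp_eq by blast
  define \<eta> where "\<eta> m = (if m \<in> M then c m else 0)" for m
  have sph: "spherical \<eta>"
    unfolding spherical_def
  proof (intro conjI ballI allI impI)
    have "T \<one> = idm n"
    proof -
      have "(\<Sum>x\<in>M. \<rho> (conjg x \<one>)) = (\<Sum>x\<in>M. scl 1 (idm n))"
        by (intro sum.cong refl) (simp add: rho_one)
      also have "\<dots> = scl (of_nat (card M)) (idm n)"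
        using fmat.scale_sum_left[of "\<lambda>_. 1" M "idm n"] by simp
      finally show ?thesis using cM by (simp add: T_def)
    qed
    then have "scl (c \<one>) E = scl 1 E" using E(3)[OF memM(1)] E(2) by simp
    then have "c \<one> = 1" by (rule scl_inj)
    then show "\<eta> \<one> = 1" by (simp add: \<eta>_def)
  next
    fix a b assume a: "a \<in> M" and b: "b \<in> M"
    have "scl (of_nat (card M) * (c a * c b)) E = scl (of_nat (card M)) (T a * T b) * E"
      using E(3)[OF a] E(3)[OF b] by (simp add: scl_mult_left scl_mult_right mult.assoc mult.commute)
    also have "\<dots> = (\<Sum>x\<in>M. T (a \<otimes> (conjg x b)) * E)"
      using a b by (simp add: T_mult sum_distrib_right)
    also have "\<dots> = scl (\<Sum>x\<in>M. c (a \<otimes> (conjg x b))) E"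
      unfolding fmat.scale_sum_left using a b by (intro sum.cong refl E(3)) auto
    finally have "of_nat (card M) * (c a * c b) = (\<Sum>x\<in>M. c (a \<otimes> (conjg x b)))"
      by (rule scl_inj)
    then show "of_nat (card M) * (\<eta> a * \<eta> b) = (\<Sum>x\<in>M. \<eta> (a \<otimes> (conjg x b)))"
      using a b by (simp add: \<eta>_def)
  qed (simp add: \<eta>_def)
  have "isum \<eta> = (\<Sum>m\<in>M. scl (\<eta> (inv m)) (T m))"
  proof -
    have "scl (of_nat (card M)) (isum \<eta>) = (\<Sum>x\<in>M. scl 1 (isum \<eta>))"
      using fmat.scale_sum_left[of "\<lambda>_. 1" M "isum \<eta>"] by simp
    also have "\<dots> = (\<Sum>x\<in>M. \<Sum>m\<in>M. scl (\<eta> (inv m)) (\<rho> (conjg x m)))"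
    proof (rule sum.cong[OF refl])
      fix x assume x: "x \<in> M"
      have "isum \<eta> = (\<Sum>m\<in>M. scl (\<eta> (inv (conjg x m))) (\<rho> (conjg x m)))"
        unfolding isum_def using x by (intro sum_conjG[symmetric]) auto
      also have "\<dots> = (\<Sum>m\<in>M. scl (\<eta> (inv m)) (\<rho> (conjg x m)))"
      proof (rule sum.cong[OF refl])
        fix m assume m: "m \<in> M"
        have "inv (conjg x m) = conjg x (inv m)" using x m by (simp add: inv_mult_group m_assoc)
        then show "scl (\<eta> (inv (conjg x m))) (\<rho> (conjg x m)) = scl (\<eta> (inv m)) (\<rho> (conjg x m))"
          using spherical_conj[OF sph x, of "inv m"] m by simp
      qed
      finally show "scl 1 (isum \<eta>) = (\<Sum>m\<in>M. scl (\<eta> (inv m)) (\<rho> (conjg x m)))" by simp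
    qed
    also have "\<dots> = (\<Sum>m\<in>M. scl (\<eta> (inv m)) (\<Sum>x\<in>M. \<rho> (conjg x m)))"
      by (subst sum.swap) (simp add: fmat.scale_sum_right)
    also have "\<dots> = scl (of_nat (card M)) (\<Sum>m\<in>M. scl (\<eta> (inv m)) (T m))"
      using cM by (simp add: T_def fmat.scale_sum_right)
    finally show ?thesis using cM fmat.scale_left_imp_eq by blast
  qed
  then have "isum \<eta> * E = (\<Sum>m\<in>M. scl (\<eta> (inv m) * \<eta> m) E)"
    by (simp add: sum_distrib_right scl_mult_left E(3)) (simp add: \<eta>_def)
  also have "\<dots> = scl (pairing \<eta> \<eta>) E"
    unfolding fmat.scale_sum_left[symmetric] pairing_def by (simp add: mult.commute)
  finally have "isum \<eta> * E \<noteq> 0" using E(1) spherical_pairing_self[OF sph] by simp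
  then have "isum \<eta> \<noteq> 0" by auto
  then have "proj \<eta> \<noteq> 0" using spherical_pairing_self[OF sph] by (simp add: proj_def)
  then show ?thesis using sph by blast
qed

end

section \<open>Normalizers and Sylow subgroups\<close>

lemma (in group) normalizer_memI:
  assumes fin: "finite P" and P: "P \<subseteq> carrier G" and x: "x \<in> carrier G"
    and conj: "\<And>y. y \<in> P \<Longrightarrow> conjg x y \<in> P"
  shows "x \<in> normalizer G P"
proof -
  have eq: "x <# P #> inv x = (\<lambda>y. conjg x y) ` P"
    by (auto simp: l_coset_def r_coset_def)
  have "inj_on (\<lambda>y. conjg x y) P"
    using P x by (intro inj_onI) (auto simp: subset_iff)
  then have "(\<lambda>y. conjg x y) ` P = P"
    using conj fin by (intro card_subset_eq) (auto simp: card_image)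
  then show ?thesis using P x eq by (simp add: normalizer_def stabilizer_def)
qed

lemma (in group) normalizer_memD:
  assumes "x \<in> normalizer G P" "P \<subseteq> carrier G" "y \<in> P"
  shows "x \<in> carrier G" "conjg x y \<in> P"
proof -
  show x: "x \<in> carrier G" using assms(1) by (simp add: normalizer_def stabilizer_def)
  have "x <# P #> inv x = P" using assms(1,2) by (simp add: normalizer_def stabilizer_def)
  moreover have "conjg x y \<in> x <# P #> inv x" using assms(3) by (auto simp: l_coset_def r_coset_def)
  ultimately show "conjg x y \<in> P" by simp
qed

lemma (in group) sylow_cofactor:
  assumes "sylow_subgroup G p P" "finite (carrier G)" "Factorial_Ring.prime p"
    and S: "subgroup S G" "P \<subseteq> S"
  shows "\<exists>j. card S = card P * j \<and> \<not> p dvd j"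
proof -
  have P: "subgroup P G" "card P = p ^ multiplicity p (Coset.order G)"
    using assms(1) by (auto simp: sylow_subgroup_def)
  have ord: "Coset.order G \<noteq> 0" using assms(2) order_gt_0_iff_finite by simp
  have "card P dvd card S" by (rule card_subgroup_dvd[OF P(1) S])
  then obtain j where j: "card S = card P * j" by (elim dvdE)
  moreover have "\<not> p dvd j"
  proof
    assume "p dvd j"
    then have "p ^ Suc (multiplicity p (Coset.order G)) dvd card S"
      unfolding j P(2) by (simp add: mult.commute mult_dvd_mono)
    also have "card S dvd Coset.order G" unfolding lagrange[OF S(1), symmetric] by simp
    finally have "Suc (multiplicity p (Coset.order G)) \<le> multiplicity p (Coset.order G)"
      using ord assms(3) by (intro multiplicity_geI) (auto simp: prime_gt_1_nat)
    then show False by simp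
  qed
  ultimately show ?thesis by blast
qed

section \<open>Galois conjugates and the orbit of constituents\<close>

context fmat_rep_normal
begin

text \<open>The Galois conjugate of \<eta>: the automorphism raising roots of unity to the power
  \<open>s\<close> maps the value of a character at m to its value at m^s.\<close>

definition pwr :: "nat \<Rightarrow> ('a \<Rightarrow> complex) \<Rightarrow> 'a \<Rightarrow> complex" where
  "pwr s \<eta> = (\<lambda>m. if m \<in> M then \<eta> (m [^] s) else 0)"

lemma pow_memM: "m \<in> M \<Longrightarrow> m [^] (s::nat) \<in> M"
  by (induction s) auto

lemma conj_pow: "g \<in> carrier G \<Longrightarrow> m \<in> carrier G \<Longrightarrow> inv g \<otimes> (m [^] (s::nat)) \<otimes> g = (inv g \<otimes> m \<otimes> g) [^] s"
proof (induction s)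
  case (Suc s)
  have "(inv g \<otimes> m \<otimes> g) [^] Suc s = (inv g \<otimes> (m [^] s) \<otimes> g) \<otimes> (inv g \<otimes> m \<otimes> g)"
    using Suc by simp
  also have "\<dots> = inv g \<otimes> (m [^] s) \<otimes> (g \<otimes> inv g) \<otimes> m \<otimes> g"
    using Suc.prems by (simp only: m_assoc m_closed inv_closed nat_pow_closed)
  also have "\<dots> = inv g \<otimes> (m [^] s) \<otimes> m \<otimes> g" using Suc.prems by simp
  finally show ?case using Suc.prems by (simp only: nat_pow_Suc m_assoc m_closed inv_closed nat_pow_closed)
qed simp

lemma pwr_cact: "g \<in> carrier G \<Longrightarrow> pwr s (cact g \<eta>) = cact g (pwr s \<eta>)"
proof
  fix m assume g: "g \<in> carrier G"
  show "pwr s (cact g \<eta>) m = cact g (pwr s \<eta>) m"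
    using g conjM'[OF g] pow_memM[of m s] conj_pow[OF g, of m s] by (auto simp: pwr_def cact_def)
qed

lemma pwr_pwr: "pwr s (pwr t \<eta>) = pwr (s * t) \<eta>"
  by (auto simp: pwr_def pow_memM nat_pow_pow)

lemma pow_bij:
  assumes "coprime s (card M)"
  shows "bij_betw (\<lambda>m. m [^] s) M M"
proof -
  obtain t where t: "[s * t = 1] (mod card M)" using cong_solve_coprime_nat[OF assms] by auto
  have st: "x [^] (s * t) = x" if x: "x \<in> M" for x
  proof -
    have mod: "x [^] k = x [^] (k mod card M)" for k :: nat
      using pow_mod_period[OF memG[OF x] pow_card_subgroup[OF sub x]] by simp
    have "x [^] (s * t) = x [^] (1 mod card M)" using mod[of "s * t"] t by (simp add: cong_def)
    also have "\<dots> = x [^] (1::nat)" by (rule mod[symmetric])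
    finally show ?thesis using x by simp
  qed
  show ?thesis
    by (rule bij_betwI[of _ _ _ "\<lambda>m. m [^] t"])
      (use st in \<open>auto simp: pow_memM nat_pow_pow mult.commute\<close>)
qed

text \<open>Clifford's theorem. The orbit sum of projections is a nonzero idempotent commuting with
  the group, hence the identity by irreducibility; conjugate projections have equal traces, and the
  trace of the identity is \<open>n\<close>.\<close>

lemma orbit_decomposition:
  assumes s: "spherical \<eta>" and ne: "proj \<eta> \<noteq> 0"
  defines "\<Omega> \<equiv> (\<lambda>g. cact g \<eta>) ` carrier G"
  shows "(\<Sum>\<theta>\<in>\<Omega>. proj \<theta>) = idm n"
    and "\<exists>d. n = card \<Omega> * d \<and> (\<forall>\<theta>\<in>\<Omega>. tr (proj \<theta>) = of_nat d)"
proof -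
  have fin\<Omega>: "finite \<Omega>" using finG by (simp add: \<Omega>_def)
  have sph: "spherical \<theta>" if "\<theta> \<in> \<Omega>" for \<theta> using that cact_spherical[OF s] by (auto simp: \<Omega>_def)
  have eta: "\<eta> \<in> \<Omega>" unfolding \<Omega>_def using cact_one[OF s] by (metis image_eqI one_closed)
  have closed: "cact g \<theta> \<in> \<Omega>" if "g \<in> carrier G" "\<theta> \<in> \<Omega>" for g \<theta>
    using that by (auto simp: \<Omega>_def simp flip: cact_mult)
  define I where "I = (\<Sum>\<theta>\<in>\<Omega>. proj \<theta>)"
  have PI: "proj \<theta> * I = proj \<theta>" if "\<theta> \<in> \<Omega>" for \<theta>
  proof -
    have "proj \<theta> * I = (\<Sum>\<theta>'\<in>\<Omega>. if \<theta> = \<theta>' then proj \<theta> else 0)"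
      unfolding I_def sum_distrib_left using that sph by (intro sum.cong refl) (simp add: proj_mult)
    then show ?thesis using fin\<Omega> that by simp
  qed
  have "I = idm n"
  proof (rule irr)
    show "supp_le n I" unfolding I_def by (intro supp_le_sum supp_proj)
    have "I * I = (\<Sum>\<theta>\<in>\<Omega>. proj \<theta> * I)" by (simp add: I_def sum_distrib_right)
    also have "\<dots> = I" unfolding I_def using PI[unfolded I_def] by (intro sum.cong) auto
    finally show "I * I = I" .
    show "I \<noteq> 0" using PI[OF eta] ne by auto
    fix g assume g: "g \<in> carrier G"
    have bij: "(\<Sum>\<theta>\<in>\<Omega>. proj (cact g \<theta>)) = (\<Sum>\<theta>\<in>\<Omega>. proj \<theta>)"
    proof (rule sum.reindex_bij_witness[of _ "cact (inv g)" "cact g"])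
      fix \<theta> assume \<theta>: "\<theta> \<in> \<Omega>"
      show "cact (inv g) (cact g \<theta>) = \<theta>" "cact g (cact (inv g) \<theta>) = \<theta>"
        using g cact_one[OF sph[OF \<theta>]] by (simp_all flip: cact_mult)
      show "cact g \<theta> \<in> \<Omega>" "cact (inv g) \<theta> \<in> \<Omega>" using g \<theta> closed by auto
    qed simp
    have "\<rho> g * I = (\<Sum>\<theta>\<in>\<Omega>. proj (cact g \<theta>)) * \<rho> g"
      by (simp add: I_def sum_distrib_left sum_distrib_right rho_proj_cact[OF g])
    then show "\<rho> g * I = I * \<rho> g" by (simp add: bij I_def)
  qed
  then show sumI: "(\<Sum>\<theta>\<in>\<Omega>. proj \<theta>) = idm n" by (simp add: I_def)
  have "proj \<eta> * proj \<eta> = proj \<eta>" using proj_mult[OF s s] by simp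
  then obtain d where d: "tr (proj \<eta>) = of_nat d" using idempotent_tr_nat by blast
  have tr\<theta>: "tr (proj \<theta>) = of_nat d" if "\<theta> \<in> \<Omega>" for \<theta>
    using that d by (auto simp: \<Omega>_def tr_proj_cact)
  have "of_nat n = tr (idm n)" by (simp add: tr_idm)
  also have "\<dots> = (\<Sum>\<theta>\<in>\<Omega>. of_nat d)" unfolding sumI[symmetric] tr_sum by (intro sum.cong refl tr\<theta>)
  also have "\<dots> = of_nat (card \<Omega> * d)" by simp
  finally have "n = card \<Omega> * d" by (simp only: of_nat_eq_iff)
  then show "\<exists>d. n = card \<Omega> * d \<and> (\<forall>\<theta>\<in>\<Omega>. tr (proj \<theta>) = of_nat d)" using tr\<theta> by blast
qed

lemma tr_rho_proj_ipoly:
  assumes s: "spherical \<eta>" and N: "N > 0" "card (carrier G) dvd N" and z: "z = cis (2 * pi / real N)"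
    and m: "m \<in> M"
  shows "\<exists>F. \<forall>s::nat. \<eta> (m [^] s) * tr (proj \<eta>) = ipoly F (z ^ s)"
proof -
  have "\<rho> m * proj \<eta> = proj \<eta> * \<rho> m" using rho_proj_cact[of m \<eta>] m cact_self[OF s m] by simp
  moreover have "proj \<eta> * proj \<eta> = proj \<eta>" using proj_mult[OF s s] by simp
  ultimately obtain F where "\<forall>s::nat. tr (\<rho> (m [^] s) * proj \<eta>) = ipoly F (z ^ s)"
    using tr_power_ipoly[OF z N(1) memG[OF m] dvd_card_pow_one[OF N(2) memG[OF m]] _ supp_proj, of \<eta>] by blast
  then show ?thesis using tr_rho_proj[OF s pow_memM[OF m]] by auto
qed

text \<open>The Galois conjugate of a spherical function is spherical: the defining identity is an
  integral polynomial relation for the root of unity \<open>z\<close>.\<close>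

lemma pwr_spherical:
  assumes s: "spherical \<eta>" and N: "N > 0" "card (carrier G) dvd N"
    and d: "tr (proj \<eta>) = of_nat d" "d > 0" and cop: "coprime s N"
  shows "spherical (pwr s \<eta>)"
proof -
  define z where "z = cis (2 * pi / real N)"
  have zN: "z ^ N = 1" using N by (simp add: z_def DeMoivre)
  have "\<exists>F. \<forall>s::nat. \<eta> (m [^] s) * of_nat d = ipoly F (z ^ s)" if "m \<in> M" for m
    using tr_rho_proj_ipoly[OF s N z_def that] d by simp
  then have "\<forall>m\<in>M. \<exists>F. \<forall>s::nat. \<eta> (m [^] s) * of_nat d = ipoly F (z ^ s)" by blast
  from bchoice[OF this] obtain F
    where F: "\<And>m s. m \<in> M \<Longrightarrow> \<eta> (m [^] (s::nat)) * of_nat d = ipoly (F m) (z ^ s)"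
    by blast
  have F1: "\<eta> m * of_nat d = ipoly (F m) z" if "m \<in> M" for m using F[OF that, of 1] that by simp
  show ?thesis
    unfolding spherical_def
  proof (intro conjI ballI allI impI)
    show "pwr s \<eta> \<one> = 1" by (simp add: pwr_def spherical_one[OF s])
  next
    fix a b assume a: "a \<in> M" and b: "b \<in> M"
    \<comment> \<open>At z^t this polynomial is d^2 times the defect of the functional equation with
      all arguments raised to the power t. For t = 1 it vanishes because \<eta> is spherical; t = s
      is the claim.\<close>
    define K where "K = of_nat (card M) * (F a * F b) - of_nat d * (\<Sum>x\<in>M. F (a \<otimes> (conjg x b)))"
    have ipoly_sum: "ipoly (\<Sum>x\<in>X. f x) y = (\<Sum>x\<in>X. ipoly (f x) y)" for X and f :: "'a \<Rightarrow> int poly" and y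
    proof (induction X rule: infinite_finite_induct)
      case (insert x X)
      show ?case unfolding sum.insert[OF insert.hyps] ipoly_add insert.IH ..
    qed simp_all
    have K: "ipoly K y = of_nat (card M) * (ipoly (F a) y * ipoly (F b) y)
        - of_nat d * (\<Sum>x\<in>M. ipoly (F (a \<otimes> (conjg x b))) y)" for y
      unfolding K_def ipoly_diff ipoly_mult ipoly_of_nat ipoly_sum ..
    have eval: "ipoly K (z ^ t) = of_nat d * of_nat d * (of_nat (card M) * (\<eta> (a [^] t) * \<eta> (b [^] t))
        - (\<Sum>x\<in>M. \<eta> ((a \<otimes> (conjg x b)) [^] t)))" for t
    proof -
      have "(\<Sum>x\<in>M. ipoly (F (a \<otimes> (conjg x b))) (z ^ t)) = (\<Sum>x\<in>M. \<eta> ((a \<otimes> (conjg x b)) [^] t) * of_nat d)"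
        using a b by (intro sum.cong refl F[symmetric]) auto
      then show ?thesis
        unfolding K F[OF a, symmetric] F[OF b, symmetric] sum_distrib_right[symmetric]
        by (simp add: algebra_simps)
    qed
    have "ipoly K z = 0" using eval[of 1] a b spherical_eq[OF s a b] by simp
    then have "ipoly K (z ^ s) = 0" by (rule ipoly_root_coprime_power[OF zN N(1) cop])
    then have "of_nat (card M) * (\<eta> (a [^] s) * \<eta> (b [^] s)) = (\<Sum>x\<in>M. \<eta> ((a \<otimes> (conjg x b)) [^] s))"
      using eval[of s] d(2) by simp
    then show "of_nat (card M) * (pwr s \<eta> a * pwr s \<eta> b) = (\<Sum>x\<in>M. pwr s \<eta> (a \<otimes> (conjg x b)))"
      using a b by (simp add: pwr_def)
  qed (simp add: pwr_def)
qed

end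

context fmat_rep_normal
begin

text \<open>\<open>N\<close> may be a proper multiple of the group order, so that one root of unity
  can serve both the constituents on \<open>M\<close> and the field of values of the
  character.\<close>

lemma acts_trivially:
  assumes p: "Factorial_Ring.prime p" and syl: "sylow_subgroup G p P" and pn: "\<not> p dvd n"
    and cM: "card M = p ^ a \<or> \<not> p dvd card M" and odd: "odd (card (normalizer G P))"
    and N: "N > 0" "card (carrier G) dvd N"
    and s: "coprime s N" "card (normalizer G P) dvd s + 1"
    and chi: "\<And>m. m \<in> M \<Longrightarrow> tr (\<rho> (m [^] s)) = tr (\<rho> m)"
  shows "\<forall>m\<in>M. \<rho> m = idm n"
proof -
  obtain k where P: "subgroup P G" "card P = p ^ k" using syl by (auto simp: sylow_subgroup_def)
  have PG: "P \<subseteq> carrier G" using P(1) by (rule subgroup.subset)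
  have finP: "finite P" using finite_subset[OF PG finG] .
  obtain \<eta>0 where \<eta>0: "spherical \<eta>0" "proj \<eta>0 \<noteq> 0" using exists_spherical_proj by blast
  define \<Omega> where "\<Omega> = (\<lambda>g. cact g \<eta>0) ` carrier G"
  have fin\<Omega>: "finite \<Omega>" using finG by (simp add: \<Omega>_def)
  have sph: "spherical \<theta>" if "\<theta> \<in> \<Omega>" for \<theta> using that cact_spherical[OF \<eta>0(1)] by (auto simp: \<Omega>_def)
  have closed: "cact g \<theta> \<in> \<Omega>" if "g \<in> carrier G" "\<theta> \<in> \<Omega>" for g \<theta>
    using that by (auto simp: \<Omega>_def simp flip: cact_mult)
  have sumI: "(\<Sum>\<theta>\<in>\<Omega>. proj \<theta>) = idm n" using orbit_decomposition(1)[OF \<eta>0] by (simp add: \<Omega>_def)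
  obtain d where d: "n = card \<Omega> * d" "\<And>\<theta>. \<theta> \<in> \<Omega> \<Longrightarrow> tr (proj \<theta>) = of_nat d"
    using orbit_decomposition(2)[OF \<eta>0] unfolding \<Omega>_def by blast
  have p\<Omega>: "\<not> p dvd card \<Omega>" and pd: "\<not> p dvd d" using pn by (auto simp: d(1))
  have d0: "d > 0" using pd by (cases d) auto
  have chi\<Omega>: "tr (\<rho> m) = (\<Sum>\<theta>\<in>\<Omega>. \<theta> m * of_nat d)" if m: "m \<in> M" for m
  proof -
    have "tr (\<rho> m) = tr (\<rho> m * (\<Sum>\<theta>\<in>\<Omega>. proj \<theta>))" using m by (simp add: sumI rho_idm)
    also have "\<dots> = (\<Sum>\<theta>\<in>\<Omega>. \<theta> m * of_nat d)"
      unfolding sum_distrib_left tr_sum using m by (intro sum.cong refl) (simp add: tr_rho_proj sph d(2))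
    finally show ?thesis .
  qed
  \<comment> \<open>The restriction of the character to \<open>M\<close> is \<open>d\<close> times
    the sum over \<Omega>. It is unchanged by m \<mapsto> m^s, a bijection of \<open>M\<close>, so
    it pairs with \<open>pwr s \<eta>\<close> as it does with \<eta>, that is, not to zero.
    Orthogonality then places \<open>pwr s \<eta>\<close> in \<Omega>.\<close>
  have pwr\<Omega>: "pwr s \<eta> \<in> \<Omega>" if \<eta>: "\<eta> \<in> \<Omega>" for \<eta>
  proof -
    have sph': "spherical (pwr s \<eta>)"
      using sph[OF \<eta>] N d(2)[OF \<eta>] d0 s(1) by (rule pwr_spherical)
    have pair: "(\<Sum>m\<in>M. \<theta>' m * tr (\<rho> (inv m))) = of_nat d * (\<Sum>\<theta>\<in>\<Omega>. pairing \<theta>' \<theta>)" for \<theta>'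
    proof -
      have "(\<Sum>m\<in>M. \<theta>' m * tr (\<rho> (inv m))) = (\<Sum>m\<in>M. \<Sum>\<theta>\<in>\<Omega>. of_nat d * (\<theta>' m * \<theta> (inv m)))"
        by (intro sum.cong refl) (simp add: chi\<Omega> sum_distrib_left mult_ac)
      also have "\<dots> = of_nat d * (\<Sum>\<theta>\<in>\<Omega>. pairing \<theta>' \<theta>)"
        by (subst sum.swap) (simp add: pairing_def sum_distrib_left)
      finally show ?thesis .
    qed
    have "card M dvd N" using dvd_trans[OF card_subgroup_dvd[OF sub subgroup_self subgroup.subset[OF sub]] N(2)] .
    then have copM: "coprime s (card M)" using s(1) by (metis coprime_mult_right_iff dvdE)
    have "(\<Sum>m\<in>M. pwr s \<eta> m * tr (\<rho> (inv m))) = (\<Sum>m\<in>M. \<eta> (m [^] s) * tr (\<rho> (inv (m [^] s))))"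
    proof (rule sum.cong[OF refl])
      fix m assume m: "m \<in> M"
      have "tr (\<rho> (inv m)) = tr (\<rho> (inv (m [^] s)))"
        using chi[of "inv m"] m by (simp add: nat_pow_inv)
      then show "pwr s \<eta> m * tr (\<rho> (inv m)) = \<eta> (m [^] s) * tr (\<rho> (inv (m [^] s)))"
        using m by (simp add: pwr_def)
    qed
    also have "\<dots> = (\<Sum>m\<in>M. \<eta> m * tr (\<rho> (inv m)))"
      using sum.reindex_bij_betw[OF pow_bij[OF copM], of "\<lambda>m. \<eta> m * tr (\<rho> (inv m))"] .
    also have "\<dots> = of_nat d * (\<Sum>\<theta>\<in>\<Omega>. pairing \<eta> \<theta>)" by (rule pair)
    also have "(\<Sum>\<theta>\<in>\<Omega>. pairing \<eta> \<theta>) = (\<Sum>\<theta>\<in>\<Omega>. if \<theta> = \<eta> then pairing \<eta> \<eta> else 0)"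
      using spherical_orthogonal[OF sph[OF \<eta>] sph] by (intro sum.cong refl) auto
    also have "\<dots> = pairing \<eta> \<eta>" using fin\<Omega> \<eta> by simp
    finally have "of_nat d * (\<Sum>\<theta>\<in>\<Omega>. pairing (pwr s \<eta>) \<theta>) \<noteq> 0"
      using d0 spherical_pairing_self[OF sph[OF \<eta>]] by (simp add: pair)
    then have "(\<Sum>\<theta>\<in>\<Omega>. pairing (pwr s \<eta>) \<theta>) \<noteq> 0" by simp
    then obtain \<theta> where \<theta>: "\<theta> \<in> \<Omega>" "pairing (pwr s \<eta>) \<theta> \<noteq> 0" by (meson sum.neutral)
    then show ?thesis using spherical_orthogonal[OF sph' sph[OF \<theta>(1)]] by simp
  qed
  have "\<exists>\<eta>\<in>\<Omega>. \<forall>y\<in>P. cact y \<eta> = \<eta>"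
    by (rule p_group_card_fixed_points[OF P p fin\<Omega> _ _ _ p\<Omega>])
      (use PG closed cact_one[OF sph] in \<open>auto simp: cact_mult subset_iff\<close>)
  then obtain \<eta> where \<eta>: "\<eta> \<in> \<Omega>" and fix\<eta>: "\<And>y. y \<in> P \<Longrightarrow> cact y \<eta> = \<eta>" by blast
  note sph\<eta> = sph[OF \<eta>]
  define \<eta>' where "\<eta>' = pwr s \<eta>"
  have \<eta>'\<Omega>: "\<eta>' \<in> \<Omega>" using pwr\<Omega>[OF \<eta>] by (simp add: \<eta>'_def)
  have fix\<eta>': "cact y \<eta>' = \<eta>'" if "y \<in> P" for y
    using that PG by (simp add: \<eta>'_def fix\<eta> subset_iff flip: pwr_cact)
  obtain g1 g2 where g12: "g1 \<in> carrier G" "\<eta> = cact g1 \<eta>0" "g2 \<in> carrier G" "\<eta>' = cact g2 \<eta>0"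
    using \<eta> \<eta>'\<Omega> by (auto simp: \<Omega>_def)
  define g where "g = g2 \<otimes> inv g1"
  have g: "g \<in> carrier G" using g12 by (simp add: g_def)
  have g\<eta>: "cact g \<eta> = \<eta>'"
    using g12 by (simp add: g_def m_assoc flip: cact_mult)
  \<comment> \<open>Both \<open>P\<close> and its conjugate by \<open>g\<close> fix \<eta>', so
    Sylow's theorem in the stabiliser \<open>S\<close> gives \<open>t\<close> bringing that
    conjugate back to \<open>P\<close>. Then x = t g normalises \<open>P\<close> and still maps
    \<eta> to \<eta>'.\<close>
  define S where "S = {h \<in> carrier G. cact h \<eta>' = \<eta>'}"
  have SG: "subgroup S G"
  proof (rule subgroupI)
    show "S \<subseteq> carrier G" by (auto simp: S_def)
    show "S \<noteq> {}" using cact_one[OF sph[OF \<eta>'\<Omega>]] by (auto simp: S_def)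
    fix u assume u: "u \<in> S"
    then have "cact (inv u) (cact u \<eta>') = \<eta>'"
      using cact_one[OF sph[OF \<eta>'\<Omega>]] cact_mult[of "inv u" u \<eta>'] by (simp add: S_def)
    then show "inv u \<in> S" using u by (simp add: S_def)
    fix v assume "v \<in> S"
    then show "u \<otimes> v \<in> S" using u by (simp add: S_def cact_mult)
  qed
  have PS: "P \<subseteq> S" using PG fix\<eta>' by (auto simp: S_def)
  define Q where "Q = (conjg g) ` P"
  have QG: "subgroup Q G" and cQ: "card Q = p ^ k"
    using conj_subgroup[OF P(1) g] P(2) by (simp_all add: Q_def)
  have QS: "Q \<subseteq> S"
  proof
    fix u assume "u \<in> Q"
    then obtain y where y: "y \<in> P" "u = conjg g y" by (auto simp: Q_def)
    have yG: "y \<in> carrier G" using y PG by blast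
    have "cact u \<eta>' = cact u (cact g \<eta>)" by (simp add: g\<eta>)
    also have "\<dots> = cact (g \<otimes> y) \<eta>" using y yG g by (simp add: m_assoc flip: cact_mult)
    also have "\<dots> = \<eta>'" using y yG g by (simp add: cact_mult fix\<eta> g\<eta>)
    finally show "u \<in> S" using y yG g by (simp add: S_def)
  qed
  obtain j where j: "card S = card P * j" "\<not> p dvd j"
    using sylow_cofactor[OF syl finG p SG PS] by blast
  have "finite S" using finG by (simp add: S_def)
  then obtain t where t: "t \<in> S" "\<And>q. q \<in> Q \<Longrightarrow> conjg t q \<in> P"
    using sylow_conjugate_subset[OF _ SG P(1) PS j QG QS cQ p] by blast
  define x where "x = t \<otimes> g"
  have tG: "t \<in> carrier G" using t(1) by (simp add: S_def)
  have xG: "x \<in> carrier G" using tG g by (simp add: x_def)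
  let ?H = "normalizer G P"
  have xH: "x \<in> ?H"
  proof (rule normalizer_memI[OF finP PG xG])
    fix y assume y: "y \<in> P"
    then have "y \<in> carrier G" using PG by blast
    then have "conjg x y = conjg t (conjg g y)"
      using tG g by (simp add: x_def inv_mult_group m_assoc)
    then show "conjg x y \<in> P" using t(2) y by (simp add: Q_def)
  qed
  have x\<eta>: "cact x \<eta> = \<eta>'"
    using tG g t(1) by (simp add: x_def cact_mult g\<eta> S_def)
  \<comment> \<open>Powers and conjugation commute, so iterating the exponent corresponds to
    iterating \<open>x\<close>.\<close>
  have iter: "pwr (s ^ i) \<eta> = cact (x [^] i) \<eta>" for i :: nat
  proof (induction i)
    case 0
    have "pwr 1 \<eta> = \<eta>" using sph\<eta> by (auto simp: pwr_def spherical_def)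
    then show ?case by (simp add: cact_one[OF sph\<eta>])
  next
    case (Suc i)
    have "pwr (s ^ Suc i) \<eta> = pwr s (cact (x [^] i) \<eta>)" by (simp add: pwr_pwr flip: Suc)
    also have "\<dots> = cact (x [^] i) (cact x \<eta>)" using xG by (simp add: pwr_cact x\<eta> \<eta>'_def)
    also have "\<dots> = cact (x [^] Suc i) \<eta>" using xG by (simp add: cact_mult)
    finally show ?case .
  qed
  define h where "h = card ?H"
  have HG: "subgroup ?H G" using normalizer_imp_subgroup[OF PG] .
  have powH: "u [^] h = \<one>" if "u \<in> ?H" for u using pow_card_subgroup[OF HG that] by (simp add: h_def)
  have period: "pwr (s ^ h) \<eta> = \<eta>" using iter[of h] powH[OF xH] cact_one[OF sph\<eta>] by simp
  \<comment> \<open>The iteration closes up after \<open>h\<close> steps because x^h = 1. As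
    \<open>h\<close> is odd, s^h is -1 modulo \<open>h\<close>, and raising to this power inverts
    every element of the normalizer.\<close>
  have real: "\<eta> (inv c) = \<eta> c" if c: "c \<in> M" "c \<in> ?H" for c
  proof -
    have "h dvd s ^ h + 1"
    proof -
      have "int h dvd int s + 1" using s(2) by (metis h_def int_dvd_int_iff of_nat_1 of_nat_add)
      then have "[int s = - 1] (mod int h)" by (simp add: cong_iff_dvd_diff)
      then have "[int s ^ h = (- 1) ^ h] (mod int h)" by (rule cong_pow)
      then have "int h dvd int s ^ h + 1" using odd by (simp add: cong_iff_dvd_diff h_def)
      then show ?thesis by (metis int_dvd_int_iff of_nat_1 of_nat_add of_nat_power)
    qed
    then obtain l where l: "s ^ h + 1 = h * l" by (elim dvdE)
    have "c [^] (s ^ h) \<otimes> c = c [^] (h * l)" using c by (simp flip: l)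
    also have "\<dots> = (c [^] h) [^] l" using c by (simp add: nat_pow_pow)
    also have "\<dots> = \<one>" using powH[OF c(2)] by simp
    finally have "inv c = c [^] (s ^ h)"
      using c by (intro inv_equality) auto
    then show ?thesis using fun_cong[OF period, of c] c by (simp add: pwr_def)
  qed
  have card_dvd: "odd (card K)" if K: "subgroup K G" "K \<subseteq> ?H" for K
    using odd card_subgroup_dvd[OF K(1) HG K(2)] dvd_trans by blast
  have ne: "(\<Sum>m\<in>M. \<eta> m) \<noteq> 0"
    using cM
  proof
    assume pM: "card M = p ^ a"
    have "\<exists>u\<in>carrier G. \<forall>q\<in>M. conjg u q \<in> P"
    proof -
      obtain i where i: "card (carrier G) = card P * i" "\<not> p dvd i"
        using sylow_cofactor[OF syl finG p subgroup_self PG] by blast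
      show ?thesis
        by (rule sylow_conjugate_subset[OF finG subgroup_self P(1) PG i sub _ pM p]) auto
    qed
    then obtain u where u: "u \<in> carrier G" "\<And>q. q \<in> M \<Longrightarrow> conjg u q \<in> P" by blast
    \<comment> \<open>Some conjugate of \<open>M\<close> lies in \<open>P\<close>, and by normality
      that conjugate is \<open>M\<close>.\<close>
    have MP: "m \<in> P" if m: "m \<in> M" for m
      using u(2)[OF conjM'[OF u(1) m]] conj_cancel(2)[OF u(1) memG[OF m]] by simp
    have MH: "M \<subseteq> ?H"
    proof
      fix m assume m: "m \<in> M"
      show "m \<in> ?H"
        by (rule normalizer_memI[OF finP PG memG[OF m]])
          (use MP[OF m] in \<open>auto intro!: subgroup.m_closed[OF P(1)] subgroup.m_inv_closed[OF P(1)]\<close>)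
    qed
    show ?thesis using MH real card_dvd[OF sub MH] by (intro spherical_real_odd[OF sph\<eta>]) auto
  next
    assume pM: "\<not> p dvd card M"
    define C where "C = {m \<in> M. \<forall>y\<in>P. conjg y m = m}"
    have CH: "C \<subseteq> ?H"
    proof
      fix c assume c: "c \<in> C"
      show "c \<in> ?H"
      proof (rule normalizer_memI[OF finP PG])
        show cG: "c \<in> carrier G" using c by (simp add: C_def)
        fix y assume y: "y \<in> P"
        then have yG: "y \<in> carrier G" using PG by blast
        have "y \<otimes> c = c \<otimes> y"
        proof -
          have "y \<otimes> c = (conjg y c) \<otimes> y" using cG yG by (simp add: m_assoc)
          then show ?thesis using c y by (simp add: C_def)
        qed
        then have "conjg c y = y" using cG yG by (metis inv_closed m_assoc r_inv r_one)
        then show "conjg c y \<in> P" using y by simp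
      qed
    qed
    have subC: "subgroup C G" by (rule fixed_points_subgroup[OF PG C_def])
    define z where "z = cis (2 * pi / real N)"
    have zN: "z ^ N = 1" using N by (simp add: z_def DeMoivre)
    show ?thesis
    proof (rule spherical_real_fixed_points[OF sph\<eta> p pM pd zN N(1) _ P _ _ C_def card_dvd[OF subC CH]])
      fix m assume m: "m \<in> M"
      obtain F where F: "\<And>s::nat. \<eta> (m [^] s) * tr (proj \<eta>) = ipoly F (z ^ s)"
        using tr_rho_proj_ipoly[OF sph\<eta> N z_def m] by blast
      have "of_nat d * \<eta> m = ipoly F z" using F[of 1] m by (simp add: d(2)[OF \<eta>] mult.commute)
      then show "of_nat d * \<eta> m \<in> integral_at z" by (simp add: integral_at_def)
    next
      fix y m assume y: "y \<in> P" and m: "m \<in> M"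
      have yG: "y \<in> carrier G" using PG y by blast
      then show "conjg y m \<in> M" using m by (intro conjM)
      have "cact (inv y) \<eta> m = \<eta> m" using fix\<eta>[OF subgroup.m_inv_closed[OF P(1) y]] by simp
      then show "\<eta> (conjg y m) = \<eta> m" using m yG by (simp add: cact_in)
    next
      fix c assume c: "c \<in> C"
      then show "\<eta> (inv c) = \<eta> c" using CH by (intro real) (auto simp: C_def)
    qed
  qed
  have one: "\<eta> m = 1" if "m \<in> M" for m using spherical_trivial[OF sph\<eta> ne that] .
  \<comment> \<open>\<eta> is 1 on \<open>M\<close>, hence invariant under conjugation. So
    \<open>proj \<eta>\<close> is the identity, while it is also a multiple of the sum of \<rho>
    over \<open>M\<close>, which absorbs every \<rho>(m).\<close>
  have "\<Omega> = {\<eta>}"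
  proof -
    have "\<theta> = \<eta>" if \<theta>: "\<theta> \<in> \<Omega>" for \<theta>
    proof -
      obtain g' where g': "g' \<in> carrier G" "\<theta> = cact g' \<eta>0" using \<theta> by (auto simp: \<Omega>_def)
      then have eq: "\<theta> = cact (g' \<otimes> inv g1) \<eta>" using g12 by (simp add: m_assoc flip: cact_mult)
      have "g' \<otimes> inv g1 \<in> carrier G" using g' g12 by simp
      then show ?thesis unfolding eq using one conjM' sph\<eta> by (auto simp: cact_def spherical_def)
    qed
    then show ?thesis using \<eta> by blast
  qed
  then have proj1: "proj \<eta> = idm n" using sumI by simp
  have "\<rho> m * proj \<eta> = proj \<eta>" if m: "m \<in> M" for m
  proof -
    have "isum \<eta> = (\<Sum>k\<in>M. \<rho> k)" unfolding isum_def by (intro sum.cong refl) (simp add: one)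
    moreover have "\<rho> m * (\<Sum>k\<in>M. \<rho> k) = (\<Sum>k\<in>M. \<rho> (m \<otimes> k))"
      unfolding sum_distrib_left using m by (intro sum.cong refl) (simp add: rho_mult)
    moreover have "\<dots> = (\<Sum>k\<in>M. \<rho> k)" by (rule sum_left_mult[OF m])
    ultimately show ?thesis by (simp add: proj_def scl_mult_right)
  qed
  then show ?thesis using rho_idm by (simp add: proj1)
qed

end

section \<open>Composition series and images of p-solvable subgroups\<close>

lemma (in group) composition_series_snoc:
  assumes A: "A \<lhd> G" and simple: "simple_group (G Mod A)" and Hs: "composition_series (subgrp A) Hs"
  shows "composition_series G (Hs @ [carrier G])"
proof -
  have A': "subgroup A G" using A by (rule normal_imp_subgroup)
  have Hs': "Hs \<noteq> []" "hd Hs = {\<one>}" "last Hs = A"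
    "\<And>i. Suc i < length Hs \<Longrightarrow> subgroup (Hs ! Suc i) (subgrp A) \<and>
        Hs ! i \<lhd> subgrp (Hs ! Suc i) \<and> simple_group (subgrp (Hs ! Suc i) Mod (Hs ! i))"
    using Hs by (auto simp: composition_series_def)
  show ?thesis
    unfolding composition_series_def
  proof (intro conjI allI impI)
    fix i assume i: "Suc i < length (Hs @ [carrier G])"
    let ?K = "Hs @ [carrier G]"
    have *: "subgroup (?K ! Suc i) G \<and> ?K ! i \<lhd> subgrp (?K ! Suc i) \<and>
      simple_group (subgrp (?K ! Suc i) Mod (?K ! i))"
    proof (cases "Suc i < length Hs")
      case True
      then show ?thesis using Hs'(4)[OF True] incl_subgroup[OF A'] by (simp add: nth_append)
    next
      case False
      then have "Suc i = length Hs" using i by simp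
      then have "length Hs - 1 = i" "i < length Hs" by simp_all
      then have "?K ! Suc i = carrier G" "?K ! i = A" using Hs'(1,3) by (auto simp: nth_append last_conv_nth)
      then show ?thesis using A simple subgroup_self by simp
    qed
    then show "subgroup (?K ! Suc i) G" "?K ! i \<lhd> subgrp (?K ! Suc i)"
      "simple_group (subgrp (?K ! Suc i) Mod (?K ! i))" by auto
  qed (use Hs' in auto)
qed

text \<open>A normal subgroup of the quotient is pulled back as the union of its cosets and compared
  with the maximal \<open>A\<close>.\<close>

lemma (in group) exists_maximal_normal:
  assumes fin: "finite (carrier G)" and nontriv: "carrier G \<noteq> {\<one>}"
  shows "\<exists>A. A \<lhd> G \<and> A \<noteq> carrier G \<and> simple_group (G Mod A)"
proof -
  define F where "F = {A. A \<lhd> G \<and> A \<noteq> carrier G}"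
  have sub: "A \<subseteq> carrier G" if "A \<lhd> G" for A using subgroup.subset[OF normal_imp_subgroup[OF that]] .
  have finF: "finite F" by (rule finite_subset[of _ "Pow (carrier G)"]) (use sub fin in \<open>auto simp: F_def\<close>)
  have "{\<one>} \<in> F" using nontriv one_is_normal by (auto simp: F_def)
  then have "\<exists>A\<in>F. \<forall>B\<in>F. A \<subseteq> B \<longrightarrow> A = B" using finite_has_maximal[OF finF] by blast
  then obtain A where A: "A \<in> F" and max: "\<And>B. B \<in> F \<Longrightarrow> A \<subseteq> B \<Longrightarrow> B = A" by blast
  have AG: "A \<lhd> G" and ne: "A \<noteq> carrier G" using A by (auto simp: F_def)
  interpret normal A G by (rule AG)
  have triv: "carrier (G Mod A) \<noteq> {\<one>\<^bsub>G Mod A\<^esub>}" using ne fact_group_trivial_iff[OF fin] by simp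
  interpret Q: group "G Mod A" by (rule factorgroup_is_group)
  have finQ: "finite (carrier (G Mod A))" using fin by (simp add: FactGroup_def RCOSETS_def)
  have "simple_group (G Mod A)"
  proof
    have "Coset.order (G Mod A) \<noteq> 1" using triv Q.order_one_triv_iff by simp
    moreover have "Coset.order (G Mod A) > 0" using finQ Q.order_gt_0_iff_finite by simp
    ultimately show "1 < Coset.order (G Mod A)" by linarith
  next
    fix B assume B: "B \<lhd> G Mod A"
    have Bsub: "subgroup B (G Mod A)" using B by (rule normal_imp_subgroup)
    have U: "\<Union>B = {x \<in> carrier G. A #> x \<in> B}" by (rule factgroup_subgroup_union_char[OF Bsub])
    have UG: "\<Union>B \<lhd> G" by (rule factgroup_subgroup_union_normal[OF B])
    have Bc: "B \<subseteq> carrier (G Mod A)" using Bsub by (rule subgroup.subset)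
    have "A \<in> B" using subgroup.one_closed[OF Bsub] by simp
    then have AU: "A \<subseteq> \<Union>B" by blast
    show "B = carrier (G Mod A) \<or> B = {\<one>\<^bsub>G Mod A\<^esub>}"
    proof (cases "\<Union>B = carrier G")
      case True
      then have "carrier G = {x \<in> carrier G. A #> x \<in> B}" using U by simp
      then have "A #> x \<in> B" if "x \<in> carrier G" for x using that by blast
      then have "carrier (G Mod A) \<subseteq> B" by (auto simp: FactGroup_def RCOSETS_def)
      then show ?thesis using Bc by blast
    next
      case False
      then have "\<Union>B \<in> F" using UG by (simp add: F_def)
      then have UA: "\<Union>B = A" using AU by (rule max)
      have "X = A" if X: "X \<in> B" for X
      proof -
        have "X \<in> carrier (G Mod A)" using X Bc by (rule rev_subsetD)
        then obtain x where x: "x \<in> carrier G" "X = A #> x" by (auto simp: FactGroup_def RCOSETS_def)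
        then have "x \<in> {x \<in> carrier G. A #> x \<in> B}" using X by simp
        then have "x \<in> A" unfolding U[symmetric] UA .
        then have "A #> x = A" by (rule rcos_const[OF is_group])
        then show ?thesis using x(2) by simp
      qed
      then have "B = {A}" using \<open>A \<in> B\<close> by blast
      then show ?thesis by simp
    qed
  qed
  then show ?thesis using AG ne by blast
qed

text \<open>\<open>p_solvable\<close> quantifies over all composition factors, so it says something
  only once a series is known to exist.\<close>

lemma (in group) composition_series_exists:
  assumes "finite (carrier G)"
  shows "\<exists>Hs. composition_series G Hs"
proof -
  have "\<exists>Hs. composition_series (subgrp K) Hs" if "subgroup K G" for K
    using that
  proof (induction "card K" arbitrary: K rule: less_induct)
    case less
    have finK: "finite K" using finite_subset[OF subgroup.subset[OF less.prems] assms] .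
    interpret K: group "subgrp K" using subgroup.subgroup_is_group[OF less.prems is_group] .
    show ?case
    proof (cases "K = {\<one>}")
      case True
      then have "composition_series (subgrp K) [{\<one>}]" by (simp add: composition_series_def)
      then show ?thesis by blast
    next
      case False
      then obtain A where A: "A \<lhd> subgrp K" "A \<noteq> K" "simple_group (subgrp K Mod A)"
        using K.exists_maximal_normal finK by auto
      have AK: "subgroup A (subgrp K)" using A(1) by (rule normal_imp_subgroup)
      then have "A \<subset> K" using A(2) subgroup.subset[OF AK] by auto
      then have "card A < card K" using finK by (intro psubset_card_mono)
      then obtain Hs where "composition_series (subgrp A) Hs"
        using less.hyps incl_subgroup[OF less.prems AK] by blast
      then show ?thesis using K.composition_series_snoc[OF A(1,3), of Hs] by auto
    qed
  qed
  from this[OF subgroup_self] show ?thesis by simp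
qed

lemma (in group_hom) card_image_kernel:
  assumes K: "subgroup K G" "finite K"
  shows "card K = card (h ` K) * card {x \<in> K. h x = \<one>\<^bsub>H\<^esub>}"
proof -
  have KG: "\<And>x. x \<in> K \<Longrightarrow> x \<in> carrier G" using subgroup.mem_carrier[OF K(1)] .
  have mK: "\<And>x y. x \<in> K \<Longrightarrow> y \<in> K \<Longrightarrow> x \<otimes> y \<in> K" "\<And>x. x \<in> K \<Longrightarrow> inv x \<in> K"
    using K(1) by (auto simp: subgroup.m_closed subgroup.m_inv_closed)
  have "card {x \<in> K. h x = w} = card {x \<in> K. h x = \<one>\<^bsub>H\<^esub>}" if w: "w \<in> h ` K" for w
  proof -
    obtain u where u: "u \<in> K" "w = h u" using w by blast
    have "bij_betw (\<lambda>x. u \<otimes> x) {x \<in> K. h x = \<one>\<^bsub>H\<^esub>} {x \<in> K. h x = w}"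
      by (rule bij_betwI[of _ _ _ "\<lambda>x. inv u \<otimes> x"])
        (use u KG mK in \<open>auto simp flip: G.m_assoc\<close>)
    then show ?thesis by (rule bij_betw_same_card[symmetric])
  qed
  then have "(\<Sum>w\<in>h ` K. card {x \<in> K. h x = w}) = card (h ` K) * card {x \<in> K. h x = \<one>\<^bsub>H\<^esub>}" by simp
  moreover have "card K = (\<Sum>w\<in>h ` K. card {x \<in> K. h x = w})"
    using sum.image_gen[OF K(2), of "\<lambda>_. 1::nat" h] by simp
  ultimately show ?thesis by simp
qed

lemma (in group_hom) kernel_in_subgroup:
  assumes "subgroup K G"
  shows "subgroup {x \<in> K. h x = \<one>\<^bsub>H\<^esub>} G"
proof -
  have "{x \<in> K. h x = \<one>\<^bsub>H\<^esub>} = K \<inter> kernel G H h"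
    using subgroup.mem_carrier[OF assms] by (auto simp: kernel_def)
  then show ?thesis using G.subgroups_Inter_pair[OF assms subgroup_kernel] by simp
qed

text \<open>Modulo \<open>A\<close> the product has the same image as \<open>B\<close>, and the
  kernel of that map on the product lies in \<open>A\<close>.\<close>

lemma (in group) card_set_mult_dvd:
  assumes A: "A \<lhd> G" and B: "B \<lhd> G" and fin: "finite (carrier G)"
  shows "card (A <#> B) dvd card A * card B"
proof -
  have AB: "subgroup (A <#> B) G" using mult_norm_subgroup[OF A normal_imp_subgroup[OF B]] .
  interpret normal A G by (rule A)
  interpret hom: group_hom G "G Mod A" "\<lambda>x. A #> x"
    by (intro group_hom.intro group_hom_axioms.intro is_group factorgroup_is_group r_coset_hom_Mod)
  have finS: "finite S" if "subgroup S G" for S using finite_subset[OF subgroup.subset[OF that] fin] .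
  have BG: "\<And>b. b \<in> B \<Longrightarrow> b \<in> carrier G" using normal_imp_subgroup[OF B] by (rule subgroup.mem_carrier)
  have "(\<lambda>x. A #> x) ` (A <#> B) = (\<lambda>x. A #> x) ` B"
  proof -
    have "A #> (a \<otimes> b) = A #> b" if "a \<in> A" "b \<in> B" for a b
      using that BG rcos_const[of a] coset_mult_assoc[OF subset, of a b] by simp
    note * = this
    show ?thesis
    proof (intro equalityI subsetI)
      fix X assume "X \<in> (\<lambda>x. A #> x) ` (A <#> B)"
      then obtain a b where "a \<in> A" "b \<in> B" "X = A #> (a \<otimes> b)" by (auto simp: set_mult_def)
      then show "X \<in> (\<lambda>x. A #> x) ` B" by (simp add: *)
    next
      fix X assume "X \<in> (\<lambda>x. A #> x) ` B"
      then obtain b where b: "b \<in> B" "X = A #> b" by blast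
      then have "\<one> \<otimes> b \<in> A <#> B" using subgroup.one_closed[OF subgroup_axioms] unfolding set_mult_def by blast
      then show "X \<in> (\<lambda>x. A #> x) ` (A <#> B)" using b BG by simp
    qed
  qed
  moreover have "card ((\<lambda>x. A #> x) ` B) dvd card B"
    using hom.card_image_kernel[OF normal_imp_subgroup[OF B] finS[OF normal_imp_subgroup[OF B]]] by simp
  moreover have "card {x \<in> A <#> B. A #> x = \<one>\<^bsub>G Mod A\<^esub>} dvd card A"
  proof (rule card_subgroup_dvd[OF hom.kernel_in_subgroup[OF AB] subgroup_axioms])
    show "{x \<in> A <#> B. A #> x = \<one>\<^bsub>G Mod A\<^esub>} \<subseteq> A"
      using subgroup.mem_carrier[OF AB] rcos_self[OF _ subgroup_axioms] by auto
  qed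
  ultimately have "card (A <#> B) dvd card B * card A"
    unfolding hom.card_image_kernel[OF AB finS[OF AB]] by (simp add: mult_dvd_mono)
  then show ?thesis by (simp only: mult.commute)
qed

text \<open>The largest normal \<open>\<pi>\<close>-subgroup of a normal subgroup \<open>A\<close> is normalised by everything.\<close>

lemma (in group) lift_normal_pi_subgroup:
  assumes fin: "finite (carrier G)" and A: "A \<lhd> G"
    and pi: "\<And>a b c. \<pi> a \<Longrightarrow> \<pi> b \<Longrightarrow> c dvd a * b \<Longrightarrow> \<pi> (c :: nat)"
    and L: "L \<lhd> subgrp A" "L \<noteq> {\<one>}" "\<pi> (card L)"
  shows "\<exists>L'. L' \<lhd> G \<and> L' \<noteq> {\<one>} \<and> \<pi> (card L') \<and> L' \<subseteq> A"
proof -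
  have AG: "subgroup A G" using A by (rule normal_imp_subgroup)
  interpret A: group "subgrp A" using subgroup.subgroup_is_group[OF AG is_group] .
  have finA: "finite A" using finite_subset[OF subgroup.subset[OF AG] fin] .
  define F where "F = {X. X \<lhd> subgrp A \<and> \<pi> (card X)}"
  have FA: "X \<subseteq> A" if "X \<in> F" for X
    using that subgroup.subset[OF normal_imp_subgroup[of X "subgrp A"]] by (auto simp: F_def)
  have finF: "finite F" by (rule finite_subset[of _ "Pow A"]) (use FA finA in auto)
  have "L \<in> F" using L by (simp add: F_def)
  have "\<exists>M\<in>F. L \<subseteq> M \<and> (\<forall>X\<in>F. M \<subseteq> X \<longrightarrow> M = X)"
    by (rule finite_has_maximal2[OF finF \<open>L \<in> F\<close>])
  then obtain M where M: "M \<in> F" "L \<subseteq> M" and max0: "\<forall>X\<in>F. M \<subseteq> X \<longrightarrow> M = X"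
    by (elim bexE conjE)
  have max: "X = M" if "X \<in> F" "M \<subseteq> X" for X
    using bspec[OF max0 that(1)] that(2) by simp
  have Mn: "M \<lhd> subgrp A" and MA: "M \<subseteq> A" using M FA by (auto simp: F_def)
  have one_mem: "\<one> \<in> X" if "X \<in> F" for X
    using that subgroup.one_closed[OF normal_imp_subgroup[of X "subgrp A"]] by (simp add: F_def)
  \<comment> \<open>The product of two members of \<open>F\<close> is again one, so the maximal
    \<open>M\<close> contains them all, in particular its own conjugates under the larger
    group.\<close>
  have absorb: "X \<subseteq> M" if X: "X \<in> F" for X
  proof -
    have Xn: "X \<lhd> subgrp A" and XA: "X \<subseteq> A" using X FA by (auto simp: F_def)
    have AGc: "\<And>a. a \<in> A \<Longrightarrow> a \<in> carrier G" using subgroup.mem_carrier[OF AG] .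
    have sub: "subgroup (X <#> M) (subgrp A)"
      using A.mult_norm_subgroup[OF Xn normal_imp_subgroup[OF Mn]] by simp
    have conj: "conjg y x \<in> Y" if "Y \<lhd> subgrp A" "y \<in> A" "x \<in> Y" for Y x y
      using normal.inv_op_closed2[OF that(1), of y x] that(2,3) m_inv_consistent[OF AG that(2)] by simp
    have "X <#> M \<lhd> subgrp A"
      unfolding A.normal_inv_iff
    proof (intro conjI ballI sub)
      fix y w assume y: "y \<in> carrier (subgrp A)" and "w \<in> X <#> M"
      then obtain x m where w: "x \<in> X" "m \<in> M" "w = x \<otimes> m" by (auto simp: set_mult_def)
      have "conjg y w = (conjg y x) \<otimes> (conjg y m)"
        using y w XA MA AGc by (simp add: conj_mult subset_iff)
      then have "conjg y w \<in> X <#> M"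
        using conj[OF Xn _ w(1)] conj[OF Mn _ w(2)] y by (auto simp: set_mult_def)
      then show "y \<otimes>\<^bsub>subgrp A\<^esub> w \<otimes>\<^bsub>subgrp A\<^esub> inv\<^bsub>subgrp A\<^esub> y \<in> X <#> M"
        using y m_inv_consistent[OF AG] by simp
    qed
    moreover have "\<pi> (card (X <#> M))"
      using A.card_set_mult_dvd[OF Xn Mn] finA X M pi[of "card X" "card M"] by (simp add: F_def)
    ultimately have "X <#> M \<in> F" by (simp add: F_def)
    moreover have "M \<subseteq> X <#> M"
    proof
      fix m assume m: "m \<in> M"
      then have "\<one> \<otimes> m \<in> X <#> M" using one_mem[OF X] unfolding set_mult_def by blast
      then show "m \<in> X <#> M" using m MA AGc by (simp add: subset_iff)
    qed
    ultimately have "X <#> M = M" by (intro max)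
    moreover have "X \<subseteq> X <#> M"
    proof
      fix x assume x: "x \<in> X"
      then have "x \<otimes> \<one> \<in> X <#> M" using one_mem[OF M(1)] unfolding set_mult_def by blast
      then show "x \<in> X <#> M" using x XA AGc by (simp add: subset_iff)
    qed
    ultimately show ?thesis by blast
  qed
  have "M \<lhd> G"
    unfolding normal_inv_iff
  proof (intro conjI ballI)
    show "subgroup M G" using incl_subgroup[OF AG normal_imp_subgroup[OF Mn]] .
    fix g m assume g: "g \<in> carrier G" and m: "m \<in> M"
    define X where "X = (conjg g) ` M"
    have AGc: "\<And>a. a \<in> A \<Longrightarrow> a \<in> carrier G" using subgroup.mem_carrier[OF AG] .
    have cA: "conjg g a \<in> A" "inv g \<otimes> a \<otimes> g \<in> A" if "a \<in> A" for a
      using normal.inv_op_closed2[OF A g that] normal.inv_op_closed1[OF A g that] .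
    have hom: "group_hom (subgrp A) (subgrp A) (conjg g)"
      using cA g AGc by (intro group_hom.intro group_hom_axioms.intro A.is_group) (auto simp: hom_def conj_mult)
    have "(conjg g) ` A = A"
    proof (intro equalityI subsetI)
      fix a assume a: "a \<in> A"
      show "a \<in> (conjg g) ` A"
        by (rule image_eqI[of _ _ "inv g \<otimes> a \<otimes> g"]) (use conj_cancel(2)[OF g AGc[OF a]] cA(2)[OF a] in simp_all)
    qed (use cA in auto)
    then have Xn: "X \<lhd> subgrp A"
      unfolding X_def using normal.surj_hom_normal_subgroup[OF Mn hom] by simp
    have "inj_on (conjg g) M" using g MA AGc by (intro inj_onI) (auto simp: subset_iff)
    then have "card X = card M" by (simp add: X_def card_image)
    then have "X \<in> F" using Xn M by (simp add: F_def)
    then show "conjg g m \<in> M" using absorb m by (auto simp: X_def)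
  qed
  moreover have "M \<noteq> {\<one>}"
    using subset_singletonD[of L \<one>] M(2) L(2) one_mem[OF \<open>L \<in> F\<close>] by blast
  moreover have "\<pi> (card M)" using M(1) by (simp add: F_def)
  ultimately show ?thesis using MA by blast
qed

section \<open>The image of the representation as a group of matrices\<close>

definition matrix_group :: "('a, 'b) monoid_scheme \<Rightarrow> nat \<Rightarrow> ('a \<Rightarrow> complex mat) \<Rightarrow> complex mat monoid" where
  "matrix_group G n \<rho> = (units_of (ring_mat TYPE(complex) n ()))\<lparr>carrier := \<rho> ` carrier G\<rparr>"

lemma matrix_group_simps [simp]:
  "carrier (matrix_group G n \<rho>) = \<rho> ` carrier G"
  "x \<otimes>\<^bsub>matrix_group G n \<rho>\<^esub> y = x * y"
  "\<one>\<^bsub>matrix_group G n \<rho>\<^esub> = 1\<^sub>m n"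
  by (simp_all add: matrix_group_def units_of_def ring_mat_def)

lemma group_hom_matrix_group:
  assumes "group G" "representation G n \<rho>"
  shows "group_hom G (matrix_group G n \<rho>) \<rho>"
proof -
  let ?U = "units_of (ring_mat TYPE(complex) n ())"
  interpret R: ring "ring_mat TYPE(complex) n ()" by (rule ring_mat)
  have U: "group ?U" by (rule R.units_group)
  have hom: "group_hom G ?U \<rho>"
    using assms U by (simp add: group_hom_def group_hom_axioms_def representation_def)
  interpret group_hom G ?U \<rho> by (rule hom)
  have "group_hom (G\<lparr>carrier := carrier G\<rparr>) (?U\<lparr>carrier := \<rho> ` carrier G\<rparr>) \<rho>"
    by (rule induced_group_hom[OF G.subgroup_self])
  then show ?thesis by (simp add: matrix_group_def)
qed

lemma representation_carrier_mat:
  assumes "representation G n \<rho>" "g \<in> carrier G"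
  shows "\<rho> g \<in> carrier_mat n n"
proof -
  have "\<rho> g \<in> carrier (units_of (ring_mat TYPE(complex) n ()))"
    using assms by (auto simp: representation_def hom_def)
  then show ?thesis by (simp add: units_of_def Units_def ring_mat_def)
qed

lemma fixed_vectors_subspace:
  assumes A: "(A :: complex mat) \<in> carrier_mat n n"
  shows "VectorSpace.subspace class_ring {w \<in> carrier_vec n. A *\<^sub>v w = w} (module_vec TYPE(complex) n)"
  unfolding VectorSpace.subspace_def submodule_def
  using vec_vs vec_module A
  by (auto simp: module_vec_simps class_ring_simps mult_add_distrib_mat_vec[OF A] mult_mat_vec[OF A])

text \<open>The fixed space of \<open>A\<close> is invariant. It contains all columns of
  \<open>A\<close>, so if it is zero then \<open>A\<close> is zero; if it is everything,
  \<open>A\<close> is the identity.\<close>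

lemma idempotent_commuting_irreducible:
  assumes irr: "irreducible_representation G n \<rho>"
    and A: "A \<in> carrier_mat n n" "A * A = A" "A \<noteq> 0\<^sub>m n n"
    and comm: "\<And>g. g \<in> carrier G \<Longrightarrow> \<rho> g * A = A * \<rho> g"
  shows "A = 1\<^sub>m n"
proof -
  have rep: "representation G n \<rho>" using irr by (simp add: irreducible_representation_def)
  define W where "W = {w \<in> carrier_vec n. A *\<^sub>v w = w}"
  have "\<rho> g *\<^sub>v w \<in> W" if g: "g \<in> carrier G" and w: "w \<in> W" for g w
  proof -
    have wc: "w \<in> carrier_vec n" "A *\<^sub>v w = w" using w by (auto simp: W_def)
    have rc: "\<rho> g \<in> carrier_mat n n" using representation_carrier_mat[OF rep g] .
    have "A *\<^sub>v (\<rho> g *\<^sub>v w) = (A * \<rho> g) *\<^sub>v w" by (rule assoc_mult_mat_vec[OF A(1) rc wc(1), symmetric])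
    also have "\<dots> = (\<rho> g * A) *\<^sub>v w" using comm[OF g] by simp
    also have "\<dots> = \<rho> g *\<^sub>v w" using assoc_mult_mat_vec[OF rc A(1) wc(1)] wc(2) by simp
    finally show ?thesis using mult_mat_vec_carrier[OF rc wc(1)] by (simp add: W_def)
  qed
  then have W: "W = {0\<^sub>v n} \<or> W = carrier_vec n"
    using irr fixed_vectors_subspace[OF A(1)] unfolding irreducible_representation_def W_def by blast
  have entry: "(A *\<^sub>v unit_vec n j) $ i = A $$ (i,j)" if "i < n" "j < n" for i j
    using A(1) that by simp
  show ?thesis
    using W
  proof
    assume W: "W = {0\<^sub>v n}"
    have "A $$ (i,j) = 0" if ij: "i < n" "j < n" for i j
    proof -
      let ?w = "A *\<^sub>v unit_vec n j"
      have "A *\<^sub>v ?w = (A * A) *\<^sub>v unit_vec n j"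
        by (rule assoc_mult_mat_vec[OF A(1) A(1), symmetric]) simp
      then have "?w \<in> W" using A(1,2) by (simp add: W_def mult_mat_vec_carrier)
      then have "?w = 0\<^sub>v n" using W by simp
      then show ?thesis using entry[OF ij] ij by simp
    qed
    then have "A = 0\<^sub>m n n" using A(1) by (intro eq_matI) auto
    then show ?thesis using A(3) by simp
  next
    assume W: "W = carrier_vec n"
    have "A $$ (i,j) = 1\<^sub>m n $$ (i,j)" if ij: "i < n" "j < n" for i j
    proof -
      have "unit_vec n j \<in> W" using W by simp
      then have "A *\<^sub>v unit_vec n j = unit_vec n j" by (simp add: W_def)
      then show ?thesis using entry[OF ij] ij by (simp add: unit_vec_def)
    qed
    then show ?thesis using A(1) by (intro eq_matI) auto
  qed
qed

lemma fmat_rep_matrix_group: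
  assumes "group G" "finite (carrier G)" and irr: "irreducible_representation G n \<rho>"
  shows "fmat_rep (matrix_group G n \<rho>) n fmat_of_mat"
proof -
  have rep: "representation G n \<rho>" using irr by (simp add: irreducible_representation_def)
  interpret group_hom G "matrix_group G n \<rho>" \<rho> by (rule group_hom_matrix_group[OF assms(1) rep])
  have carr: "x \<in> carrier_mat n n" if "x \<in> carrier (matrix_group G n \<rho>)" for x
    using that representation_carrier_mat[OF rep] by auto
  show ?thesis
  proof (intro fmat_rep.intro fmat_rep_axioms.intro H.is_group)
    show "finite (carrier (matrix_group G n \<rho>))" using assms(2) by simp
    show "fmat_of_mat (x \<otimes>\<^bsub>matrix_group G n \<rho>\<^esub> y) = fmat_of_mat x * fmat_of_mat y"
      if "x \<in> carrier (matrix_group G n \<rho>)" "y \<in> carrier (matrix_group G n \<rho>)" for x y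
      using that carr by (simp add: fmat_of_mat_times[of _ n])
    show "fmat_of_mat \<one>\<^bsub>matrix_group G n \<rho>\<^esub> = idm n" by (simp add: idm_def)
    show "supp_le n (fmat_of_mat x)" if "x \<in> carrier (matrix_group G n \<rho>)" for x
      by (rule supp_le_fmat_of_mat[OF carr[OF that]])
    show "n > 0" using irr by (simp add: irreducible_representation_def)
    fix I assume I: "supp_le n I" "I * I = I" "I \<noteq> 0"
      and comm: "\<And>g. g \<in> carrier (matrix_group G n \<rho>) \<Longrightarrow> fmat_of_mat g * I = I * fmat_of_mat g"
    define A where "A = mat_of_fmat n I"
    have A: "A \<in> carrier_mat n n" and FA: "fmat_of_mat A = I"
      using I(1) by (simp_all add: A_def fmat_of_mat_of_fmat)
    have "A = 1\<^sub>m n"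
    proof (rule idempotent_commuting_irreducible[OF irr A])
      show "A * A = A"
        by (rule fmat_of_mat_inject[of _ n]) (use A in \<open>simp_all add: fmat_of_mat_times[OF A A] FA I(2)\<close>)
      show "A \<noteq> 0\<^sub>m n n"
      proof
        assume A0: "A = 0\<^sub>m n n"
        have "ent I i j = 0" for i j unfolding FA[symmetric] A0 by (simp add: ent_fmat_of_mat)
        then have "I = 0" by (intro fmat_eqI) (simp add: zero_fmat.rep_eq)
        then show False using I(3) by simp
      qed
      fix g assume g: "g \<in> carrier G"
      have rc: "\<rho> g \<in> carrier_mat n n" using representation_carrier_mat[OF rep g] .
      show "\<rho> g * A = A * \<rho> g"
        by (rule fmat_of_mat_inject[of _ n])
          (use A rc comm[of "\<rho> g"] g in \<open>simp_all add: fmat_of_mat_times[OF A rc] fmat_of_mat_times[OF rc A] FA\<close>)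
    qed
    then show "I = idm n" using FA by (simp add: idm_def)
  qed
qed

text \<open>The index \<open>i\<close> of the image of \<open>P\<close> divides the index
  \<open>j\<close> of \<open>P\<close>, hence is prime to \<open>p\<close>.\<close>

lemma (in group_hom) sylow_image:
  assumes fin: "finite (carrier G)" and surj: "h ` carrier G = carrier H"
    and p: "Factorial_Ring.prime p" and syl: "sylow_subgroup G p P"
  shows "sylow_subgroup H p (h ` P)"
proof -
  have P: "subgroup P G" "card P = p ^ multiplicity p (Coset.order G)"
    using syl by (auto simp: sylow_subgroup_def)
  have PG: "P \<subseteq> carrier G" using P(1) by (rule subgroup.subset)
  have finP: "finite P" using finite_subset[OF PG fin] .
  let ?K = "{x \<in> carrier G. h x = \<one>\<^bsub>H\<^esub>}" and ?L = "{x \<in> P. h x = \<one>\<^bsub>H\<^esub>}"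
  have cG: "card (carrier G) = card (carrier H) * card ?K"
    using card_image_kernel[OF G.subgroup_self fin] by (simp add: surj)
  have cP: "card P = card (h ` P) * card ?L" by (rule card_image_kernel[OF P(1) finP])
  have "card ?L dvd card ?K"
    by (rule G.card_subgroup_dvd[OF kernel_in_subgroup[OF P(1)] kernel_in_subgroup[OF G.subgroup_self]])
      (use PG in auto)
  then obtain l where l: "card ?K = card ?L * l" by (elim dvdE)
  have hP: "subgroup (h ` P) H" by (rule subgroup_img_is_subgroup[OF P(1)])
  have "card (h ` P) dvd card (carrier H)"
    by (rule H.card_subgroup_dvd[OF hP H.subgroup_self]) (use PG in auto)
  then obtain i where i: "card (carrier H) = card (h ` P) * i" by (elim dvdE)
  obtain j where j: "card (carrier G) = card P * j" "\<not> p dvd j"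
    using G.sylow_cofactor[OF syl fin p G.subgroup_self PG] by blast
  have "card P > 0" using finP subgroup.one_closed[OF P(1)] by (auto simp: card_gt_0_iff)
  moreover have "card P * j = card P * (i * l)"
    using cG cP j(1) by (simp add: i l mult_ac)
  ultimately have "j = i * l" by simp
  then have pi: "\<not> p dvd i" using j(2) by auto
  have "card (h ` P) dvd p ^ multiplicity p (Coset.order G)" using cP P(2) by (metis dvd_triv_left)
  then obtain a where a: "card (h ` P) = p ^ a" using divides_primepow_nat[OF p] by blast
  have i0: "i \<noteq> 0" using pi by (cases "i = 0") auto
  have "multiplicity p (Coset.order H) = a"
  proof -
    have pp: "p ^ a \<noteq> 0" using p by (auto dest: prime_gt_0_nat)
    have "multiplicity p (p ^ a * i) = multiplicity p (p ^ a) + multiplicity p i"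
      using pp i0 p by (intro prime_elem_multiplicity_mult_distrib) auto
    also have "multiplicity p i = 0" using pi by (rule not_dvd_imp_multiplicity_0)
    also have "multiplicity p (p ^ a) = a" using p by (intro multiplicity_same_power) (auto simp: prime_nat_iff)
    finally show ?thesis using i a by (simp add: Coset.order_def)
  qed
  then show ?thesis using hP a by (simp add: sylow_subgroup_def)
qed

text \<open>Frattini argument: for a lift \<open>g\<close> of \<open>w\<close>, both
  \<open>P\<close> and its conjugate by \<open>g\<close> are Sylow in the full preimage
  \<open>S\<close> of the image of \<open>P\<close>, so an element of \<open>S\<close> corrects
  \<open>g\<close> to a normalising lift.\<close>

lemma (in group_hom) normalizer_image:
  assumes fin: "finite (carrier G)" and surj: "h ` carrier G = carrier H"
    and p: "Factorial_Ring.prime p" and syl: "sylow_subgroup G p P"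
  shows "normalizer H (h ` P) \<subseteq> h ` normalizer G P"
proof
  fix w assume w: "w \<in> normalizer H (h ` P)"
  have P: "subgroup P G" "card P = p ^ multiplicity p (Coset.order G)"
    using syl by (auto simp: sylow_subgroup_def)
  have PG: "P \<subseteq> carrier G" using P(1) by (rule subgroup.subset)
  have finP: "finite P" using finite_subset[OF PG fin] .
  have hPH: "h ` P \<subseteq> carrier H" using PG by auto
  have wH: "w \<in> carrier H"
    using H.normalizer_memD(1)[OF w hPH] subgroup.one_closed[OF P(1)] by blast
  obtain g where g: "g \<in> carrier G" "w = h g" using wH surj by blast
  let ?K = "kernel G H h"
  have Kn: "?K \<lhd> G" by (rule normal_kernel)
  define S where "S = ?K <#>\<^bsub>G\<^esub> P"
  have SG: "subgroup S G" unfolding S_def by (rule G.mult_norm_subgroup[OF Kn P(1)])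
  have S_iff: "x \<in> S" if x: "x \<in> carrier G" "h x \<in> h ` P" for x
  proof -
    obtain y where y: "y \<in> P" "h x = h y" using x(2) by blast
    have yG: "y \<in> carrier G" using y PG by blast
    have "x \<otimes> inv y \<in> ?K" using x(1) y yG by (simp add: kernel_def)
    moreover have "x = (x \<otimes> inv y) \<otimes> y" using x(1) yG by (simp add: G.m_assoc)
    ultimately show ?thesis using y(1) unfolding S_def set_mult_def by blast
  qed
  have PS: "P \<subseteq> S" using S_iff PG by blast
  define Q where "Q = (G.conjg g) ` P"
  have QG: "subgroup Q G" and cQ: "card Q = p ^ multiplicity p (Coset.order G)"
    using G.conj_subgroup[OF P(1) g(1)] P(2) by (simp_all add: Q_def)
  have QS: "Q \<subseteq> S"
  proof
    fix x assume "x \<in> Q"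
    then obtain y where y: "y \<in> P" "x = g \<otimes> y \<otimes> inv g" by (auto simp: Q_def)
    have yG: "y \<in> carrier G" using y PG by blast
    have "h x = w \<otimes>\<^bsub>H\<^esub> h y \<otimes>\<^bsub>H\<^esub> inv\<^bsub>H\<^esub> w" using y yG g by simp
    then have "h x \<in> h ` P" using H.normalizer_memD(2)[OF w hPH, of "h y"] y(1) by simp
    then show "x \<in> S" using S_iff y yG g by simp
  qed
  obtain j where j: "card S = card P * j" "\<not> p dvd j"
    using G.sylow_cofactor[OF syl fin p SG PS] by blast
  have finS: "finite S" using finite_subset[OF subgroup.subset[OF SG] fin] .
  obtain t where t: "t \<in> S" "\<And>q. q \<in> Q \<Longrightarrow> t \<otimes> q \<otimes> inv t \<in> P"
    using G.sylow_conjugate_subset[OF finS SG P(1) PS j QG QS cQ p] by blast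
  obtain k y where ky: "k \<in> ?K" "y \<in> P" "t = k \<otimes> y" using t(1) by (auto simp: S_def set_mult_def)
  have kG: "k \<in> carrier G" "h k = \<one>\<^bsub>H\<^esub>" using ky(1) by (auto simp: kernel_def)
  have yG: "y \<in> carrier G" using ky(2) PG by blast
  text \<open>The factor \<open>y\<close> of \<open>t = k \<otimes> y\<close> normalises \<open>P\<close>, so it may be moved to the front.\<close>
  define x where "x = inv y \<otimes> (t \<otimes> g)"
  have tG: "t \<in> carrier G" using ky(3) kG yG by simp
  have "x \<in> normalizer G P"
  proof (rule G.normalizer_memI[OF finP PG])
    show "x \<in> carrier G" using yG tG g by (simp add: x_def)
    fix u assume u: "u \<in> P"
    have uG: "u \<in> carrier G" using u PG by blast
    have "x \<otimes> u \<otimes> inv x = inv y \<otimes> (t \<otimes> (g \<otimes> u \<otimes> inv g) \<otimes> inv t) \<otimes> y"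
      using uG yG tG g by (simp add: x_def G.inv_mult_group G.m_assoc)
    moreover have "t \<otimes> (g \<otimes> u \<otimes> inv g) \<otimes> inv t \<in> P" using t(2) u by (simp add: Q_def)
    ultimately show "x \<otimes> u \<otimes> inv x \<in> P"
      using subgroup.m_closed[OF P(1)] subgroup.m_inv_closed[OF P(1)] ky(2) by simp
  qed
  moreover have "h x = w"
    using kG yG g(1) by (simp add: x_def ky(3) g(2) H.m_assoc flip: H.m_assoc)
  ultimately show "w \<in> h ` normalizer G P" by blast
qed

text \<open>Take the first term of a composition series of \<open>N\<close> with nontrivial image.
  The preceding term dies, so this image has order dividing that of a composition factor. It is then
  replaced by normal subgroups of larger and larger groups, up to \<open>H\<close>.\<close>

lemma (in group_hom) p_solvable_image_normal_subgroup:
  assumes fin: "finite (carrier G)" and surj: "h ` carrier G = carrier H"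
    and p: "Factorial_Ring.prime p" and N: "N \<lhd> G" and solv: "p_solvable p (G.subgrp N)"
    and ne: "h ` N \<noteq> {\<one>\<^bsub>H\<^esub>}"
  shows "\<exists>L. L \<lhd> H \<and> L \<noteq> {\<one>\<^bsub>H\<^esub>} \<and> L \<subseteq> h ` N \<and> ((\<exists>a. card L = p ^ a) \<or> \<not> p dvd card L)"
proof -
  have NG: "subgroup N G" using N by (rule normal_imp_subgroup)
  have finN: "finite N" using finite_subset[OF subgroup.subset[OF NG] fin] .
  interpret N: group "G.subgrp N" using subgroup.subgroup_is_group[OF NG G.is_group] .
  obtain Hs where Hs: "composition_series (G.subgrp N) Hs"
    using N.composition_series_exists finN by auto
  then have Hs': "Hs \<noteq> []" "hd Hs = {\<one>}" "last Hs = N"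
    "\<And>i. Suc i < length Hs \<Longrightarrow> subgroup (Hs ! Suc i) (G.subgrp N)"
    "\<And>i. Suc i < length Hs \<Longrightarrow> Hs ! i \<lhd> G.subgrp (Hs ! Suc i)"
    by (auto simp: composition_series_def)
  have Hs0: "Hs ! 0 = {\<one>}" using Hs'(1,2) by (simp add: hd_conv_nth)
  define m where "m = length Hs - 1"
  have m: "Suc m = length Hs" using Hs'(1) by (simp add: m_def)
  have Hsm: "Hs ! m = N" using Hs'(1,3) by (simp add: m_def last_conv_nth)
  have subG: "subgroup (Hs ! i) G" if "i \<le> m" for i
  proof (cases i)
    case 0
    then show ?thesis using G.triv_subgroup by (simp add: Hs0)
  next
    case (Suc k)
    then show ?thesis using G.incl_subgroup[OF NG Hs'(4)[of k]] that m by simp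
  qed
  have finHs: "finite (Hs ! i)" if "i \<le> m" for i
    using finite_subset[OF subgroup.subset[OF subG[OF that]] fin] .
  define j where "j = (LEAST i. h ` (Hs ! i) \<noteq> {\<one>\<^bsub>H\<^esub>})"
  have m_ne: "h ` (Hs ! m) \<noteq> {\<one>\<^bsub>H\<^esub>}" using ne by (simp add: Hsm)
  have j_ne: "h ` (Hs ! j) \<noteq> {\<one>\<^bsub>H\<^esub>}"
    unfolding j_def by (rule LeastI[of "\<lambda>i. h ` (Hs ! i) \<noteq> {\<one>\<^bsub>H\<^esub>}", OF m_ne])
  have jm: "j \<le> m" unfolding j_def by (rule Least_le) (rule m_ne)
  have "j \<noteq> 0" using j_ne Hs0 by (cases "j = 0") auto
  then obtain i where i: "j = Suc i" by (cases j) auto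
  have hB: "h ` (Hs ! i) = {\<one>\<^bsub>H\<^esub>}"
    using not_less_Least[of i "\<lambda>i. h ` (Hs ! i) \<noteq> {\<one>\<^bsub>H\<^esub>}"] i by (simp add: j_def)
  let ?A = "Hs ! j" and ?B = "Hs ! i"
  have AG: "subgroup ?A G" and finA: "finite ?A" using subG finHs jm by auto
  have BG: "subgroup ?B G" using subG jm i by simp
  have BA: "?B \<lhd> G.subgrp ?A" using Hs'(5)[of i] jm m i by simp
  interpret A: group "G.subgrp ?A" using subgroup.subgroup_is_group[OF AG G.is_group] .
  define q where "q = Coset.order (G.subgrp ?A Mod ?B)"
  have "composition_factor (G.subgrp N) (G.subgrp ?A Mod ?B)"
    unfolding composition_factor_def using Hs jm m i by (intro exI[of _ Hs] exI[of _ i]) auto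
  then have q: "q = p \<or> \<not> p dvd q" using solv unfolding p_solvable_def q_def by blast
  have qB: "q * card ?B = card ?A"
    using A.lagrange[OF normal_imp_subgroup[OF BA]] by (simp add: q_def Coset.order_def FactGroup_def)
  have card_dvd: "card (h ` ?A) dvd q"
  proof -
    let ?K = "{x \<in> ?A. h x = \<one>\<^bsub>H\<^esub>}"
    have "?B \<subseteq> ?K" using hB subgroup.subset[OF normal_imp_subgroup[OF BA]] by auto
    then have "card ?B dvd card ?K" by (rule G.card_subgroup_dvd[OF BG kernel_in_subgroup[OF AG]])
    then obtain l where l: "card ?K = card ?B * l" by (elim dvdE)
    have "card (h ` ?A) * card ?K = q * card ?B" using card_image_kernel[OF AG finA] qB by simp
    then have "(card (h ` ?A) * l) * card ?B = q * card ?B" by (simp add: l mult_ac)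
    moreover have "card ?B > 0"
      using finHs[of i] jm i subgroup.one_closed[OF BG] by (auto simp: card_gt_0_iff)
    ultimately show ?thesis by auto
  qed
  define \<pi> where "\<pi> c = (if q = p then \<exists>a. c = p ^ a else \<not> p dvd c)" for c
  have \<pi>A: "\<pi> (card (h ` ?A))"
  proof (cases "q = p")
    case True
    then have "card (h ` ?A) dvd p ^ 1" using card_dvd by simp
    then have "\<exists>a. card (h ` ?A) = p ^ a" using iffD1[OF divides_primepow_nat[OF p]] by blast
    then show ?thesis using True by (simp add: \<pi>_def)
  next
    case False
    then have "\<not> p dvd card (h ` ?A)" using q dvd_trans[OF _ card_dvd, of p] by blast
    then show ?thesis using False by (simp add: \<pi>_def)
  qed
  have \<pi>_closed: "\<pi> c" if ab: "\<pi> a" "\<pi> b" and c: "c dvd a * b" for a b c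
  proof (cases "q = p")
    case True
    then obtain k l where "a = p ^ k" "b = p ^ l" using ab by (auto simp: \<pi>_def)
    then have "c dvd p ^ (k + l)" using c by (simp add: power_add)
    then have "\<exists>a. c = p ^ a" using iffD1[OF divides_primepow_nat[OF p]] by blast
    then show ?thesis using True by (simp add: \<pi>_def)
  next
    case False
    then have "\<not> p dvd a * b" using ab p False by (simp add: \<pi>_def prime_dvd_mult_iff)
    then have "\<not> p dvd c" using dvd_trans[OF _ c, of p] by blast
    then show ?thesis using False by (simp add: \<pi>_def)
  qed
  have finI: "finite (h ` (Hs ! k))" if "k \<le> m" for k using finHs[OF that] by simp
  \<comment> \<open>Normality is not transitive, so \<open>L\<close> is replaced at each step by the
    largest normal \<pi>-subgroup of the previous term.\<close>
  have chain: "\<exists>L. L \<lhd> H.subgrp (h ` (Hs ! k)) \<and> L \<noteq> {\<one>\<^bsub>H\<^esub>} \<and> \<pi> (card L)" if "j \<le> k" "k \<le> m" for k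
    using that
  proof (induction k rule: dec_induct)
    case base
    interpret hA: group "H.subgrp (h ` ?A)"
      using subgroup.subgroup_is_group[OF subgroup_img_is_subgroup[OF AG] H.is_group] .
    show ?case using hA.normal_self j_ne \<pi>A by auto
  next
    case (step k)
    then obtain L where L: "L \<lhd> H.subgrp (h ` (Hs ! k))" "L \<noteq> {\<one>\<^bsub>H\<^esub>}" "\<pi> (card L)" by auto
    have sk: "subgroup (Hs ! Suc k) G" using subG step by simp
    interpret hk: group "H.subgrp (h ` (Hs ! Suc k))"
      using subgroup.subgroup_is_group[OF subgroup_img_is_subgroup[OF sk] H.is_group] .
    have "Hs ! k \<lhd> G.subgrp (Hs ! Suc k)" using Hs'(5)[of k] step m by simp
    then have nk: "h ` (Hs ! k) \<lhd> H.subgrp (h ` (Hs ! Suc k))"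
      by (rule normal.surj_hom_normal_subgroup[OF _ induced_group_hom[OF sk]]) simp
    have fk: "finite (carrier (H.subgrp (h ` (Hs ! Suc k))))" using finI[OF step.prems] by simp
    have "\<exists>L'. L' \<lhd> H.subgrp (h ` (Hs ! Suc k)) \<and> L' \<noteq> {\<one>\<^bsub>H.subgrp (h ` (Hs ! Suc k))\<^esub>} \<and>
        \<pi> (card L') \<and> L' \<subseteq> h ` (Hs ! k)"
    proof (rule hk.lift_normal_pi_subgroup[where \<pi> = \<pi> and L = L, OF fk nk])
      show "\<pi> c" if "\<pi> a" "\<pi> b" "c dvd a * b" for a b c using that by (rule \<pi>_closed)
    qed (use L in simp_all)
    then show ?case by auto
  qed
  obtain L where L: "L \<lhd> H.subgrp (h ` N)" "L \<noteq> {\<one>\<^bsub>H\<^esub>}" "\<pi> (card L)"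
    using chain[OF jm order_refl] by (auto simp: Hsm)
  have hN: "h ` N \<lhd> H" by (rule normal.surj_hom_normal_subgroup[OF N group_hom_axioms surj])
  have finH: "finite (carrier H)" using fin by (simp flip: surj)
  have "\<exists>L'. L' \<lhd> H \<and> L' \<noteq> {\<one>\<^bsub>H\<^esub>} \<and> \<pi> (card L') \<and> L' \<subseteq> h ` N"
  proof (rule H.lift_normal_pi_subgroup[where \<pi> = \<pi> and L = L, OF finH hN])
    show "\<pi> c" if "\<pi> a" "\<pi> b" "c dvd a * b" for a b c using that by (rule \<pi>_closed)
  qed (use L in simp_all)
  then obtain L' where L': "L' \<lhd> H" "L' \<noteq> {\<one>\<^bsub>H\<^esub>}" "\<pi> (card L')" "L' \<subseteq> h ` N" by blast
  have "(\<exists>a. card L' = p ^ a) \<or> \<not> p dvd card L'" using L'(3) by (auto simp: \<pi>_def split: if_splits)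
  then show ?thesis using L' by blast
qed

text \<open>By the Chinese remainder theorem \<open>s\<close> can be -1 modulo \<open>h\<close> and
  1 modulo each prime of \<open>N\<close> not dividing \<open>h\<close>; no prime factor of
  \<open>N\<close> then divides \<open>s\<close>. The prime \<open>r\<close> is among the
  latter.\<close>

lemma exists_galois_exponent:
  assumes N: "N > (0::nat)" and r: "Factorial_Ring.prime r" "r dvd N" and h: "coprime h r" "h > 0"
  shows "\<exists>s. coprime s N \<and> h dvd s + 1 \<and> [s = 1] (mod r)"
proof -
  define X where "X = {q. Factorial_Ring.prime q \<and> q dvd N \<and> \<not> q dvd h}"
  have finX: "finite X" by (rule finite_subset[of _ "{..N}"]) (use N in \<open>auto simp: X_def dvd_imp_le\<close>)
  have "coprime h (\<Prod>X)"
  proof (rule prod_coprime_right)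
    fix q assume "q \<in> X"
    then have "coprime q h" by (intro prime_imp_coprime) (auto simp: X_def)
    then show "coprime h q" by (rule iffD1[OF coprime_commute])
  qed
  \<comment> \<open>\<open>h - 1\<close> stands for -1 in the natural numbers.\<close>
  then obtain s where s: "[s = h - 1] (mod h)" "[s = 1] (mod \<Prod>X)"
    using binary_chinese_remainder_nat by blast
  have s1: "[s = 1] (mod q)" if "q \<in> X" for q
    by (rule cong_dvd_modulus_nat[OF s(2) dvd_prod_eqI[OF finX that]]) simp
  have "[s + 1 = (h - 1) + 1] (mod h)" using s(1) by (intro cong_add) auto
  moreover have "h - 1 + 1 = h" using h(2) by simp
  ultimately have "[s + 1 = h] (mod h)" by (simp only:)
  then have hs: "h dvd s + 1" by (simp add: cong_dvd_iff)
  have "coprime s N"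
  proof (rule ccontr)
    assume "\<not> coprime s N"
    then have "gcd s N \<noteq> 1" unfolding coprime_iff_gcd_eq_1 .
    then obtain q where "Factorial_Ring.prime q" "q dvd gcd s N" using prime_factor_nat by blast
    then have q: "Factorial_Ring.prime q" "q dvd s" "q dvd N" by simp_all
    have "\<not> q dvd 1" using q(1) by auto
    show False
    proof (cases "q dvd h")
      case True
      then have "q dvd s + 1" using hs by (rule dvd_trans)
      then have "q dvd 1" using q(2) by (simp only: dvd_add_right_iff)
      then show False using \<open>\<not> q dvd 1\<close> by contradiction
    next
      case False
      then have "[s = 1] (mod q)" using q by (intro s1) (simp add: X_def)
      then show False using q(2) \<open>\<not> q dvd 1\<close> cong_dvd_iff[of s 1 q] by blast
    qed
  qed
  moreover have "r \<in> X"
  proof -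
    have "\<not> r dvd h" using coprime_common_divisor[OF h(1), of r] r(1) by auto
    then show ?thesis using r by (simp add: X_def)
  qed
  ultimately show ?thesis using s1 hs by blast
qed

theorem theorem3:
  fixes G :: "('a, 'b) monoid_scheme" (structure)
    and p r d :: nat
    and P N :: "'a set"
    and \<chi> :: "'a \<Rightarrow> complex"
  assumes "group G" and "finite (carrier G)"
    and "Factorial_Ring.prime p" and "Factorial_Ring.prime r"
    and "sylow_subgroup G p P"
    and "gcd (card (normalizer G P)) (2 * r) = 1"
    and "irreducible_character G \<chi>"
    and "\<chi> \<one> = of_nat d" and "\<not> p dvd d"
    and "\<forall>g\<in>carrier G. \<chi> g \<in> cyclotomic_field r"
    and "N \<lhd> G" and "p_solvable p (G\<lparr>carrier := N\<rparr>)"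
  shows "N \<subseteq> character_kernel G \<chi>"
proof -
  obtain n \<rho> where irr: "irreducible_representation G n \<rho>"
    and chi: "\<And>g. g \<in> carrier G \<Longrightarrow> \<chi> g = mat_trace (\<rho> g)"
    using assms(7) unfolding irreducible_character_def by blast
  have rep: "representation G n \<rho>" using irr by (simp add: irreducible_representation_def)
  \<comment> \<open>On the image the representation is faithful, so a subgroup acting trivially is
    trivial.\<close>
  let ?H = "matrix_group G n \<rho>"
  interpret group_hom G ?H \<rho> by (rule group_hom_matrix_group[OF assms(1) rep])
  interpret fmat_rep ?H n fmat_of_mat by (rule fmat_rep_matrix_group[OF assms(1,2) irr])
  have surj: "\<rho> ` carrier G = carrier ?H" by simp
  have carr: "x \<in> carrier_mat n n" if "x \<in> carrier ?H" for x
    using that representation_carrier_mat[OF rep] by auto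
  have NG: "N \<subseteq> carrier G" using subgroup.subset[OF normal_imp_subgroup[OF assms(11)]] .
  have PG: "subgroup P G" using assms(5) by (simp add: sylow_subgroup_def)
  have rho1: "\<rho> \<one> = 1\<^sub>m n" using hom_one by simp
  have "of_nat d = (of_nat n :: complex)" using chi[of \<one>] assms(8) rho1 by (simp add: mat_trace_def)
  then have dn: "d = n" by simp
  define k where "k = card (normalizer G P)"
  have normG: "subgroup (normalizer G P) G" using G.normalizer_imp_subgroup[OF subgroup.subset[OF PG]] .
  have fin_norm: "finite (normalizer G P)" using finite_subset[OF subgroup.subset[OF normG] assms(2)] .
  have k0: "k > 0" using fin_norm subgroup.one_closed[OF normG] by (auto simp: k_def card_gt_0_iff)
  have "coprime k (2 * r)" using assms(6) unfolding k_def coprime_iff_gcd_eq_1 .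
  then have k2: "odd k" and kr: "coprime k r" by auto
  \<comment> \<open>The exponent is chosen for |N_G(P)|; this divisibility transfers its congruence,
    and oddness, to the normalizer in the image.\<close>
  have "card (normalizer ?H (\<rho> ` P)) dvd card (\<rho> ` normalizer G P)"
    by (rule H.card_subgroup_dvd[OF H.normalizer_imp_subgroup subgroup_img_is_subgroup[OF normG]
          normalizer_image[OF assms(2) surj assms(3,5)]])
      (rule subgroup.subset[OF subgroup_img_is_subgroup[OF PG]])
  also have "\<dots> dvd k" using card_image_kernel[OF normG fin_norm] by (simp add: k_def)
  finally have Hk: "card (normalizer ?H (\<rho> ` P)) dvd k" .
  \<comment> \<open>The factor \<open>r\<close> makes a power of \<open>z\<close> generate
    \<open>cyclotomic_field r\<close>, and the factor |G| covers the orders of all group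
    elements.\<close>
  define M where "M = card (carrier G) * r"
  have cG: "card (carrier G) > 0" using assms(2) G.one_closed by (auto simp: card_gt_0_iff)
  have M0: "M > 0" using cG prime_gt_0_nat[OF assms(4)] by (simp add: M_def)
  have "card (carrier G) = card (carrier ?H) * card {x \<in> carrier G. \<rho> x = \<one>\<^bsub>?H\<^esub>}"
    using card_image_kernel[OF G.subgroup_self assms(2)] by simp
  then have "card (carrier ?H) dvd card (carrier G)" by (rule dvdI)
  then have HM: "card (carrier ?H) dvd M" unfolding M_def by (rule dvd_mult2)
  obtain s where s: "coprime s M" "k dvd s + 1" "[s = 1] (mod r)"
    using exists_galois_exponent[OF M0 assms(4) _ kr k0] by (auto simp: M_def)
  define z where "z = cis (2 * pi / real M)"
  have zM: "z ^ M = 1" using M0 by (simp add: z_def DeMoivre)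
  have zr: "z ^ card (carrier G) = cis (2 * pi / real r)"
    using cG by (simp add: z_def M_def DeMoivre)
  \<comment> \<open>The trace of x^s is F(z^s) with the same F for all s; F(z) is a character value,
    so it lies in the field fixed by the exponent.\<close>
  have galois: "tr (fmat_of_mat (x [^]\<^bsub>?H\<^esub> s)) = tr (fmat_of_mat x)" if x: "x \<in> carrier ?H" for x
  proof -
    have "x [^]\<^bsub>?H\<^esub> M = \<one>\<^bsub>?H\<^esub>" by (rule H.dvd_card_pow_one[OF HM x])
    moreover have "fmat_of_mat x * idm n = idm n * fmat_of_mat x" using rho_idm[OF x] by simp
    ultimately have "\<exists>F. \<forall>s::nat. tr (fmat_of_mat (x [^]\<^bsub>?H\<^esub> s) * idm n) = ipoly F (z ^ s)"
      by (rule tr_power_ipoly[OF z_def M0 x _ idm_mult(1)[OF supp_le_idm] supp_le_idm])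
    then obtain F where F: "\<And>s::nat. tr (fmat_of_mat (x [^]\<^bsub>?H\<^esub> s) * idm n) = ipoly F (z ^ s)"
      by blast
    have F': "tr (fmat_of_mat (x [^]\<^bsub>?H\<^esub> s)) = ipoly F (z ^ s)" for s :: nat
      using F[of s] rho_idm(2)[OF H.nat_pow_closed[OF x]] by simp
    obtain g where g: "g \<in> carrier G" "x = \<rho> g" using x by auto
    have F1: "tr (fmat_of_mat x) = ipoly F z"
      using F'[of 1] unfolding H.nat_pow_eone[OF x] power_one_right .
    then have "ipoly F z = \<chi> g"
      using g chi tr_fmat_of_mat[OF carr[OF x]] by simp
    then have "ipoly F (z ^ s) = ipoly F z"
      using assms(10) g prime_gt_0_nat[OF assms(4)]
      by (intro cyclotomic_field_galois_fixed[OF zM M0 s(1,3) _ zr]) auto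
    then show ?thesis using F'[of s] F1 by simp
  qed
  have "\<rho> ` N = {\<one>\<^bsub>?H\<^esub>}"
  proof (rule ccontr)
    assume "\<rho> ` N \<noteq> {\<one>\<^bsub>?H\<^esub>}"
    then obtain L where L: "L \<lhd> ?H" "L \<noteq> {\<one>\<^bsub>?H\<^esub>}" "(\<exists>a. card L = p ^ a) \<or> \<not> p dvd card L"
      using p_solvable_image_normal_subgroup[OF assms(2) surj assms(3,11,12)] by blast
    interpret fmat_rep_normal ?H n fmat_of_mat L
      by (intro fmat_rep_normal.intro fmat_rep_axioms fmat_rep_normal_axioms.intro L(1))
    obtain a where a: "card L = p ^ a \<or> \<not> p dvd card L" using L(3) by blast
    have odd: "odd (card (normalizer ?H (\<rho> ` P)))" using k2 Hk dvd_trans by blast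
    have HL: "card (normalizer ?H (\<rho> ` P)) dvd s + 1" using Hk s(2) dvd_trans by blast
    have "\<forall>x\<in>L. fmat_of_mat x = idm n"
      by (rule acts_trivially[OF assms(3) sylow_image[OF assms(2) surj assms(3,5)] _ a odd M0 HM s(1) HL])
        (use assms(9) dn galois memG in auto)
    then have "x = 1\<^sub>m n" if "x \<in> L" for x
      using fmat_of_mat_inject[OF carr[OF memG[OF that]], of "1\<^sub>m n"] that by (simp add: idm_def)
    then have "L \<subseteq> {1\<^sub>m n}" by blast
    moreover have "1\<^sub>m n \<in> L" using memM(1) by simp
    ultimately show False using L(2) by auto
  qed
  then have "\<rho> g = \<rho> \<one>" if "g \<in> N" for g using that rho1 by auto
  then show ?thesis using NG chi by (auto simp: character_kernel_def)
qed

end
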